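(* Let $(X,\rho,|\cdot|)$ be a homogeneous space and let $T$ be a Calderón–Zygmund operator on $X$. Then there is a constant $C(T,X)$, depending only on $T$ and $X$, such that for every weight $w\in A_2$, $$\|T\|_{L^2(w)}\le C(T,X)\,[w]_{A_2},$$ where $\|T\|_{L^2(w)}$ denotes the operator norm of $T$ on $L^2(w)$; that is, $\|Tf\|_{L^2(w)}\le C(T,X)[w]_{A_2}\|f\|_{L^2(w)}$.
   Context: Homogeneous space: a triple $(X,\rho,|\cdot|)$ where $X$ is a set, $\rho:X\times X\to[0,\infty)$ is a quasimetric, i.e. $\rho(x,y)=0$ iff $x=y$, $\rho(x,y)=\rho(y,x)$, and $\rho(x,z)\le C_0(\rho(x,y)+\rho(y,z))$ for all $x,y,z\in X$ with a constant $C_0>0$; and $|\cdot|$ is a positive (Borel) measure on $X$ for which balls $B(x,r)=\{y:\rho(x,y)<r\}$ are measurable and which is doubling: $0<|B(x,2r)|\le C_d|B(x,r)|<\infty$ for all $x\in X$, $r>0$, with a constant $C_d$. Integrals without explicit measure are with respect to $|\cdot|$, and $⨍_E f=\frac1{|E|}\int_E f$ denotes the average. Calderón–Zygmund kernel: a function $K:(X\times X)\setminus\{x=y\}\to\mathbb R$ for which there exist $\eta>0$ and $C<\infty$ such that for all $x_0\ne y$ in $X$: $|K(x_0,y)|\le \frac{C}{|B(x_0,\rho(x_0,y))|}$, and for all $x\in X$ with $\rho(x_0,x)\le\eta\,\rho(x_0,y)$, $$|K(x,y)-K(x_0,y)|\le\Big(\frac{\rho(x,x_0)}{\rho(x_0,y)}\Big)^{\eta}\frac1{|B(x_0,\rho(x_0,y))|},\qquad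 |K(y,x)-K(y,x_0)|\le\Big(\frac{\rho(x,x_0)}{\rho(x_0,y)}\Big)^{\eta}\frac1{|B(x_0,\rho(x_0,y))|}.$$ Calderón–Zygmund operator: a linear operator $T$ that is bounded on $L^2(X)$ and is a singular integral operator associated to a Calderón–Zygmund kernel $K$, i.e. $Tf(x)=\int_X K(x,y)f(y)\,dy$ for $x$ outside the support of $f$. Weight: a nonnegative locally integrable function $w$ on $X$. $w\in A_2$ means $[w]_{A_2}:=\sup_{x\in X,\,r>0}\big(⨍_{B(x,r)}w\big)\big(⨍_{B(x,r)}w^{-1}\big)<\infty$. $\|f\|_{L^2(w)}^2=\int_X|f|^2w$. The operator norm on $L^2(w)$ is understood via functions $f\in L^2(X)\cap L^2(w)$ (on which $T$ is already defined) and extension by density. *)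

theory Defs
  imports "HOL-Analysis.Analysis"
begin

text \<open>The underlying set of a homogeneous space is \<open>space M\<close>, and the values of
  \<open>\<rho>\<close>, of kernels and of functions outside \<open>space M\<close> are irrelevant.\<close>

definition qball :: "'a measure \<Rightarrow> ('a \<Rightarrow> 'a \<Rightarrow> real) \<Rightarrow> 'a \<Rightarrow> real \<Rightarrow> 'a set" where
  "qball M \<rho> x r = {y \<in> space M. \<rho> x y < r}"

definition quasimetric_on :: "'a set \<Rightarrow> ('a \<Rightarrow> 'a \<Rightarrow> real) \<Rightarrow> bool" where
  "quasimetric_on X \<rho> \<longleftrightarrow>
     (\<forall>x\<in>X. \<forall>y\<in>X. 0 \<le> \<rho> x y \<and> (\<rho> x y = 0 \<longleftrightarrow> x = y) \<and> \<rho> x y = \<rho> y x) \<and>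
     (\<exists>C0>0. \<forall>x\<in>X. \<forall>y\<in>X. \<forall>z\<in>X. \<rho> x z \<le> C0 * (\<rho> x y + \<rho> y z))"

text \<open>The open sets of the topology induced by \<open>\<rho>\<close>. Balls of a quasimetric need not be open,
  and need not even be Borel sets.\<close>

definition qopens :: "'a measure \<Rightarrow> ('a \<Rightarrow> 'a \<Rightarrow> real) \<Rightarrow> 'a set set" where
  "qopens M \<rho> = {U. U \<subseteq> space M \<and> (\<forall>x\<in>U. \<exists>r>0. qball M \<rho> x r \<subseteq> U)}"

definition homogeneous_space :: "'a measure \<Rightarrow> ('a \<Rightarrow> 'a \<Rightarrow> real) \<Rightarrow> bool" where
  "homogeneous_space M \<rho> \<longleftrightarrow>
     quasimetric_on (space M) \<rho> \<and>
     sets M = sigma_sets (space M) (qopens M \<rho>) \<and>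
     (\<forall>x\<in>space M. \<forall>r>0. qball M \<rho> x r \<in> sets M) \<and>
     (\<exists>Cd::real. \<forall>x\<in>space M. \<forall>r>0.
        0 < emeasure M (qball M \<rho> x (2 * r)) \<and>
        emeasure M (qball M \<rho> x (2 * r)) \<le> ennreal Cd * emeasure M (qball M \<rho> x r) \<and>
        ennreal Cd * emeasure M (qball M \<rho> x r) < \<infinity>)"

text \<open>A kernel is a function on pairs of distinct points, so the smoothness conditions are only
  imposed where both terms are off-diagonal (for \<open>\<eta> < 1\<close> the side condition \<open>x \<noteq> y\<close>
  is automatic).\<close>

definition cz_kernel :: "'a measure \<Rightarrow> ('a \<Rightarrow> 'a \<Rightarrow> real) \<Rightarrow> ('a \<Rightarrow> 'a \<Rightarrow> real) \<Rightarrow> bool" where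
  "cz_kernel M \<rho> K \<longleftrightarrow>
     (\<exists>\<eta>>0. \<exists>C::real. \<forall>x0\<in>space M. \<forall>y\<in>space M. x0 \<noteq> y \<longrightarrow>
        \<bar>K x0 y\<bar> \<le> C / measure M (qball M \<rho> x0 (\<rho> x0 y)) \<and>
        (\<forall>x\<in>space M. x \<noteq> y \<and> \<rho> x0 x \<le> \<eta> * \<rho> x0 y \<longrightarrow>
           \<bar>K x y - K x0 y\<bar>
             \<le> (\<rho> x x0 / \<rho> x0 y) powr \<eta> * (1 / measure M (qball M \<rho> x0 (\<rho> x0 y))) \<and>
           \<bar>K y x - K y x0\<bar>
             \<le> (\<rho> x x0 / \<rho> x0 y) powr \<eta> * (1 / measure M (qball M \<rho> x0 (\<rho> x0 y)))))"

text \<open>The norm of \<open>L\<^sup>2(w)\<close>, where \<open>w\<close> is nonnegative on \<open>space M\<close>;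
  infinite if the function is not square integrable.\<close>

definition L2_norm :: "'a measure \<Rightarrow> ('a \<Rightarrow> real) \<Rightarrow> ('a \<Rightarrow> real) \<Rightarrow> ennreal" where
  "L2_norm M w f =
     (let I = (\<integral>\<^sup>+x. ennreal (\<bar>f x\<bar>\<^sup>2 * w x) \<partial>M)
      in if I = \<infinity> then \<infinity> else ennreal (sqrt (enn2real I)))"

definition L2_space :: "'a measure \<Rightarrow> ('a \<Rightarrow> real) \<Rightarrow> ('a \<Rightarrow> real) set" where
  "L2_space M w = {f \<in> borel_measurable M. L2_norm M w f < \<infinity>}"

abbreviation one_weight :: "'a \<Rightarrow> real" where
  "one_weight \<equiv> (\<lambda>_. 1)"

text \<open>The support of an almost-everywhere class of functions: the complement of the set of points
  near which the function vanishes almost everywhere.\<close>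

definition ess_support :: "'a measure \<Rightarrow> ('a \<Rightarrow> 'a \<Rightarrow> real) \<Rightarrow> ('a \<Rightarrow> real) \<Rightarrow> 'a set" where
  "ess_support M \<rho> f =
     {x \<in> space M. \<forall>r>0. \<not> (AE y in M. y \<in> qball M \<rho> x r \<longrightarrow> f y = 0)}"

text \<open>Operators act on representatives, and all identities hold almost everywhere.
  Linearity and boundedness imply that \<open>T\<close> respects almost-everywhere equality.\<close>

definition linear_on_L2 :: "'a measure \<Rightarrow> (('a \<Rightarrow> real) \<Rightarrow> ('a \<Rightarrow> real)) \<Rightarrow> bool" where
  "linear_on_L2 M T \<longleftrightarrow>
     (\<forall>f\<in>L2_space M one_weight. \<forall>g\<in>L2_space M one_weight. \<forall>a b.
        AE x in M. T (\<lambda>y. a * f y + b * g y) x = a * T f x + b * T g x)"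

definition bounded_on_L2 :: "'a measure \<Rightarrow> (('a \<Rightarrow> real) \<Rightarrow> ('a \<Rightarrow> real)) \<Rightarrow> bool" where
  "bounded_on_L2 M T \<longleftrightarrow>
     (\<exists>B::real. \<forall>f\<in>L2_space M one_weight.
        T f \<in> L2_space M one_weight \<and>
        L2_norm M one_weight (T f) \<le> ennreal B * L2_norm M one_weight f)"

definition associated_kernel ::
  "'a measure \<Rightarrow> ('a \<Rightarrow> 'a \<Rightarrow> real) \<Rightarrow> (('a \<Rightarrow> real) \<Rightarrow> ('a \<Rightarrow> real)) \<Rightarrow>
   ('a \<Rightarrow> 'a \<Rightarrow> real) \<Rightarrow> bool" where
  "associated_kernel M \<rho> T K \<longleftrightarrow>
     (\<forall>f\<in>L2_space M one_weight. AE x in M.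
        x \<notin> ess_support M \<rho> f \<longrightarrow> has_bochner_integral M (\<lambda>y. K x y * f y) (T f x))"

definition cz_operator ::
  "'a measure \<Rightarrow> ('a \<Rightarrow> 'a \<Rightarrow> real) \<Rightarrow> (('a \<Rightarrow> real) \<Rightarrow> ('a \<Rightarrow> real)) \<Rightarrow> bool" where
  "cz_operator M \<rho> T \<longleftrightarrow>
     linear_on_L2 M T \<and> bounded_on_L2 M T \<and>
     (\<exists>K. cz_kernel M \<rho> K \<and> associated_kernel M \<rho> T K)"

definition weight :: "'a measure \<Rightarrow> ('a \<Rightarrow> 'a \<Rightarrow> real) \<Rightarrow> ('a \<Rightarrow> real) \<Rightarrow> bool" where
  "weight M \<rho> w \<longleftrightarrow>
     w \<in> borel_measurable M \<and> (\<forall>x\<in>space M. 0 \<le> w x) \<and>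
     (\<forall>x\<in>space M. \<forall>r>0. set_integrable M (qball M \<rho> x r) w)"

definition average :: "'a measure \<Rightarrow> 'a set \<Rightarrow> ('a \<Rightarrow> ennreal) \<Rightarrow> ennreal" where
  "average M E g = (\<integral>\<^sup>+x\<in>E. g x \<partial>M) / emeasure M E"

text \<open>The inverse is taken in \<open>ennreal\<close>, so that it is infinite where \<open>w\<close> vanishes.\<close>

definition A2_const :: "'a measure \<Rightarrow> ('a \<Rightarrow> 'a \<Rightarrow> real) \<Rightarrow> ('a \<Rightarrow> real) \<Rightarrow> ennreal" where
  "A2_const M \<rho> w =
     (SUP (x, r) \<in> space M \<times> {0<..}.
        average M (qball M \<rho> x r) (\<lambda>y. ennreal (w y)) *
        average M (qball M \<rho> x r) (\<lambda>y. inverse (ennreal (w y))))"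

definition A2_weight :: "'a measure \<Rightarrow> ('a \<Rightarrow> 'a \<Rightarrow> real) \<Rightarrow> ('a \<Rightarrow> real) \<Rightarrow> bool" where
  "A2_weight M \<rho> w \<longleftrightarrow> weight M \<rho> w \<and> A2_const M \<rho> w < \<infinity>"

text \<open>The supremum over the dense subspace \<open>L\<^sup>2 \<inter> L\<^sup>2(w)\<close> is the operator norm
  of the extension of \<open>T\<close> to \<open>L\<^sup>2(w)\<close>.\<close>

definition op_norm_L2 ::
  "'a measure \<Rightarrow> ('a \<Rightarrow> real) \<Rightarrow> (('a \<Rightarrow> real) \<Rightarrow> ('a \<Rightarrow> real)) \<Rightarrow> ennreal" where
  "op_norm_L2 M w T =
     (SUP f \<in> {f \<in> L2_space M one_weight \<inter> L2_space M w. L2_norm M w f \<le> 1}.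
        L2_norm M w (T f))"

end

theory Submission
  imports Defs
begin

text \<open>
  The proof is by sparse domination. On a system of dyadic cubes, a Calderon--Zygmund decomposition
  gives the weak type \<open>(1,1)\<close> bound. Together with the small oscillation of \<open>T (f 1\<^bsub>X - \<alpha>P\<^esub>)\<close> on a
  cube \<open>P\<close>, it allows one to pass from a cube \<open>Q\<close> to a family of subcubes of at most half the total
  measure: outside them \<open>\<bar>T (f 1\<^bsub>\<alpha>Q\<^esub>)\<bar>\<close> is at most a multiple of the average of \<open>\<bar>f\<bar>\<close> over \<open>\<alpha>Q\<close>, and on
  each subcube \<open>P\<close> it exceeds \<open>\<bar>T (f 1\<^bsub>\<alpha>P\<^esub>)\<bar>\<close> by no more than that. Iterating bounds
  \<open>\<integral> \<bar>T f\<bar> g\<close> by a sum of \<open>(\<alpha>Q-average of \<bar>f\<bar>) * \<integral>\<^sub>Q g\<close> over a sparse family of cubes \<open>Q\<close>.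

  For a sparse family, the dilated cubes can be enlarged to boundedly many families in which any two
  sets are nested or disjoint. Writing averages with respect to \<open>dx\<close> as averages with respect to the
  measures \<open>w\<inverse> dx\<close> and \<open>w dx\<close> costs exactly one factor \<open>[w]\<close>, and the maximal operators of nested
  families are bounded on \<open>L\<^sup>2\<close> of any measure with an absolute constant, so the estimate is linear in \<open>[w]\<close>.
\<close>

section \<open>Doubling quasi-metric spaces\<close>

text \<open>The constant may depend on \<open>T\<close> and \<open>X\<close> only and the bound must
  be linear in \<open>[w]\<close>, so the weight may enter only after \<open>T\<close> has been
  eliminated: the sparse bound is unweighted, and its constant is made of \<open>A\<close>,
  \<open>D\<close>, \<open>\<eta>\<close> and \<open>b\<^sub>T\<close>. It is bilinear because each
  of \<open>f\<close> and \<open>g\<close> then receives its own measure, and because the norm in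
  \<open>L\<^sup>2(w)\<close> can be recovered by testing against truncations of
  \<open>\<bar>T f\<bar> * w\<close>.

  The dyadic system has a coarsest generation, of radius \<open>R\<close> about a point
  \<open>x\<^sub>0\<close>. No constant depends on these two, so they are chosen last, such that one
  cube contains the supports of \<open>f\<close> and \<open>g\<close>. The price is that the
  coarsest cubes have no parents, and stopping arguments need a hypothesis on them.

  Families of cubes are cut down to finite ones wherever \<open>T\<close> or a sum over them is
  involved. The errors of this are controlled by the square integral of \<open>f\<close> or by
  bounds for \<open>f\<close> and \<open>g\<close>, which must not enter the constant; they tend to
  zero for bounded functions of bounded support, and the general case is reached by
  truncation.\<close>

locale doubling_space =
  fixes M :: "'a measure" and \<rho> :: "'a \<Rightarrow> 'a \<Rightarrow> real" and A D :: real
  assumes A_ge_1: "1 \<le> A" and D_ge_1: "1 \<le> D"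
    and rho_nonneg: "\<And>x y. x \<in> space M \<Longrightarrow> y \<in> space M \<Longrightarrow> 0 \<le> \<rho> x y"
    and rho_zero: "\<And>x y. x \<in> space M \<Longrightarrow> y \<in> space M \<Longrightarrow> \<rho> x y = 0 \<longleftrightarrow> x = y"
    and rho_sym: "\<And>x y. x \<in> space M \<Longrightarrow> y \<in> space M \<Longrightarrow> \<rho> x y = \<rho> y x"
    and rho_tri: "\<And>x y z. x \<in> space M \<Longrightarrow> y \<in> space M \<Longrightarrow> z \<in> space M \<Longrightarrow>
                   \<rho> x z \<le> A * (\<rho> x y + \<rho> y z)"
    and sets_M: "sets M = sigma_sets (space M) (qopens M \<rho>)"
    and ball_sets: "\<And>x r. x \<in> space M \<Longrightarrow> 0 < r \<Longrightarrow> qball M \<rho> x r \<in> sets M"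
    and ball_finite: "\<And>x r. x \<in> space M \<Longrightarrow> 0 < r \<Longrightarrow> emeasure M (qball M \<rho> x r) < \<infinity>"
    and ball_pos: "\<And>x r. x \<in> space M \<Longrightarrow> 0 < r \<Longrightarrow> 0 < measure M (qball M \<rho> x r)"
    and ball_doubling: "\<And>x r. x \<in> space M \<Longrightarrow> 0 < r \<Longrightarrow>
          measure M (qball M \<rho> x (2 * r)) \<le> D * measure M (qball M \<rho> x r)"
begin

abbreviation B where "B \<equiv> qball M \<rho>"

definition V :: "'a \<Rightarrow> real \<Rightarrow> real" where "V x r = measure M (B x r)"

text \<open>A crude form of \<open>D powr log 2 c\<close>, which avoids logarithms because \<open>c \<le> 2 ^ nat \<lceil>c\<rceil>\<close>.\<close>

definition Dil :: "real \<Rightarrow> real" where "Dil c = D ^ nat \<lceil>c\<rceil>"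

lemma mem_B: "y \<in> B x r \<longleftrightarrow> y \<in> space M \<and> \<rho> x y < r"
  by (simp add: qball_def)

lemma rho_self: "x \<in> space M \<Longrightarrow> \<rho> x x = 0"
  using rho_zero by blast

lemma B_fmeasurable [measurable, intro]: "x \<in> space M \<Longrightarrow> B x r \<in> fmeasurable M"
proof (cases "0 < r")
  case False
  assume "x \<in> space M"
  with False have "B x r = {}"
    using rho_nonneg[of x] by (force simp: mem_B)
  then show ?thesis by simp
qed (auto intro!: fmeasurableI ball_sets ball_finite)

lemma B_sets [measurable, intro]: "x \<in> space M \<Longrightarrow> B x r \<in> sets M"
  using B_fmeasurable by blast

lemma V_pos: "x \<in> space M \<Longrightarrow> 0 < r \<Longrightarrow> 0 < V x r"
  by (simp add: V_def ball_pos)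

lemma emeasure_B: "x \<in> space M \<Longrightarrow> emeasure M (B x r) = ennreal (V x r)"
  unfolding V_def using B_fmeasurable[of x r] by (simp add: emeasure_eq_measure2 fmeasurableD2 emeasure_eq_ennreal_measure)

lemma B_tri: "x \<in> space M \<Longrightarrow> y \<in> space M \<Longrightarrow> A * (\<rho> x y + s) \<le> r \<Longrightarrow> B y s \<subseteq> B x r"
proof
  fix p assume x: "x \<in> space M" and y: "y \<in> space M" and r: "A * (\<rho> x y + s) \<le> r" and "p \<in> B y s"
  then have p: "p \<in> space M" "\<rho> y p < s" by (auto simp: mem_B)
  have "\<rho> x p \<le> A * (\<rho> x y + \<rho> y p)" using rho_tri x y p by blast
  also have "\<dots> < A * (\<rho> x y + s)" using p A_ge_1 by simp
  finally show "p \<in> B x r" using p r by (simp add: mem_B)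
qed

lemma B_mono: "r \<le> s \<Longrightarrow> B x r \<subseteq> B x s"
  by (auto simp: mem_B)

lemma V_mono: "x \<in> space M \<Longrightarrow> r \<le> s \<Longrightarrow> V x r \<le> V x s"
  unfolding V_def by (intro measure_mono_fmeasurable B_mono) auto

lemma Dil_ge_1: "1 \<le> Dil c"
  unfolding Dil_def using D_ge_1 by simp

lemma Dil_pos: "0 < Dil c"
  using Dil_ge_1[of c] by linarith

lemma V_pow: "x \<in> space M \<Longrightarrow> 0 < r \<Longrightarrow> V x (2 ^ n * r) \<le> D ^ n * V x r"
proof (induction n)
  case (Suc n)
  have "V x (2 ^ Suc n * r) = V x (2 * (2 ^ n * r))" by (simp add: mult.assoc)
  also have "\<dots> \<le> D * V x (2 ^ n * r)" unfolding V_def using Suc.prems ball_doubling by simp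
  also have "\<dots> \<le> D * (D ^ n * V x r)" using Suc D_ge_1 by simp
  finally show ?case by (simp add: mult.assoc)
qed simp

lemma V_dil: assumes "x \<in> space M" "0 < r" shows "V x (c * r) \<le> Dil c * V x r"
proof -
  have "c \<le> real (nat \<lceil>c\<rceil>)" by linarith
  also have "\<dots> \<le> 2 ^ nat \<lceil>c\<rceil>" by (rule less_imp_le, rule of_nat_less_two_power)
  finally have "c * r \<le> 2 ^ nat \<lceil>c\<rceil> * r" using assms by simp
  then have "V x (c * r) \<le> V x (2 ^ nat \<lceil>c\<rceil> * r)" using V_mono assms by blast
  also have "\<dots> \<le> Dil c * V x r" unfolding Dil_def using V_pow assms by blast
  finally show ?thesis .
qed

lemma V_le:
  assumes "x \<in> space M" "y \<in> space M" "0 < r" "A * (\<rho> x y + s) \<le> c * r"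
  shows "V y s \<le> Dil c * V x r"
proof -
  have "V y s \<le> V x (c * r)" unfolding V_def
    using B_tri[OF assms(1,2,4)] assms by (intro measure_mono_fmeasurable) auto
  also have "\<dots> \<le> Dil c * V x r" using V_dil assms by blast
  finally show ?thesis .
qed

text \<open>The balls of radius \<open>r / (2 * A)\<close> about the points are disjoint and lie in
  \<open>B x (A * (c + 1) * r)\<close>. Each of them, dilated by \<open>K\<close>, contains that
  ball and so carries at least the fraction \<open>1 / Dil K\<close> of its volume.\<close>

lemma packing:
  assumes F: "finite F" "F \<subseteq> B x (c * r)" "\<And>z z'. z \<in> F \<Longrightarrow> z' \<in> F \<Longrightarrow> z \<noteq> z' \<Longrightarrow> r \<le> \<rho> z z'"
    and x: "x \<in> space M" and r: "0 < r" and c: "0 < c"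
  shows "real (card F) \<le> Dil (2 * A * A * (c + A * (c + 1)))"
proof -
  define K where "K = 2 * A * A * (c + A * (c + 1))"
  define b where "b z = B z (r / (2 * A))" for z
  have A0: "0 < A" using A_ge_1 by simp
  have FX: "z \<in> space M" "\<rho> x z < c * r" if "z \<in> F" for z using F(2) that by (auto simp: mem_B)
  have disj: "disjoint_family_on b F"
  proof (unfold disjoint_family_on_def, intro ballI impI)
    fix z z' assume z: "z \<in> F" "z' \<in> F" "z \<noteq> z'"
    show "b z \<inter> b z' = {}"
    proof (rule ccontr)
      assume "b z \<inter> b z' \<noteq> {}"
      then obtain p where p: "p \<in> space M" "\<rho> z p < r / (2 * A)" "\<rho> z' p < r / (2 * A)"
        unfolding b_def by (auto simp: mem_B)
      have "\<rho> z z' \<le> A * (\<rho> z p + \<rho> p z')" using rho_tri FX z p by blast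
      also have "\<dots> < A * (r / (2 * A) + r / (2 * A))"
        using p rho_sym[of z' p] FX z A0 by (intro mult_strict_left_mono add_strict_mono) auto
      also have "\<dots> = r" using A0 by (simp add: field_simps)
      finally show False using F(3)[OF z] by simp
    qed
  qed
  have sub: "b z \<subseteq> B x (A * (c + 1) * r)" if "z \<in> F" for z
    unfolding b_def
  proof (rule B_tri)
    have "r / (2 * A) \<le> r / 1" using A_ge_1 r by (intro divide_left_mono) auto
    then have "\<rho> x z + r / (2 * A) \<le> (c + 1) * r" using FX[OF that] by (simp add: algebra_simps)
    then show "A * (\<rho> x z + r / (2 * A)) \<le> A * (c + 1) * r" using A0 by (simp add: mult.assoc)
  qed (use FX that x in auto)
  have low: "V x (A * (c + 1) * r) / Dil K \<le> measure M (b z)" if "z \<in> F" for z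
  proof -
    have "A * (\<rho> z x + A * (c + 1) * r) \<le> A * (c * r + A * (c + 1) * r)"
      using FX[OF that] rho_sym[of z x] x A0 by simp
    also have "\<dots> = K * (r / (2 * A))" unfolding K_def using A0 by (simp add: field_simps)
    finally have "V x (A * (c + 1) * r) \<le> Dil K * V z (r / (2 * A))"
      using FX[OF that] x r A0 by (intro V_le) auto
    then show ?thesis using Dil_pos[of K] by (simp add: field_simps b_def V_def)
  qed
  have "real (card F) * (V x (A * (c + 1) * r) / Dil K) \<le> (\<Sum>z\<in>F. measure M (b z))"
    using low sum_mono[of F "\<lambda>_. V x (A * (c + 1) * r) / Dil K" "\<lambda>z. measure M (b z)"] by simp
  also have "\<dots> = measure M (\<Union>z\<in>F. b z)"
    using F(1) disj FX unfolding b_def by (intro measure_finite_Union[symmetric]) (auto simp: fmeasurableD2 B_fmeasurable)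
  also have "\<dots> \<le> V x (A * (c + 1) * r)" unfolding V_def
    using sub x FX F(1) unfolding b_def by (intro measure_mono_fmeasurable) auto
  finally have "real (card F) * (V x (A * (c + 1) * r) / Dil K) \<le> V x (A * (c + 1) * r)" .
  moreover have "0 < V x (A * (c + 1) * r)" using x r c A0 by (intro V_pos) auto
  ultimately show ?thesis using Dil_pos[of K] unfolding K_def by (simp add: field_simps)
qed

text \<open>The bound of \<open>packing\<close> is uniform over all finite subsets, which forces the
  set itself to be finite.\<close>

lemma separated_finite:
  assumes "S \<subseteq> B x s" "\<And>z z'. z \<in> S \<Longrightarrow> z' \<in> S \<Longrightarrow> z \<noteq> z' \<Longrightarrow> r \<le> \<rho> z z'"
    and x: "x \<in> space M" and r: "0 < r" and s: "0 < s"
  shows "finite S"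
proof -
  define N where "N = nat \<lceil>Dil (2 * A * A * (s / r + A * (s / r + 1)))\<rceil>"
  have "card F \<le> N" if "F \<subseteq> S" "finite F" for F
  proof -
    have "real (card F) \<le> Dil (2 * A * A * (s / r + A * (s / r + 1)))"
      using that assms by (intro packing[of F x "s / r" r]) (auto simp: subset_iff)
    then show ?thesis unfolding N_def by linarith
  qed
  then show ?thesis using finite_if_finite_subsets_card_bdd by blast
qed

text \<open>Greedy selection by largest radius. A ball of radius at most \<open>s\<close> that meets
  the chosen ball of radius \<open>s\<close> lies within \<open>A * (2 * A * s + s)\<close> of its
  centre, hence the factor \<open>3 * A\<^sup>2\<close>. The balls disjoint from the chosen one form
  the smaller family of the induction.\<close>

lemma vitali_finite:
  assumes "finite I" "\<And>i. i \<in> I \<Longrightarrow> c i \<in> space M" "\<And>i. i \<in> I \<Longrightarrow> 0 < s i"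
  shows "\<exists>J\<subseteq>I. disjoint_family_on (\<lambda>i. B (c i) (s i)) J \<and>
           (\<forall>i\<in>I. \<exists>j\<in>J. B (c i) (s i) \<subseteq> B (c j) (3 * A\<^sup>2 * s j))"
  using assms
proof (induction "card I" arbitrary: I rule: less_induct)
  case less
  show ?case
  proof (cases "I = {}")
    case False
    define m where "m = Max (s ` I)"
    have "m \<in> s ` I" unfolding m_def using False less.prems by (intro Max_in) auto
    then obtain i where i: "i \<in> I" "s i = m" by auto
    have im: "s j \<le> s i" if "j \<in> I" for j unfolding i m_def using that less.prems by (intro Max_ge) auto
    define I' where "I' = {j\<in>I. B (c j) (s j) \<inter> B (c i) (s i) = {}}"
    have ci: "c i \<in> B (c i) (s i)" using less.prems i by (auto simp: mem_B rho_self)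
    have "I' \<subset> I" unfolding I'_def using i ci by blast
    then have "card I' < card I" using less.prems by (intro psubset_card_mono)
    moreover have "finite I'" using \<open>I' \<subset> I\<close> less.prems(1) finite_subset by blast
    moreover have "c j \<in> space M" "0 < s j" if "j \<in> I'" for j using less.prems(2,3) that unfolding I'_def by auto
    ultimately have "\<exists>J\<subseteq>I'. disjoint_family_on (\<lambda>i. B (c i) (s i)) J \<and>
           (\<forall>i\<in>I'. \<exists>j\<in>J. B (c i) (s i) \<subseteq> B (c j) (3 * A\<^sup>2 * s j))"
      by (intro less.hyps)
    then obtain J where J: "J \<subseteq> I'" "disjoint_family_on (\<lambda>i. B (c i) (s i)) J"
      "\<forall>i\<in>I'. \<exists>j\<in>J. B (c i) (s i) \<subseteq> B (c j) (3 * A\<^sup>2 * s j)"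
      by blast
    have hit: "B (c j) (s j) \<subseteq> B (c i) (3 * A\<^sup>2 * s i)" if j: "j \<in> I" "j \<notin> I'" for j
    proof (rule B_tri)
      show X: "c i \<in> space M" "c j \<in> space M" using less.prems i j by auto
      obtain p where p: "p \<in> space M" "\<rho> (c j) p < s j" "\<rho> (c i) p < s i"
        using j unfolding I'_def by (auto simp: mem_B)
      have "\<rho> (c i) (c j) \<le> A * (\<rho> (c i) p + \<rho> p (c j))" using rho_tri X p by blast
      also have "\<dots> \<le> A * (s i + s i)"
        using p im[OF j(1)] rho_sym[of p "c j"] X A_ge_1 by (intro mult_left_mono add_mono) auto
      finally have "\<rho> (c i) (c j) + s j \<le> A * (s i + s i) + 1 * s i" using im[OF j(1)] by simp
      also have "\<dots> \<le> A * (s i + s i) + A * s i"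
        using A_ge_1 less.prems(3)[OF i(1)] by (intro add_mono mult_right_mono) auto
      finally have "A * (\<rho> (c i) (c j) + s j) \<le> A * (3 * A * s i)"
        using A_ge_1 by (intro mult_left_mono) auto
      then show "A * (\<rho> (c i) (c j) + s j) \<le> 3 * A\<^sup>2 * s i" by (simp add: power2_eq_square mult_ac)
    qed
    show ?thesis
    proof (intro exI[of _ "insert i J"] conjI ballI)
      show "insert i J \<subseteq> I" using i J(1) unfolding I'_def by auto
      show "disjoint_family_on (\<lambda>i. B (c i) (s i)) (insert i J)"
        using J(1,2) unfolding I'_def disjoint_family_on_def by blast
      fix j assume "j \<in> I"
      then show "\<exists>j'\<in>insert i J. B (c j) (s j) \<subseteq> B (c j') (3 * A\<^sup>2 * s j')"
        using J(3) hit by (cases "j \<in> I'") auto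
    qed
  qed (auto simp: disjoint_family_on_def)
qed

end

text \<open>The new element has at most \<open>N\<close> coloured neighbours, while
  \<open>N + 1\<close> colours are available. In \<open>sparse_form_bound\<close> this splits the
  centres of each scale into classes that are separated as \<open>laminar_enlargement\<close>
  requires.\<close>

lemma greedy_colouring:
  fixes R :: "'b \<Rightarrow> 'b \<Rightarrow> bool"
  assumes "finite S" "symp R" "\<And>s. s \<in> S \<Longrightarrow> card {t\<in>S. R s t} \<le> N"
  shows "\<exists>col::'b \<Rightarrow> nat. (\<forall>s\<in>S. col s \<le> N) \<and> (\<forall>s\<in>S. \<forall>t\<in>S. R s t \<and> s \<noteq> t \<longrightarrow> col s \<noteq> col t)"
  using assms
proof (induction S rule: finite_induct)
  case (insert x S)
  have le: "card {t\<in>S. R s t} \<le> N" if "s \<in> S" for s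
  proof -
    have "card {t\<in>S. R s t} \<le> card {t\<in>insert x S. R s t}" using insert.hyps by (intro card_mono) auto
    also have "\<dots> \<le> N" using insert.prems that by blast
    finally show ?thesis .
  qed
  from insert.IH[OF insert.prems(1) le]
  obtain col where col: "\<forall>s\<in>S. col s \<le> N" "\<forall>s\<in>S. \<forall>t\<in>S. R s t \<and> s \<noteq> t \<longrightarrow> col s \<noteq> (col t :: nat)"
    by auto
  have "card (col ` {t\<in>S. R x t}) \<le> card {t\<in>S. R x t}" using insert.hyps by (intro card_image_le) auto
  also have "\<dots> \<le> card {t\<in>insert x S. R x t}" using insert.hyps by (intro card_mono) auto
  also have "\<dots> \<le> N" using insert.prems by blast
  finally have "card (col ` {t\<in>S. R x t}) < card {..N}" by simp
  moreover have "finite (col ` {t\<in>S. R x t})" using insert.hyps by simp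
  ultimately have "\<not> {..N} \<subseteq> col ` {t\<in>S. R x t}" using card_mono leD by blast
  then obtain c where c: "c \<le> N" "c \<notin> col ` {t\<in>S. R x t}" by auto
  show ?case
  proof (intro exI[of _ "col(x := c)"] conjI ballI impI)
    fix s t assume st: "s \<in> insert x S" "t \<in> insert x S" "R s t \<and> s \<noteq> t"
    then have "R t s" using insert.prems(1) by (auto dest: sympD)
    then show "(col(x := c)) s \<noteq> (col(x := c)) t" using st col c by (auto simp: image_iff)
  qed (use col c in auto)
qed auto

context doubling_space
begin

section \<open>Laminar families\<close>

text \<open>A substitute for adjacent dyadic systems. The sets are built from the finest scale to the coarsest:
  a new ball absorbs all finer sets that it meets, and since the radii decrease fast, it at most
  doubles (up to the quasi-metric constant) in the process.\<close>

lemma laminar_enlargement: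
  fixes S :: "(nat \<times> 'a) set" and r :: "nat \<Rightarrow> real"
  assumes "finite S" "\<And>s. s \<in> S \<Longrightarrow> snd s \<in> space M" "0 < \<alpha>"
    and "\<And>k. 0 < r k" "\<And>j k. k < j \<Longrightarrow> 4 * A\<^sup>2 * r j \<le> r k"
    and "\<And>k z z'. (k, z) \<in> S \<Longrightarrow> (k, z') \<in> S \<Longrightarrow> z \<noteq> z' \<Longrightarrow> 4 * A\<^sup>2 * \<alpha> * r k \<le> \<rho> z z'"
  shows "\<exists>F. (\<forall>s\<in>S. F s \<in> sets M \<and> B (snd s) (\<alpha> * r (fst s)) \<subseteq> F s \<and>
                F s \<subseteq> B (snd s) (2 * A * \<alpha> * r (fst s))) \<and>
             (\<forall>s\<in>S. \<forall>t\<in>S. F s \<subseteq> F t \<or> F t \<subseteq> F s \<or> F s \<inter> F t = {})"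
  using assms
proof (induction "card S" arbitrary: S)
  case 0
  then show ?case by auto
next
  case (Suc n)
  have A0: "0 < A" using A_ge_1 by simp
  have "S \<noteq> {}" using Suc.hyps(2) by auto
  \<comment> \<open>A smaller index means a larger radius: the pair split off is of the coarsest
    scale, and the induction hypothesis provides the sets of all other pairs.\<close>
  define m where "m = Min (fst ` S)"
  have "m \<in> fst ` S" unfolding m_def using \<open>S \<noteq> {}\<close> Suc.prems(1) by (intro Min_in) auto
  then obtain z where s: "(m, z) \<in> S" by auto
  have m_le: "m \<le> fst t" if "t \<in> S" for t unfolding m_def using that Suc.prems(1) by (intro Min_le) auto
  define S' where "S' = S - {(m, z)}"
  have "n = card S'" unfolding S'_def using s Suc.hyps(2) Suc.prems(1) by simp
  then have "\<exists>F. (\<forall>s\<in>S'. F s \<in> sets M \<and> B (snd s) (\<alpha> * r (fst s)) \<subseteq> F s \<and>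
                F s \<subseteq> B (snd s) (2 * A * \<alpha> * r (fst s))) \<and>
             (\<forall>s\<in>S'. \<forall>t\<in>S'. F s \<subseteq> F t \<or> F t \<subseteq> F s \<or> F s \<inter> F t = {})"
    using Suc.prems unfolding S'_def by (intro Suc.hyps(1)) auto
  then obtain F where F0: "\<forall>s\<in>S'. F s \<in> sets M \<and> B (snd s) (\<alpha> * r (fst s)) \<subseteq> F s \<and>
                F s \<subseteq> B (snd s) (2 * A * \<alpha> * r (fst s))"
    and lam0: "\<forall>s\<in>S'. \<forall>t\<in>S'. F s \<subseteq> F t \<or> F t \<subseteq> F s \<or> F s \<inter> F t = {}"
    by (elim exE conjE) (rule that)
  have F: "F s \<in> sets M" "B (snd s) (\<alpha> * r (fst s)) \<subseteq> F s" "F s \<subseteq> B (snd s) (2 * A * \<alpha> * r (fst s))"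
    if "s \<in> S'" for s using F0 that by auto
  have lam: "F s \<subseteq> F t \<or> F t \<subseteq> F s \<or> F s \<inter> F t = {}" if "s \<in> S'" "t \<in> S'" for s t
    using lam0 that by auto
  define b where "b = B z (\<alpha> * r m)"
  define G where "G = b \<union> \<Union> (F ` {t\<in>S'. F t \<inter> b \<noteq> {}})"
  define F' where "F' = F((m, z) := G)"
  have zX: "z \<in> space M" using Suc.prems(2)[OF s] by simp
  have rm: "0 < r m" by fact
  \<comment> \<open>Sets of one scale never meet: their centres are
    \<open>4 * A\<^sup>2 * \<alpha> * r m\<close> apart, while each set stays within
    \<open>2 * A * \<alpha> * r m\<close> of its centre.\<close>
  have same: "B z (2 * A * \<alpha> * r m) \<inter> F t = {}" if t: "t \<in> S'" "fst t = m" for t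
  proof (rule ccontr)
    assume "B z (2 * A * \<alpha> * r m) \<inter> F t \<noteq> {}"
    then obtain p where p': "p \<in> B z (2 * A * \<alpha> * r m)" "p \<in> F t" by auto
    then have p: "p \<in> space M" "\<rho> z p < 2 * A * \<alpha> * r m" "\<rho> (snd t) p < 2 * A * \<alpha> * r m"
      using F(3)[OF t(1)] t(2) by (auto simp: mem_B)
    have tS: "t = (m, snd t)" "t \<in> S" "snd t \<noteq> z" using t unfolding S'_def by (auto simp: prod_eq_iff)
    have tX: "snd t \<in> space M" using Suc.prems(2) tS by blast
    have "\<rho> z (snd t) \<le> A * (\<rho> z p + \<rho> p (snd t))" using rho_tri zX tX p by blast
    also have "\<dots> < A * (2 * A * \<alpha> * r m + 2 * A * \<alpha> * r m)"
      using p rho_sym[of p "snd t"] tX A0 by (intro mult_strict_left_mono add_strict_mono) auto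
    also have "\<dots> = 4 * A\<^sup>2 * \<alpha> * r m" by (simp add: power2_eq_square)
    finally show False using Suc.prems(6)[OF s, of "snd t"] tS by auto
  qed
  have b_sub: "b \<subseteq> B z (2 * A * \<alpha> * r m)"
  proof -
    have "1 * (\<alpha> * r m) \<le> 2 * A * (\<alpha> * r m)"
      using A_ge_1 rm Suc.prems(3) by (intro mult_right_mono) auto
    then show ?thesis unfolding b_def by (intro B_mono) (simp add: mult.assoc)
  qed
  have G_sub: "G \<subseteq> B z (2 * A * \<alpha> * r m)"
  proof -
    \<comment> \<open>As \<open>4 * A\<^sup>2 * r j \<le> r m\<close>, a finer set has diameter at
      most \<open>\<alpha> * r m\<close>; if it meets \<open>b\<close>, it ends within
      \<open>A * (\<alpha> * r m + \<alpha> * r m)\<close> of \<open>z\<close>.\<close>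
    have "F t \<subseteq> B z (2 * A * \<alpha> * r m)" if t: "t \<in> S'" "F t \<inter> b \<noteq> {}" for t
    proof
      fix p assume pF: "p \<in> F t"
      obtain q where q: "q \<in> F t" "q \<in> b" using t by auto
      have "fst t \<noteq> m" using same[OF t(1)] b_sub t(2) by auto
      then have mt: "m < fst t" using m_le[of t] t(1) unfolding S'_def by auto
      have tX: "snd t \<in> space M" using Suc.prems(2) t unfolding S'_def by blast
      have p: "p \<in> space M" "\<rho> (snd t) p < 2 * A * \<alpha> * r (fst t)"
        using F(3)[OF t(1)] pF by (auto simp: mem_B)
      have q': "q \<in> space M" "\<rho> (snd t) q < 2 * A * \<alpha> * r (fst t)" "\<rho> z q < \<alpha> * r m"
        using F(3)[OF t(1)] q by (auto simp: mem_B b_def)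
      have "\<rho> q p \<le> A * (\<rho> q (snd t) + \<rho> (snd t) p)" using rho_tri tX p q' by blast
      also have "\<dots> \<le> A * (2 * A * \<alpha> * r (fst t) + 2 * A * \<alpha> * r (fst t))"
        using p q' rho_sym[of q "snd t"] tX A0 by (intro mult_left_mono add_mono) auto
      also have "\<dots> = \<alpha> * (4 * A\<^sup>2 * r (fst t))" by (simp add: power2_eq_square)
      also have "\<dots> \<le> \<alpha> * r m" using Suc.prems(5)[OF mt] Suc.prems(3) by (intro mult_left_mono) auto
      finally have qp: "\<rho> q p \<le> \<alpha> * r m" .
      have "\<rho> z p \<le> A * (\<rho> z q + \<rho> q p)" using rho_tri zX p q' by blast
      also have "\<dots> < A * (\<alpha> * r m + \<alpha> * r m)" using qp q' A0 by (intro mult_strict_left_mono) auto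
      finally show "p \<in> B z (2 * A * \<alpha> * r m)" using p by (simp add: mem_B algebra_simps)
    qed
    then show ?thesis unfolding G_def using b_sub by auto
  qed
  have G_lam: "F t \<subseteq> G \<or> F t \<inter> G = {}" if t: "t \<in> S'" for t
  proof (cases "fst t = m")
    case True
    then show ?thesis using same[OF t] G_sub by auto
  next
    case False
    show ?thesis
    proof (rule disjCI)
      assume "F t \<inter> G \<noteq> {}"
      then consider "F t \<inter> b \<noteq> {}" | u where "u \<in> S'" "F u \<inter> b \<noteq> {}" "F t \<inter> F u \<noteq> {}"
        unfolding G_def by blast
      then show "F t \<subseteq> G"
      proof cases
        case 1 then show ?thesis unfolding G_def using t by auto
      next
        case 2
        then have "F t \<subseteq> F u \<or> F u \<subseteq> F t" using lam[OF t, of u] by blast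
        then show ?thesis
        proof
          assume "F t \<subseteq> F u" then show ?thesis unfolding G_def using 2 by blast
        next
          assume "F u \<subseteq> F t"
          then have "F t \<inter> b \<noteq> {}" using 2 by blast
          then show ?thesis unfolding G_def using t by auto
        qed
      qed
    qed
  qed
  have "G \<in> sets M" unfolding G_def b_def
    using F(1) zX Suc.prems(1) unfolding S'_def by (intro sets.Un sets.finite_UN B_sets) auto
  moreover have "b \<subseteq> G" unfolding G_def by auto
  moreover have F': "F' (m, z) = G" "\<And>t. t \<in> S' \<Longrightarrow> F' t = F t" unfolding F'_def S'_def by auto
  moreover have S_eq: "S = insert (m, z) S'" using s unfolding S'_def by auto
  ultimately have "(\<forall>s\<in>S. F' s \<in> sets M \<and> B (snd s) (\<alpha> * r (fst s)) \<subseteq> F' s \<and>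
                F' s \<subseteq> B (snd s) (2 * A * \<alpha> * r (fst s)))"
    using F G_sub unfolding b_def by auto
  moreover have "F' s \<subseteq> F' t \<or> F' t \<subseteq> F' s \<or> F' s \<inter> F' t = {}" if "s \<in> S" "t \<in> S" for s t
  proof -
    have "u = (m, z) \<and> F' u = G \<or> u \<in> S' \<and> F' u = F u" if "u \<in> S" for u
      using that S_eq F'(1) F'(2)[of u] by (cases "u = (m, z)") auto
    from this[OF that(1)] this[OF that(2)]
    show ?thesis using G_lam[of s] G_lam[of t] lam[of s t] by (elim disjE conjE) (simp_all add: Int_commute, blast+)
  qed
  ultimately show ?case by (intro exI[of _ F'] conjI) simp_all
qed

end

text \<open>Abel summation over the finitely many values of a maximal function; it replaces the layer cake
  formula, and so no \<open>\<sigma>\<close>-finiteness is needed.\<close>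

lemma telescoping_finite_set:
  fixes \<phi> :: "real \<Rightarrow> 'b::ab_group_add"
  assumes "finite W" "W \<subseteq> {0<..}"
  shows "(\<Sum>v\<in>W. \<phi> v - \<phi> (Max (insert 0 {u\<in>W. u < v}))) = \<phi> (Max (insert 0 W)) - \<phi> 0"
  using assms
proof (induction W rule: finite_linorder_max_induct)
  case (insert b A)
  have "{u \<in> insert b A. u < v} = {u \<in> A. u < v}" if "v \<in> A" for v
    using insert.hyps that by auto
  moreover have "{u \<in> insert b A. u < b} = A" using insert.hyps by auto
  moreover have "Max (insert 0 (insert b A)) = b"
    using insert.hyps insert.prems by (intro Max_eqI) (auto intro: less_imp_le)
  moreover have "b \<notin> A" using insert.hyps by auto
  ultimately show ?case using insert by simp
qed auto

section \<open>Maximal operators of nested families\<close>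

lemma laminar_weak_type:
  fixes N :: "'b measure" and g :: "'b \<Rightarrow> ennreal"
  assumes "finite \<L>" "\<L> \<subseteq> sets N" "g \<in> borel_measurable N"
    and "\<And>L L'. L \<in> \<L> \<Longrightarrow> L' \<in> \<L> \<Longrightarrow> L \<subseteq> L' \<or> L' \<subseteq> L \<or> L \<inter> L' = {}"
    and "\<And>L. L \<in> \<L> \<Longrightarrow> t * emeasure N L \<le> (\<integral>\<^sup>+x\<in>L. g x \<partial>N)"
  shows "t * emeasure N (\<Union>\<L>) \<le> (\<integral>\<^sup>+x\<in>\<Union>\<L>. g x \<partial>N)"
  using assms
proof (induction "card \<L>" arbitrary: \<L> rule: less_induct)
  case less
  show ?case
  proof (cases "\<L> = {}")
    case False
    \<comment> \<open>Every other set lies inside the maximal set \<open>L\<close> or is disjoint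
      from it, so \<open>L\<close> can be split off. No overlap is counted, and the constant is
      \<open>1\<close> for every measure.\<close>
    then obtain L where L: "L \<in> \<L>" "\<And>L'. L' \<in> \<L> \<Longrightarrow> L \<subseteq> L' \<Longrightarrow> L = L'"
      using finite_has_maximal[OF less.prems(1)] by (metis (no_types))
    \<comment> \<open>\<open>L\<close> is removed explicitly because the empty set is disjoint from
      itself.\<close>
    define \<K> where "\<K> = {L'\<in>\<L>. L' \<inter> L = {}} - {L}"
    have K: "\<K> \<subset> \<L>" "finite \<K>" unfolding \<K>_def using L less.prems(1) by auto
    then have "card \<K> < card \<L>" using less.prems by (intro psubset_card_mono)
    then have IH: "t * emeasure N (\<Union>\<K>) \<le> (\<integral>\<^sup>+x\<in>\<Union>\<K>. g x \<partial>N)"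
    proof (rule less.hyps)
      show "K' \<subseteq> K'' \<or> K'' \<subseteq> K' \<or> K' \<inter> K'' = {}" if "K' \<in> \<K>" "K'' \<in> \<K>" for K' K''
        using less.prems(4) K(1) that by (meson psubsetD)
    qed (use K less.prems in auto)
    have U: "\<Union>\<L> = L \<union> \<Union>\<K>"
    proof -
      have "L' \<subseteq> L" if "L' \<in> \<L>" "L' \<notin> \<K>" for L'
        using less.prems(4)[OF L(1) that(1)] L(2)[OF that(1)] that unfolding \<K>_def by auto
      then show ?thesis using L(1) K(1) by auto
    qed
    have d: "L \<inter> \<Union>\<K> = {}" unfolding \<K>_def by auto
    have m: "L \<in> sets N" "\<Union>\<K> \<in> sets N" using L(1) K less.prems(2) by (auto intro!: sets.finite_Union)
    have "t * emeasure N (\<Union>\<L>) = t * emeasure N L + t * emeasure N (\<Union>\<K>)"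
      unfolding U using m d by (simp add: plus_emeasure[symmetric] distrib_left)
    also have "\<dots> \<le> (\<integral>\<^sup>+x\<in>L. g x \<partial>N) + (\<integral>\<^sup>+x\<in>\<Union>\<K>. g x \<partial>N)"
      using IH less.prems(5)[OF L(1)] by (rule add_mono[rotated])
    also have "\<dots> = (\<integral>\<^sup>+x\<in>\<Union>\<L>. g x \<partial>N)"
      unfolding U using m d less.prems(3) by (intro nn_integral_disjoint_pair[symmetric]) auto
    finally show ?thesis .
  qed auto
qed

text \<open>A null set contributes \<open>0\<close>: its integral vanishes, and
  \<open>0 / 0 = 0\<close> in \<open>ennreal\<close>.\<close>

definition lam_max :: "'b measure \<Rightarrow> 'i set \<Rightarrow> ('i \<Rightarrow> 'b set) \<Rightarrow> ('b \<Rightarrow> ennreal) \<Rightarrow> 'b \<Rightarrow> ennreal" where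
  "lam_max N I L g x = (SUP i\<in>I. (\<integral>\<^sup>+y\<in>L i. g y \<partial>N) / emeasure N (L i) * indicator (L i) x)"

lemma lam_max_measurable [measurable]:
  assumes "finite I" "\<And>i. i \<in> I \<Longrightarrow> L i \<in> sets N"
  shows "lam_max N I L g \<in> borel_measurable N"
  unfolding lam_max_def using assms by (intro borel_measurable_SUP) (auto intro: countable_finite)

text \<open>Doob's inequality with its constant \<open>2\<^sup>2\<close>. Summing the weak type
  bound over the values of the maximal function \<open>m\<close> gives
  \<open>\<integral> m\<^sup>2 \<le> 2 * \<integral> g m\<close>; then Cauchy--Schwarz applies,
  followed by a division by \<open>\<integral> m\<^sup>2\<close>. That integral is finite because
  there are finitely many sets, of finite measure and with finite averages.\<close>

lemma laminar_maximal:
  fixes N :: "'b measure" and g :: "'b \<Rightarrow> ennreal"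
  assumes I: "finite I" and L: "\<And>i. i \<in> I \<Longrightarrow> L i \<in> sets N" "\<And>i. i \<in> I \<Longrightarrow> emeasure N (L i) < \<infinity>"
    and lam: "\<And>i j. i \<in> I \<Longrightarrow> j \<in> I \<Longrightarrow> L i \<subseteq> L j \<or> L j \<subseteq> L i \<or> L i \<inter> L j = {}"
    and g [measurable]: "g \<in> borel_measurable N"
  shows "(\<integral>\<^sup>+x. (lam_max N I L g x)\<^sup>2 \<partial>N) \<le> 4 * (\<integral>\<^sup>+x. (g x)\<^sup>2 \<partial>N)"
proof (cases "(\<integral>\<^sup>+x. (g x)\<^sup>2 \<partial>N) = \<infinity>")
  case True
  then show ?thesis by (simp add: ennreal_mult_top)
next
  case False
  define av where "av i = (\<integral>\<^sup>+y\<in>L i. g y \<partial>N) / emeasure N (L i)" for i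
  have av_fin: "av i < \<infinity>" if i: "i \<in> I" for i
  proof (cases "emeasure N (L i) = 0")
    case True
    then have "(\<integral>\<^sup>+y\<in>L i. g y \<partial>N) = 0"
      using L(1)[OF i] by (intro nn_integral_null_set) (auto intro: null_setsI)
    then show ?thesis by (simp add: av_def)
  next
    case False
    have "(\<integral>\<^sup>+y\<in>L i. g y \<partial>N)\<^sup>2 \<le> (\<integral>\<^sup>+x. (g x)\<^sup>2 \<partial>N) * (\<integral>\<^sup>+x. (indicator (L i) x)\<^sup>2 \<partial>N)"
      using L(1)[OF i] by (intro Cauchy_Schwarz_nn_integral) auto
    also have "(\<lambda>x. (indicator (L i) x :: ennreal)\<^sup>2) = indicator (L i)" by (auto simp: indicator_def)
    also have "(\<integral>\<^sup>+x. indicator (L i) x \<partial>N) = emeasure N (L i)" using L(1)[OF i] by simp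
    also have "(\<integral>\<^sup>+x. (g x)\<^sup>2 \<partial>N) * emeasure N (L i) < \<infinity>"
      using L(2)[OF i] \<open>(\<integral>\<^sup>+x. (g x)\<^sup>2 \<partial>N) \<noteq> \<infinity>\<close> by (simp add: ennreal_mult_less_top less_top)
    finally have "(\<integral>\<^sup>+y\<in>L i. g y \<partial>N) < \<infinity>" by (simp add: power2_eq_square ennreal_mult_less_top) (auto simp: less_top)
    then show ?thesis using False unfolding av_def by (simp add: less_top[symmetric] ennreal_divide_eq_top_iff)
  qed
  define m where "m x = lam_max N I L g x" for x
  \<comment> \<open>\<open>W\<close> contains every positive value that \<open>m\<close> can take;
    these are real numbers because the averages are finite.\<close>
  define W where "W = {v. 0 < v \<and> ennreal v \<in> av ` I}"
  have W: "finite W" "W \<subseteq> {0<..}"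
  proof -
    have "v \<in> enn2real ` (av ` I)" if "v \<in> W" for v
    proof -
      have "ennreal v \<in> av ` I" "v = enn2real (ennreal v)" using that unfolding W_def by auto
      then show ?thesis by (metis imageI)
    qed
    then have "W \<subseteq> enn2real ` (av ` I)" by auto
    then show "finite W" using I finite_subset by blast
  qed (auto simp: W_def)
  have m_meas [measurable]: "m \<in> borel_measurable N"
    unfolding m_def[abs_def] using I L by (intro lam_max_measurable) auto
  have m_val: "m x \<in> insert 0 (ennreal ` W)" for x
  proof (cases "I = {}")
    case True then show ?thesis by (simp add: m_def lam_max_def bot_ennreal)
  next
    case False
    have "m x \<in> (\<lambda>i. av i * indicator (L i) x) ` I"
      unfolding m_def lam_max_def av_def[symmetric] using I False
      by (subst cSup_eq_Max) auto
    then obtain i where i: "i \<in> I" "m x = av i * indicator (L i) x" by auto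
    show ?thesis
    proof (cases "av i = 0 \<or> x \<notin> L i")
      case False
      then have "m x = ennreal (enn2real (av i))" using i av_fin[OF i(1)] by (simp add: less_top)
      moreover have "enn2real (av i) \<in> W" unfolding W_def using False i(1) av_fin[OF i(1)]
        by (auto simp: less_top enn2real_positive_iff zero_less_iff_neq_zero)
      ultimately show ?thesis by blast
    qed (use i in auto)
  qed
  define P where "P v = {x\<in>space N. ennreal v \<le> m x}" for v
  have P_sets [measurable]: "P v \<in> sets N" for v unfolding P_def by measurable
  have weak: "ennreal v * emeasure N (P v) \<le> (\<integral>\<^sup>+x\<in>P v. g x \<partial>N)" if v: "v \<in> W" for v
  proof -
    have v0: "0 < v" using v W by auto
    have "P v = \<Union> (L ` {i\<in>I. ennreal v \<le> av i})"
    proof (intro equalityI subsetI)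
      fix x assume "x \<in> P v"
      then have x: "ennreal v \<le> m x" unfolding P_def by auto
      then have "I \<noteq> {}" using v0 by (auto simp: m_def lam_max_def bot_ennreal)
      then have "m x \<in> (\<lambda>i. av i * indicator (L i) x) ` I"
        unfolding m_def lam_max_def av_def[symmetric] using I by (subst cSup_eq_Max) auto
      then obtain i where "i \<in> I" "m x = av i * indicator (L i) x" by auto
      then show "x \<in> \<Union> (L ` {i\<in>I. ennreal v \<le> av i})"
        using x v0 by (cases "x \<in> L i") auto
    next
      fix x assume "x \<in> \<Union> (L ` {i\<in>I. ennreal v \<le> av i})"
      then obtain i where i: "i \<in> I" "ennreal v \<le> av i" "x \<in> L i" by auto
      have "av i * indicator (L i) x \<le> m x"
        unfolding m_def lam_max_def av_def[symmetric] using i by (intro SUP_upper)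
      then have "av i \<le> m x" using i by simp
      then show "x \<in> P v" using i L(1)[OF i(1)] sets.sets_into_space unfolding P_def by fastforce
    qed
    moreover have "ennreal v * emeasure N (\<Union> (L ` {i\<in>I. ennreal v \<le> av i}))
        \<le> (\<integral>\<^sup>+x\<in>\<Union> (L ` {i\<in>I. ennreal v \<le> av i}). g x \<partial>N)"
    proof (rule laminar_weak_type)
      fix L0 assume "L0 \<in> L ` {i\<in>I. ennreal v \<le> av i}"
      then obtain i where i: "i \<in> I" "ennreal v \<le> av i" "L0 = L i" by auto
      show "ennreal v * emeasure N L0 \<le> (\<integral>\<^sup>+x\<in>L0. g x \<partial>N)"
      proof (cases "emeasure N L0 = 0")
        case False
        have "ennreal v * emeasure N L0 \<le> av i * emeasure N L0" using i by (intro mult_right_mono) auto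
        also have "\<dots> = (\<integral>\<^sup>+x\<in>L0. g x \<partial>N)"
          unfolding av_def i using False L(2)[OF i(1)] i
          by (simp add: ennreal_divide_times ennreal_times_divide ennreal_mult_divide_eq less_top mult.commute[of "emeasure N (L i)"])
        finally show ?thesis .
      qed simp
    next
      fix L1 L2 assume "L1 \<in> L ` {i\<in>I. ennreal v \<le> av i}" "L2 \<in> L ` {i\<in>I. ennreal v \<le> av i}"
      then obtain i j where "i \<in> I" "L1 = L i" "j \<in> I" "L2 = L j" by auto
      then show "L1 \<subseteq> L2 \<or> L2 \<subseteq> L1 \<or> L1 \<inter> L2 = {}" using lam[of i j] by auto
    qed (use I L in auto)
    ultimately show ?thesis by simp
  qed
  \<comment> \<open>The next smaller level, or \<open>0\<close> below the least one, so that sums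
    over \<open>W\<close> telescope.\<close>
  define pd where "pd v = Max (insert 0 {u\<in>W. u < v})" for v
  have pd: "0 \<le> pd v" "v \<in> W \<Longrightarrow> pd v \<le> v" for v
    unfolding pd_def using W by (auto intro!: Max_ge)
  have tel: "(\<Sum>v\<in>W. (\<phi> v - \<phi> (pd v)) * indicator (P v) x) = \<phi> (enn2real (m x)) - \<phi> 0"
    if x: "x \<in> space N" for x and \<phi> :: "real \<Rightarrow> real"
  proof -
    define W' where "W' = {v\<in>W. ennreal v \<le> m x}"
    have W': "finite W'" "W' \<subseteq> {0<..}" using W unfolding W'_def by auto
    have "(\<Sum>v\<in>W. (\<phi> v - \<phi> (pd v)) * indicator (P v) x) = (\<Sum>v\<in>W'. \<phi> v - \<phi> (pd v))"
      unfolding W'_def P_def using W(1) x by (intro sum.mono_neutral_cong_right) (auto simp: indicator_def)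
    also have "\<dots> = (\<Sum>v\<in>W'. \<phi> v - \<phi> (Max (insert 0 {u\<in>W'. u < v})))"
    proof (intro sum.cong refl)
      fix v assume v: "v \<in> W'"
      have "{u\<in>W. u < v} = {u\<in>W'. u < v}"
      proof -
        have "ennreal u \<le> m x" if "u < v" for u
          using v that unfolding W'_def by (intro order_trans[OF ennreal_leI[of u v]]) auto
        then show ?thesis unfolding W'_def by auto
      qed
      then show "\<phi> v - \<phi> (pd v) = \<phi> v - \<phi> (Max (insert 0 {u\<in>W'. u < v}))" unfolding pd_def by simp
    qed
    also have "\<dots> = \<phi> (Max (insert 0 W')) - \<phi> 0" using telescoping_finite_set[OF W'] .
    also have "Max (insert 0 W') = enn2real (m x)"
      using W' W m_val[of x] by (intro Max_eqI) (auto simp: W'_def)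
    finally show ?thesis .
  qed
  have m_real: "m x = ennreal (enn2real (m x))" for x using m_val[of x] W by auto
  have m1: "m x = (\<Sum>v\<in>W. ennreal (v - pd v) * indicator (P v) x)" if "x \<in> space N" for x
  proof -
    have "(\<Sum>v\<in>W. ennreal (v - pd v) * indicator (P v) x) = (\<Sum>v\<in>W. ennreal ((v - pd v) * indicator (P v) x))"
      by (intro sum.cong) (auto split: split_indicator)
    also have "\<dots> = ennreal (\<Sum>v\<in>W. (v - pd v) * indicator (P v) x)"
      using pd by (intro sum_ennreal) (auto intro!: mult_nonneg_nonneg)
    finally have "(\<Sum>v\<in>W. ennreal (v - pd v) * indicator (P v) x) = ennreal (\<Sum>v\<in>W. (v - pd v) * indicator (P v) x)" .
    then show ?thesis using tel[OF that, of "\<lambda>v. v"] m_real[of x] by simp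
  qed
  have m2: "(m x)\<^sup>2 = (\<Sum>v\<in>W. ennreal (v\<^sup>2 - (pd v)\<^sup>2) * indicator (P v) x)" if "x \<in> space N" for x
  proof -
    have "(\<Sum>v\<in>W. ennreal (v\<^sup>2 - (pd v)\<^sup>2) * indicator (P v) x) = (\<Sum>v\<in>W. ennreal ((v\<^sup>2 - (pd v)\<^sup>2) * indicator (P v) x))"
      by (intro sum.cong) (auto split: split_indicator)
    also have "\<dots> = ennreal (\<Sum>v\<in>W. (v\<^sup>2 - (pd v)\<^sup>2) * indicator (P v) x)"
      using pd by (intro sum_ennreal) (auto intro!: mult_nonneg_nonneg power_mono)
    also have "\<dots> = ennreal ((enn2real (m x))\<^sup>2)" using tel[OF that, of "\<lambda>v. v\<^sup>2"] by simp
    also have "\<dots> = (m x)\<^sup>2" by (subst m_real) (simp add: ennreal_power)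
    finally show ?thesis by simp
  qed
  \<comment> \<open>Discrete form of \<open>d(v\<^sup>2) = 2 v dv\<close>.\<close>
  have sq: "ennreal (v\<^sup>2 - (pd v)\<^sup>2) \<le> 2 * (ennreal (v - pd v) * ennreal v)" if v: "v \<in> W" for v
  proof -
    have "v\<^sup>2 - (pd v)\<^sup>2 = (v - pd v) * (v + pd v)" by (simp add: power2_eq_square algebra_simps)
    also have "\<dots> \<le> (v - pd v) * (2 * v)" using pd[of v] v by (intro mult_left_mono) auto
    finally have "ennreal (v\<^sup>2 - (pd v)\<^sup>2) \<le> ennreal (2 * ((v - pd v) * v))" by (intro ennreal_leI) (simp add: mult_ac)
    also have "\<dots> = 2 * (ennreal (v - pd v) * ennreal v)"
      using pd[of v] v W by (subst ennreal_mult) (auto simp: ennreal_mult[symmetric])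
    finally show ?thesis .
  qed
  define J where "J = (\<integral>\<^sup>+x. (m x)\<^sup>2 \<partial>N)"
  define G where "G = (\<integral>\<^sup>+x. (g x)\<^sup>2 \<partial>N)"
  have JS: "J = (\<Sum>v\<in>W. ennreal (v\<^sup>2 - (pd v)\<^sup>2) * emeasure N (P v))"
  proof -
    have "J = (\<integral>\<^sup>+x. (\<Sum>v\<in>W. ennreal (v\<^sup>2 - (pd v)\<^sup>2) * indicator (P v) x) \<partial>N)"
      unfolding J_def using m2 by (intro nn_integral_cong) auto
    also have "\<dots> = (\<Sum>v\<in>W. ennreal (v\<^sup>2 - (pd v)\<^sup>2) * emeasure N (P v))"
      by (subst nn_integral_sum) (auto simp: nn_integral_cmult_indicator)
    finally show ?thesis .
  qed
  also have "\<dots> \<le> (\<Sum>v\<in>W. 2 * (ennreal (v - pd v) * ennreal v) * emeasure N (P v))"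
    using sq by (intro sum_mono mult_right_mono) auto
  also have "\<dots> = (\<Sum>v\<in>W. 2 * (ennreal (v - pd v) * (ennreal v * emeasure N (P v))))"
    by (simp add: mult.assoc)
  also have "\<dots> \<le> (\<Sum>v\<in>W. 2 * (ennreal (v - pd v) * (\<integral>\<^sup>+x\<in>P v. g x \<partial>N)))"
    using weak by (intro sum_mono mult_left_mono) auto
  also have "\<dots> = 2 * (\<integral>\<^sup>+x. (\<Sum>v\<in>W. ennreal (v - pd v) * (g x * indicator (P v) x)) \<partial>N)"
    by (subst nn_integral_sum) (auto simp: nn_integral_cmult sum_distrib_left)
  also have "(\<integral>\<^sup>+x. (\<Sum>v\<in>W. ennreal (v - pd v) * (g x * indicator (P v) x)) \<partial>N) = (\<integral>\<^sup>+x. g x * m x \<partial>N)"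
    using m1 by (intro nn_integral_cong) (simp add: sum_distrib_left mult_ac)
  finally have J_le: "J \<le> 2 * (\<integral>\<^sup>+x. g x * m x \<partial>N)" .
  have "J < \<infinity>"
  proof -
    have "emeasure N (P v) < \<infinity>" if v: "v \<in> W" for v
    proof -
      have "P v \<subseteq> \<Union> (L ` I)"
      proof
        fix x assume x: "x \<in> P v"
        then have "ennreal v \<le> m x" "0 < ennreal v" using v W unfolding P_def by auto
        then have "0 < m x" by (rule less_le_trans[rotated])
        then obtain i where "i \<in> I" "0 < av i * indicator (L i) x"
          unfolding m_def lam_max_def av_def[symmetric] by (auto simp: less_SUP_iff)
        then show "x \<in> \<Union> (L ` I)" by (cases "x \<in> L i") auto
      qed
      then have "emeasure N (P v) \<le> emeasure N (\<Union> (L ` I))" using I L by (intro emeasure_mono) auto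
      also have "\<dots> \<le> (\<Sum>i\<in>I. emeasure N (L i))" using I L by (intro emeasure_subadditive_finite) auto
      also have "\<dots> < \<infinity>" using L(2) I by (simp add: less_top[symmetric])
      finally show ?thesis .
    qed
    then show ?thesis unfolding JS using W(1) by (auto simp: ennreal_mult_eq_top_iff less_top[symmetric])
  qed
  have "J * J \<le> (2 * (\<integral>\<^sup>+x. g x * m x \<partial>N)) * (2 * (\<integral>\<^sup>+x. g x * m x \<partial>N))"
    using J_le by (intro mult_mono) auto
  also have "\<dots> = 4 * (\<integral>\<^sup>+x. g x * m x \<partial>N)\<^sup>2" by (simp add: power2_eq_square mult_ac)
  also have "\<dots> \<le> 4 * (G * J)"
    unfolding G_def J_def by (intro mult_left_mono Cauchy_Schwarz_nn_integral) auto
  finally have "J * J \<le> (4 * G) * J" by (simp add: mult_ac)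
  then have "J \<le> 4 * G"
  proof (cases "J = 0")
    case False
    have "J * J \<le> J * (4 * G)" using \<open>J * J \<le> (4 * G) * J\<close> by (subst mult.commute[of J "4 * G"])
    then show ?thesis using False \<open>J < \<infinity>\<close> by (simp add: ennreal_mult_le_mult_iff less_top)
  qed simp
  then show ?thesis unfolding J_def G_def m_def .
qed

lemma ennreal_power2_le_imp_le:
  fixes x :: ennreal assumes "x\<^sup>2 \<le> (ennreal y)\<^sup>2" "0 \<le> y" shows "x \<le> ennreal y"
proof (cases x)
  case (real z)
  then have "z\<^sup>2 \<le> y\<^sup>2" using assms by (simp add: ennreal_power)
  then show ?thesis using real assms by (auto intro!: ennreal_leI dest: power2_le_imp_le)
next
  case top
  then show ?thesis using assms by (simp add: ennreal_power top_unique)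
qed

lemma set_nn_integral_as_average:
  assumes "L \<in> sets N" "emeasure N L < \<infinity>"
  shows "(\<integral>\<^sup>+y\<in>L. g y \<partial>N) = (\<integral>\<^sup>+y\<in>L. g y \<partial>N) / emeasure N L * emeasure N L"
proof (cases "emeasure N L = 0")
  case True
  then have "(\<integral>\<^sup>+y\<in>L. g y \<partial>N) = 0"
    using assms by (intro nn_integral_null_set) (auto intro: null_setsI)
  then show ?thesis by simp
next
  case False
  then show ?thesis using assms
    by (simp add: ennreal_divide_times ennreal_times_divide ennreal_mult_divide_eq less_top mult.commute[of "emeasure N L"])
qed

section \<open>Weighted bounds for sparse forms\<close>

text \<open>The dual weight substitution. As \<open>v\<close> is the reciprocal of \<open>u\<close>,
  the factor \<open>v\<close> cancels the density once, and a second \<open>v\<close> survives in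
  the square. It serves both \<open>u = 1 / w\<close> and \<open>u = w\<close>.\<close>

lemma density_reciprocal:
  fixes h u v :: "'b \<Rightarrow> ennreal"
  assumes [measurable]: "h \<in> borel_measurable M" "u \<in> borel_measurable M" "v \<in> borel_measurable M"
    and uv: "AE x in M. u x * v x = 1"
  shows "Q \<in> sets M \<Longrightarrow> (\<integral>\<^sup>+x\<in>Q. h x * v x \<partial>density M u) = (\<integral>\<^sup>+x\<in>Q. h x \<partial>M)"
    and "(\<integral>\<^sup>+x. (h x * v x)\<^sup>2 \<partial>density M u) = (\<integral>\<^sup>+x. (h x)\<^sup>2 * v x \<partial>M)"
proof -
  assume [measurable]: "Q \<in> sets M"
  have "(\<integral>\<^sup>+x\<in>Q. h x * v x \<partial>density M u) = (\<integral>\<^sup>+x. u x * (h x * v x * indicator Q x) \<partial>M)"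
    by (intro nn_integral_density) auto
  also have "\<dots> = (\<integral>\<^sup>+x. (u x * v x) * (h x * indicator Q x) \<partial>M)" by (simp add: mult_ac)
  also have "\<dots> = (\<integral>\<^sup>+x\<in>Q. h x \<partial>M)" using uv by (intro nn_integral_cong_AE) (auto elim!: eventually_mono)
  finally show "(\<integral>\<^sup>+x\<in>Q. h x * v x \<partial>density M u) = (\<integral>\<^sup>+x\<in>Q. h x \<partial>M)" .
next
  have "(\<integral>\<^sup>+x. (h x * v x)\<^sup>2 \<partial>density M u) = (\<integral>\<^sup>+x. u x * (h x * v x)\<^sup>2 \<partial>M)"
    by (intro nn_integral_density) auto
  also have "\<dots> = (\<integral>\<^sup>+x. (u x * v x) * ((h x)\<^sup>2 * v x) \<partial>M)" by (simp add: power2_eq_square mult_ac)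
  also have "\<dots> = (\<integral>\<^sup>+x. (h x)\<^sup>2 * v x \<partial>M)" using uv by (intro nn_integral_cong_AE) (auto elim!: eventually_mono)
  finally show "(\<integral>\<^sup>+x. (h x * v x)\<^sup>2 \<partial>density M u) = (\<integral>\<^sup>+x. (h x)\<^sup>2 * v x \<partial>M)" .
qed

text \<open>The weight appears as \<open>sqrt (u x)\<close> next to the maximal function because the
  bounds for \<open>u = 1 / w\<close> and \<open>u = w\<close> will be multiplied, and then the two
  square roots cancel.\<close>

lemma weighted_laminar_maximal:
  fixes h :: "'b \<Rightarrow> ennreal" and u :: "'b \<Rightarrow> real" and v :: "'b \<Rightarrow> ennreal"
  assumes I: "finite I" and L: "\<And>i. i \<in> I \<Longrightarrow> L i \<in> sets M"
      "\<And>i. i \<in> I \<Longrightarrow> emeasure (density M (\<lambda>x. ennreal (u x))) (L i) < \<infinity>"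
    and lam: "\<And>i j. i \<in> I \<Longrightarrow> j \<in> I \<Longrightarrow> L i \<subseteq> L j \<or> L j \<subseteq> L i \<or> L i \<inter> L j = {}"
    and [measurable]: "h \<in> borel_measurable M" "u \<in> borel_measurable M" "v \<in> borel_measurable M"
    and u: "AE x in M. 0 < u x" and uv: "AE x in M. ennreal (u x) * v x = 1"
  shows "(\<integral>\<^sup>+x. (lam_max (density M (\<lambda>x. ennreal (u x))) I L (\<lambda>x. h x * v x) x * ennreal (sqrt (u x)))\<^sup>2 \<partial>M)
           \<le> 4 * (\<integral>\<^sup>+x. (h x)\<^sup>2 * v x \<partial>M)"
proof -
  define N where "N = density M (\<lambda>x. ennreal (u x))"
  define m where "m = lam_max N I L (\<lambda>x. h x * v x)"
  have [measurable]: "m \<in> borel_measurable M"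
    using lam_max_measurable[of I L N "\<lambda>x. h x * v x"] I L unfolding m_def N_def by auto
  have "(\<integral>\<^sup>+x. (m x * ennreal (sqrt (u x)))\<^sup>2 \<partial>M) = (\<integral>\<^sup>+x. ennreal (u x) * (m x)\<^sup>2 \<partial>M)"
    using u by (intro nn_integral_cong_AE) (auto elim!: eventually_mono simp: power_mult_distrib ennreal_power mult.commute)
  also have "\<dots> = (\<integral>\<^sup>+x. (m x)\<^sup>2 \<partial>N)" unfolding N_def by (intro nn_integral_density[symmetric]) auto
  also have "\<dots> \<le> 4 * (\<integral>\<^sup>+x. (h x * v x)\<^sup>2 \<partial>N)"
    unfolding m_def using I L lam by (intro laminar_maximal) (auto simp: N_def)
  also have "(\<integral>\<^sup>+x. (h x * v x)\<^sup>2 \<partial>N) = (\<integral>\<^sup>+x. (h x)\<^sup>2 * v x \<partial>M)"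
    unfolding N_def by (intro density_reciprocal(2) uv) auto
  finally show ?thesis unfolding m_def N_def .
qed

lemma sum_disjoint_indicator_le:
  fixes h :: ennreal
  assumes "finite S" "disjoint_family_on E S"
  shows "(\<Sum>s\<in>S. h * indicator (E s) x) \<le> h"
proof (cases "\<exists>s\<in>S. x \<in> E s")
  case True
  then obtain s where s: "s \<in> S" "x \<in> E s" by auto
  have "(\<Sum>t\<in>S. h * indicator (E t) x) = (\<Sum>t\<in>{s}. h * indicator (E t) x)"
    using assms s unfolding disjoint_family_on_def
    by (intro sum.mono_neutral_right) (auto simp: indicator_def)
  then show ?thesis using s by simp
next
  case False
  then have "(\<Sum>t\<in>S. h * indicator (E t) x) = 0" by (intro sum.neutral) auto
  then show ?thesis by simp
qed

context doubling_space
begin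

text \<open>On \<open>E s\<close>, which lies in \<open>L s\<close>, the two weighted averages over
  \<open>L s\<close> are below the maximal functions, so the disjointness of the sets
  \<open>E s\<close> turns the sum into the single integral of \<open>m1 * m2\<close>. The
  hypothesis on the weight is applied once per term, to the ball of radius
  \<open>2 * A * \<alpha> * r k\<close> around \<open>L s\<close>; this causes
  \<open>(Dil (2 * A))\<^sup>2\<close>. The factor \<open>4\<close> is the product of the norms
  \<open>2\<close> of the two maximal operators.\<close>

lemma sparse_class_bound:
  fixes S :: "(nat \<times> 'a) set" and r :: "nat \<Rightarrow> real" and w :: "'a \<Rightarrow> real" and f g :: "'a \<Rightarrow> ennreal"
  assumes S: "finite S" "\<And>s. s \<in> S \<Longrightarrow> snd s \<in> space M" and \<alpha>: "0 < \<alpha>"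
    and r: "\<And>k. 0 < r k" "\<And>j k. k < j \<Longrightarrow> 4 * A\<^sup>2 * r j \<le> r k"
    and sep: "\<And>k z z'. (k, z) \<in> S \<Longrightarrow> (k, z') \<in> S \<Longrightarrow> z \<noteq> z' \<Longrightarrow> 4 * A\<^sup>2 * \<alpha> * r k \<le> \<rho> z z'"
    and E: "\<And>s. s \<in> S \<Longrightarrow> E s \<in> sets M" "disjoint_family_on E S"
      "\<And>s. s \<in> S \<Longrightarrow> E s \<subseteq> B (snd s) (\<alpha> * r (fst s))"
      "\<And>s. s \<in> S \<Longrightarrow> V (snd s) (\<alpha> * r (fst s)) \<le> c\<^sub>0 * measure M (E s)" and c0: "0 \<le> c\<^sub>0"
    and w [measurable]: "w \<in> borel_measurable M" and w_pos: "AE x in M. 0 < w x"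
    and A2: "\<And>x r. x \<in> space M \<Longrightarrow> 0 < r \<Longrightarrow>
      (\<integral>\<^sup>+y\<in>B x r. ennreal (w y) \<partial>M) * (\<integral>\<^sup>+y\<in>B x r. ennreal (1 / w y) \<partial>M) \<le> a * (ennreal (V x r))\<^sup>2"
    and wfin: "\<And>x r. x \<in> space M \<Longrightarrow> 0 < r \<Longrightarrow> (\<integral>\<^sup>+y\<in>B x r. ennreal (w y) \<partial>M) < \<infinity>"
    and sfin: "\<And>x r. x \<in> space M \<Longrightarrow> 0 < r \<Longrightarrow> (\<integral>\<^sup>+y\<in>B x r. ennreal (1 / w y) \<partial>M) < \<infinity>"
    and f [measurable]: "f \<in> borel_measurable M" and g [measurable]: "g \<in> borel_measurable M"
    and fn: "(\<integral>\<^sup>+x. (f x)\<^sup>2 * ennreal (w x) \<partial>M) \<le> ennreal (\<phi>\<^sup>2)" "0 \<le> \<phi>"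
    and gn: "(\<integral>\<^sup>+x. (g x)\<^sup>2 * ennreal (1 / w x) \<partial>M) \<le> ennreal (\<gamma>\<^sup>2)" "0 \<le> \<gamma>"
  shows "(\<Sum>s\<in>S. (\<integral>\<^sup>+y\<in>B (snd s) (\<alpha> * r (fst s)). f y \<partial>M) / ennreal (V (snd s) (\<alpha> * r (fst s)))
                    * (\<integral>\<^sup>+y\<in>B (snd s) (\<alpha> * r (fst s)). g y \<partial>M))
           \<le> a * ennreal ((Dil (2 * A))\<^sup>2 * c\<^sub>0 * (4 * \<phi> * \<gamma>))"
proof -
  have "\<exists>F. (\<forall>s\<in>S. F s \<in> sets M \<and> B (snd s) (\<alpha> * r (fst s)) \<subseteq> F s \<and>
                F s \<subseteq> B (snd s) (2 * A * \<alpha> * r (fst s))) \<and>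
             (\<forall>s\<in>S. \<forall>t\<in>S. F s \<subseteq> F t \<or> F t \<subseteq> F s \<or> F s \<inter> F t = {})"
    by (intro laminar_enlargement S \<alpha> r sep)
  then obtain L where L0: "\<forall>s\<in>S. L s \<in> sets M \<and> B (snd s) (\<alpha> * r (fst s)) \<subseteq> L s \<and>
                L s \<subseteq> B (snd s) (2 * A * \<alpha> * r (fst s))"
    and lam0: "\<forall>s\<in>S. \<forall>t\<in>S. L s \<subseteq> L t \<or> L t \<subseteq> L s \<or> L s \<inter> L t = {}"
    by (elim exE conjE) (rule that)
  have L: "L s \<in> sets M" "B (snd s) (\<alpha> * r (fst s)) \<subseteq> L s" "L s \<subseteq> B (snd s) (2 * A * \<alpha> * r (fst s))"
    if "s \<in> S" for s using L0 that by auto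
  have A0: "0 < A" using A_ge_1 by simp
  define N1 where "N1 = density M (\<lambda>x. ennreal (1 / w x))"
  define N2 where "N2 = density M (\<lambda>x. ennreal (w x))"
  have [measurable_cong, simp]: "sets N1 = sets M" "sets N2 = sets M" unfolding N1_def N2_def by auto
  define f' where "f' x = f x * ennreal (w x)" for x
  define g' where "g' x = g x * ennreal (1 / w x)" for x
  have [measurable]: "f' \<in> borel_measurable M" "g' \<in> borel_measurable M" unfolding f'_def[abs_def] g'_def[abs_def] by measurable
  have ww: "AE x in M. ennreal (w x) * ennreal (1 / w x) = 1"
    using w_pos by eventually_elim (simp add: ennreal_mult[symmetric])
  have ww': "AE x in M. ennreal (1 / w x) * ennreal (w x) = 1" using ww by (simp add: mult.commute)
  have I1: "(\<integral>\<^sup>+x\<in>Q. f' x \<partial>N1) = (\<integral>\<^sup>+x\<in>Q. f x \<partial>M)" if "Q \<in> sets M" for Q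
    unfolding N1_def f'_def using ww' that by (intro density_reciprocal(1)) auto
  have I2: "(\<integral>\<^sup>+x\<in>Q. g' x \<partial>N2) = (\<integral>\<^sup>+x\<in>Q. g x \<partial>M)" if "Q \<in> sets M" for Q
    unfolding N2_def g'_def using ww that by (intro density_reciprocal(1)) auto
  define m1 where "m1 = lam_max N1 S L f'"
  define m2 where "m2 = lam_max N2 S L g'"
  have N_fin: "emeasure N1 (L s) < \<infinity>" "emeasure N2 (L s) < \<infinity>"
    and N_prod: "emeasure N1 (L s) * emeasure N2 (L s) \<le> a * (ennreal (V (snd s) (2 * A * \<alpha> * r (fst s))))\<^sup>2"
    if s: "s \<in> S" for s
  proof -
    define b where "b = B (snd s) (2 * A * \<alpha> * r (fst s))"
    have pos: "0 < 2 * A * \<alpha> * r (fst s)" using A0 \<alpha> r by simp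
    have [measurable]: "b \<in> sets M" "L s \<in> sets M" unfolding b_def using S s L by auto
    have e1: "emeasure N1 (L s) \<le> (\<integral>\<^sup>+y\<in>b. ennreal (1 / w y) \<partial>M)"
      unfolding N1_def using L(3)[OF s] unfolding b_def[symmetric]
      by (subst emeasure_density) (auto intro!: nn_integral_mono simp: indicator_def)
    have e2: "emeasure N2 (L s) \<le> (\<integral>\<^sup>+y\<in>b. ennreal (w y) \<partial>M)"
      unfolding N2_def using L(3)[OF s] unfolding b_def[symmetric]
      by (subst emeasure_density) (auto intro!: nn_integral_mono simp: indicator_def)
    show "emeasure N1 (L s) < \<infinity>" using e1 sfin[OF S(2)[OF s] pos] unfolding b_def by (rule le_less_trans)
    show "emeasure N2 (L s) < \<infinity>" using e2 wfin[OF S(2)[OF s] pos] unfolding b_def by (rule le_less_trans)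
    have "emeasure N1 (L s) * emeasure N2 (L s) \<le> (\<integral>\<^sup>+y\<in>b. ennreal (1 / w y) \<partial>M) * (\<integral>\<^sup>+y\<in>b. ennreal (w y) \<partial>M)"
      using e1 e2 by (intro mult_mono) auto
    also have "\<dots> \<le> a * (ennreal (V (snd s) (2 * A * \<alpha> * r (fst s))))\<^sup>2"
      using A2[OF S(2)[OF s] pos] unfolding b_def by (subst mult.commute)
    finally show "emeasure N1 (L s) * emeasure N2 (L s) \<le> a * (ennreal (V (snd s) (2 * A * \<alpha> * r (fst s))))\<^sup>2" .
  qed
  have meas [measurable]: "m1 \<in> borel_measurable M" "m2 \<in> borel_measurable M"
    using lam_max_measurable[of S L N1 f'] lam_max_measurable[of S L N2 g'] S L unfolding m1_def m2_def by auto
  define K where "K = (Dil (2 * A))\<^sup>2 * c\<^sub>0"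
  have K0: "0 \<le> K" unfolding K_def using c0 by simp
  have trm: "(\<integral>\<^sup>+y\<in>B (snd s) (\<alpha> * r (fst s)). f y \<partial>M) / ennreal (V (snd s) (\<alpha> * r (fst s)))
                    * (\<integral>\<^sup>+y\<in>B (snd s) (\<alpha> * r (fst s)). g y \<partial>M)
        \<le> a * ennreal K * (\<integral>\<^sup>+x. (m1 x * m2 x) * indicator (E s) x \<partial>M)" if s: "s \<in> S" for s
  proof -
    define v where "v = V (snd s) (\<alpha> * r (fst s))"
    have v: "0 < v" unfolding v_def using S(2)[OF s] \<alpha> r by (intro V_pos) auto
    define a1 where "a1 = (\<integral>\<^sup>+y\<in>L s. f' y \<partial>N1) / emeasure N1 (L s)"
    define a2 where "a2 = (\<integral>\<^sup>+y\<in>L s. g' y \<partial>N2) / emeasure N2 (L s)"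
    have Ls: "L s \<in> sets M" using L s by auto
    have F1: "(\<integral>\<^sup>+y\<in>B (snd s) (\<alpha> * r (fst s)). f y \<partial>M) \<le> a1 * emeasure N1 (L s)"
    proof -
      have "(\<integral>\<^sup>+y\<in>B (snd s) (\<alpha> * r (fst s)). f y \<partial>M) \<le> (\<integral>\<^sup>+y\<in>L s. f y \<partial>M)"
        using L(2)[OF s] by (intro nn_integral_mono) (auto simp: indicator_def)
      also have "\<dots> = a1 * emeasure N1 (L s)" unfolding a1_def
        using set_nn_integral_as_average[of "L s" N1 f'] N_fin[OF s] Ls I1[OF Ls] by simp
      finally show ?thesis .
    qed
    have F2: "(\<integral>\<^sup>+y\<in>B (snd s) (\<alpha> * r (fst s)). g y \<partial>M) \<le> a2 * emeasure N2 (L s)"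
    proof -
      have "(\<integral>\<^sup>+y\<in>B (snd s) (\<alpha> * r (fst s)). g y \<partial>M) \<le> (\<integral>\<^sup>+y\<in>L s. g y \<partial>M)"
        using L(2)[OF s] by (intro nn_integral_mono) (auto simp: indicator_def)
      also have "\<dots> = a2 * emeasure N2 (L s)" unfolding a2_def
        using set_nn_integral_as_average[of "L s" N2 g'] N_fin[OF s] Ls I2[OF Ls] by simp
      finally show ?thesis .
    qed
    \<comment> \<open>Of the two volumes supplied by \<open>A2\<close>, one cancels the volume in
      the average of \<open>f\<close>, and the other is replaced by \<open>measure M (E s)\<close>
      at the cost of \<open>c\<^sub>0\<close>.\<close>
    have "V (snd s) (2 * A * (\<alpha> * r (fst s))) \<le> Dil (2 * A) * v"
      unfolding v_def using S(2)[OF s] \<alpha> r by (intro V_dil) auto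
    then have "(V (snd s) (2 * A * \<alpha> * r (fst s)))\<^sup>2 \<le> (Dil (2 * A) * v)\<^sup>2"
      by (intro power_mono) (auto simp: V_def mult.assoc)
    also have "\<dots> = (Dil (2 * A))\<^sup>2 * v * v" by (simp add: power2_eq_square)
    also have "\<dots> \<le> (Dil (2 * A))\<^sup>2 * (c\<^sub>0 * measure M (E s)) * v"
      using E(4)[OF s] v unfolding v_def[symmetric] by (intro mult_right_mono mult_left_mono) auto
    finally have "(V (snd s) (2 * A * \<alpha> * r (fst s)))\<^sup>2 \<le> K * measure M (E s) * v" unfolding K_def by (simp add: mult_ac)
    then have Vb: "(ennreal (V (snd s) (2 * A * \<alpha> * r (fst s))))\<^sup>2 / ennreal v \<le> ennreal K * ennreal (measure M (E s))"
      using v K0 by (simp add: V_def ennreal_power divide_ennreal ennreal_mult[symmetric] pos_divide_le_eq)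
    have Em: "ennreal (measure M (E s)) = emeasure M (E s)"
    proof -
      have "emeasure M (E s) \<le> emeasure M (B (snd s) (\<alpha> * r (fst s)))"
        using E(3)[OF s] S(2)[OF s] by (intro emeasure_mono) auto
      then have "emeasure M (E s) \<noteq> \<infinity>" using emeasure_B[OF S(2)[OF s]] by (auto simp: top_unique)
      then show ?thesis by (simp add: emeasure_eq_ennreal_measure)
    qed
    have "(\<integral>\<^sup>+y\<in>B (snd s) (\<alpha> * r (fst s)). f y \<partial>M) / ennreal v * (\<integral>\<^sup>+y\<in>B (snd s) (\<alpha> * r (fst s)). g y \<partial>M)
        \<le> a1 * emeasure N1 (L s) / ennreal v * (a2 * emeasure N2 (L s))"
      using F1 F2 by (intro mult_mono divide_right_mono_ennreal) auto
    also have "\<dots> = a1 * a2 * ((emeasure N1 (L s) * emeasure N2 (L s)) / ennreal v)"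
      by (simp add: divide_ennreal_def mult_ac)
    also have "\<dots> \<le> a1 * a2 * ((a * (ennreal (V (snd s) (2 * A * \<alpha> * r (fst s))))\<^sup>2) / ennreal v)"
      using N_prod[OF s] by (intro mult_left_mono divide_right_mono_ennreal) auto
    also have "\<dots> = a1 * a2 * (a * ((ennreal (V (snd s) (2 * A * \<alpha> * r (fst s))))\<^sup>2 / ennreal v))"
      by (simp add: ennreal_times_divide)
    also have "\<dots> \<le> a1 * a2 * (a * (ennreal K * emeasure M (E s)))"
      using Vb unfolding Em by (intro mult_left_mono) auto
    also have "\<dots> = a * ennreal K * (\<integral>\<^sup>+x. a1 * a2 * indicator (E s) x \<partial>M)"
      using E(1)[OF s] by (subst nn_integral_cmult_indicator) (auto simp: mult_ac)
    also have "\<dots> \<le> a * ennreal K * (\<integral>\<^sup>+x. m1 x * m2 x * indicator (E s) x \<partial>M)"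
    proof (intro mult_left_mono nn_integral_mono)
      fix x
      show "a1 * a2 * indicator (E s) x \<le> m1 x * m2 x * indicator (E s) x"
      proof (cases "x \<in> E s")
        case True
        then have x: "x \<in> L s" using E(3)[OF s] L(2)[OF s] by auto
        have "a1 * indicator (L s) x \<le> m1 x" unfolding m1_def lam_max_def a1_def using s by (intro SUP_upper)
        moreover have "a2 * indicator (L s) x \<le> m2 x" unfolding m2_def lam_max_def a2_def using s by (intro SUP_upper)
        ultimately show ?thesis using True x by (auto intro!: mult_mono)
      qed simp
    qed auto
    finally show ?thesis unfolding v_def .
  qed
  have "(\<Sum>s\<in>S. (\<integral>\<^sup>+y\<in>B (snd s) (\<alpha> * r (fst s)). f y \<partial>M) / ennreal (V (snd s) (\<alpha> * r (fst s)))
                    * (\<integral>\<^sup>+y\<in>B (snd s) (\<alpha> * r (fst s)). g y \<partial>M))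
      \<le> (\<Sum>s\<in>S. a * ennreal K * (\<integral>\<^sup>+x. (m1 x * m2 x) * indicator (E s) x \<partial>M))"
    by (intro sum_mono trm)
  also have "\<dots> = a * ennreal K * (\<integral>\<^sup>+x. (\<Sum>s\<in>S. (m1 x * m2 x) * indicator (E s) x) \<partial>M)"
    using E(1) by (subst nn_integral_sum) (auto simp: sum_distrib_left)
  also have "\<dots> \<le> a * ennreal K * (\<integral>\<^sup>+x. m1 x * m2 x \<partial>M)"
    using S(1) E(2) by (intro mult_left_mono nn_integral_mono sum_disjoint_indicator_le) auto
  also have "\<dots> \<le> a * ennreal K * ennreal (4 * \<phi> * \<gamma>)"
  proof (intro mult_left_mono ennreal_power2_le_imp_le)
    \<comment> \<open>Inserting \<open>sqrt (1 / w x) * sqrt (w x) = 1\<close> lets Cauchy--Schwarz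
      for \<open>dx\<close> split the integral into the two weighted norms.\<close>
    have "(\<integral>\<^sup>+x. m1 x * m2 x \<partial>M) = (\<integral>\<^sup>+x. (m1 x * ennreal (sqrt (1 / w x))) * (m2 x * ennreal (sqrt (w x))) \<partial>M)"
    proof (intro nn_integral_cong_AE)
      show "AE x in M. m1 x * m2 x = m1 x * ennreal (sqrt (1 / w x)) * (m2 x * ennreal (sqrt (w x)))"
        using w_pos
      proof eventually_elim
        case (elim x)
        then have "ennreal (sqrt (1 / w x)) * ennreal (sqrt (w x)) = 1"
          by (simp add: ennreal_mult[symmetric] real_sqrt_divide)
        then show ?case by (simp add: mult_ac)
      qed
    qed
    then have "(\<integral>\<^sup>+x. m1 x * m2 x \<partial>M)\<^sup>2 \<le> (\<integral>\<^sup>+x. (m1 x * ennreal (sqrt (1 / w x)))\<^sup>2 \<partial>M) * (\<integral>\<^sup>+x. (m2 x * ennreal (sqrt (w x)))\<^sup>2 \<partial>M)"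
      by (simp only:) (intro Cauchy_Schwarz_nn_integral; measurable)
    also have "\<dots> \<le> ennreal (4 * \<phi>\<^sup>2) * ennreal (4 * \<gamma>\<^sup>2)"
    proof (intro mult_mono)
      have "(\<integral>\<^sup>+x. (m1 x * ennreal (sqrt (1 / w x)))\<^sup>2 \<partial>M) \<le> 4 * (\<integral>\<^sup>+x. (f x)\<^sup>2 * ennreal (w x) \<partial>M)"
        unfolding m1_def N1_def f'_def[abs_def]
        using S(1) L(1) N_fin(1)[unfolded N1_def] lam0 ww' w_pos
        by (intro weighted_laminar_maximal) (auto elim!: eventually_mono)
      also have "\<dots> \<le> 4 * ennreal (\<phi>\<^sup>2)" using fn by (intro mult_left_mono) auto
      finally show "(\<integral>\<^sup>+x. (m1 x * ennreal (sqrt (1 / w x)))\<^sup>2 \<partial>M) \<le> ennreal (4 * \<phi>\<^sup>2)"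
        by (simp add: ennreal_mult)
      have "(\<integral>\<^sup>+x. (m2 x * ennreal (sqrt (w x)))\<^sup>2 \<partial>M) \<le> 4 * (\<integral>\<^sup>+x. (g x)\<^sup>2 * ennreal (1 / w x) \<partial>M)"
        unfolding m2_def N2_def g'_def[abs_def]
        using S(1) L(1) N_fin(2)[unfolded N2_def] lam0 ww w_pos
        by (intro weighted_laminar_maximal) auto
      also have "\<dots> \<le> 4 * ennreal (\<gamma>\<^sup>2)" using gn by (intro mult_left_mono) auto
      finally show "(\<integral>\<^sup>+x. (m2 x * ennreal (sqrt (w x)))\<^sup>2 \<partial>M) \<le> ennreal (4 * \<gamma>\<^sup>2)"
        by (simp add: ennreal_mult)
    qed auto
    also have "\<dots> = (ennreal (4 * \<phi> * \<gamma>))\<^sup>2"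
      using fn gn by (simp add: ennreal_power ennreal_mult[symmetric] power2_eq_square mult_ac)
    finally show "(\<integral>\<^sup>+x. m1 x * m2 x \<partial>M)\<^sup>2 \<le> (ennreal (4 * \<phi> * \<gamma>))\<^sup>2" .
  qed (use fn gn in auto)
  also have "\<dots> = a * ennreal (K * (4 * \<phi> * \<gamma>))" using K0 fn gn by (simp add: ennreal_mult mult.assoc)
  finally show ?thesis unfolding K_def .
qed

text \<open>Centres of one scale are only \<open>r k\<close> apart, less than
  \<open>sparse_class_bound\<close> asks for. By \<open>packing\<close>, few of them lie within
  \<open>4 * A\<^sup>2 * \<alpha> * r k\<close> of a given one, so a colouring splits the family
  into boundedly many classes to which that lemma applies.\<close>

lemma sparse_form_bound:
  fixes S :: "(nat \<times> 'a) set" and r :: "nat \<Rightarrow> real" and w :: "'a \<Rightarrow> real" and f g :: "'a \<Rightarrow> ennreal"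
  assumes S: "finite S" "\<And>s. s \<in> S \<Longrightarrow> snd s \<in> space M" and \<alpha>: "0 < \<alpha>"
    and r: "\<And>k. 0 < r k" "\<And>j k. k < j \<Longrightarrow> 4 * A\<^sup>2 * r j \<le> r k"
    and sep: "\<And>k z z'. (k, z) \<in> S \<Longrightarrow> (k, z') \<in> S \<Longrightarrow> z \<noteq> z' \<Longrightarrow> r k \<le> \<rho> z z'"
    and E: "\<And>s. s \<in> S \<Longrightarrow> E s \<in> sets M" "disjoint_family_on E S"
      "\<And>s. s \<in> S \<Longrightarrow> E s \<subseteq> B (snd s) (\<alpha> * r (fst s))"
      "\<And>s. s \<in> S \<Longrightarrow> V (snd s) (\<alpha> * r (fst s)) \<le> c\<^sub>0 * measure M (E s)" and c0: "0 \<le> c\<^sub>0"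
    and w: "w \<in> borel_measurable M" and w_pos: "AE x in M. 0 < w x"
    and A2: "\<And>x r. x \<in> space M \<Longrightarrow> 0 < r \<Longrightarrow>
      (\<integral>\<^sup>+y\<in>B x r. ennreal (w y) \<partial>M) * (\<integral>\<^sup>+y\<in>B x r. ennreal (1 / w y) \<partial>M) \<le> a * (ennreal (V x r))\<^sup>2"
    and wfin: "\<And>x r. x \<in> space M \<Longrightarrow> 0 < r \<Longrightarrow> (\<integral>\<^sup>+y\<in>B x r. ennreal (w y) \<partial>M) < \<infinity>"
    and sfin: "\<And>x r. x \<in> space M \<Longrightarrow> 0 < r \<Longrightarrow> (\<integral>\<^sup>+y\<in>B x r. ennreal (1 / w y) \<partial>M) < \<infinity>"
    and f: "f \<in> borel_measurable M" and g: "g \<in> borel_measurable M"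
    and fn: "(\<integral>\<^sup>+x. (f x)\<^sup>2 * ennreal (w x) \<partial>M) \<le> ennreal (\<phi>\<^sup>2)" "0 \<le> \<phi>"
    and gn: "(\<integral>\<^sup>+x. (g x)\<^sup>2 * ennreal (1 / w x) \<partial>M) \<le> ennreal (\<gamma>\<^sup>2)" "0 \<le> \<gamma>"
  shows "(\<Sum>s\<in>S. (\<integral>\<^sup>+y\<in>B (snd s) (\<alpha> * r (fst s)). f y \<partial>M) / ennreal (V (snd s) (\<alpha> * r (fst s)))
                    * (\<integral>\<^sup>+y\<in>B (snd s) (\<alpha> * r (fst s)). g y \<partial>M))
           \<le> a * ennreal ((Dil (2 * A * A * (4 * A\<^sup>2 * \<alpha> + A * (4 * A\<^sup>2 * \<alpha> + 1))) + 1) * ((Dil (2 * A))\<^sup>2 * c\<^sub>0 * (4 * \<phi> * \<gamma>)))"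
proof -
  define D0 where "D0 = Dil (2 * A * A * (4 * A\<^sup>2 * \<alpha> + A * (4 * A\<^sup>2 * \<alpha> + 1)))"
  define n where "n = nat \<lfloor>D0\<rfloor>"
  define R where "R s t \<longleftrightarrow> s \<in> S \<and> t \<in> S \<and> fst s = fst t \<and> \<rho> (snd s) (snd t) < 4 * A\<^sup>2 * \<alpha> * r (fst s)" for s t
  have "symp R" unfolding R_def by (intro sympI) (auto simp: rho_sym S(2))
  moreover have "card {t\<in>S. R s t} \<le> n" if s: "s \<in> S" for s
  proof -
    define Z where "Z = snd ` {t\<in>S. R s t}"
    have "inj_on snd {t\<in>S. R s t}" unfolding R_def by (auto simp: inj_on_def prod_eq_iff)
    then have "card {t\<in>S. R s t} = card Z" unfolding Z_def by (simp add: card_image)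
    moreover have "real (card Z) \<le> D0" unfolding D0_def
    proof (rule packing)
      show "finite Z" unfolding Z_def using S by auto
      show "Z \<subseteq> B (snd s) (4 * A\<^sup>2 * \<alpha> * r (fst s))" unfolding Z_def R_def using S by (auto simp: mem_B)
      show "r (fst s) \<le> \<rho> z z'" if "z \<in> Z" "z' \<in> Z" "z \<noteq> z'" for z z'
        using that sep[of "fst s" z z'] unfolding Z_def R_def by auto
    qed (use s S r \<alpha> A_ge_1 in auto)
    ultimately show ?thesis unfolding n_def by linarith
  qed
  ultimately obtain col :: "nat \<times> 'a \<Rightarrow> nat" where col: "\<forall>s\<in>S. col s \<le> n"
    "\<forall>s\<in>S. \<forall>t\<in>S. R s t \<and> s \<noteq> t \<longrightarrow> col s \<noteq> col t"
    using greedy_colouring[OF S(1), of R n] by auto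
  define c where "c s = (\<integral>\<^sup>+y\<in>B (snd s) (\<alpha> * r (fst s)). f y \<partial>M) / ennreal (V (snd s) (\<alpha> * r (fst s)))
                    * (\<integral>\<^sup>+y\<in>B (snd s) (\<alpha> * r (fst s)). g y \<partial>M)" for s
  have "(\<Sum>s\<in>S. c s) = (\<Sum>i\<in>{..n}. \<Sum>s\<in>{s\<in>S. col s = i}. c s)"
    using col(1) S(1) by (subst sum.group) auto
  also have "\<dots> \<le> (\<Sum>i\<in>{..n}. a * ennreal ((Dil (2 * A))\<^sup>2 * c\<^sub>0 * (4 * \<phi> * \<gamma>)))"
    unfolding c_def
  proof (intro sum_mono sparse_class_bound)
    fix i k z z' assume "i \<in> {..n}"
      and kz: "(k, z) \<in> {s \<in> S. col s = i}" "(k, z') \<in> {s \<in> S. col s = i}" and zz: "z \<noteq> z'"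
    then have "\<not> R (k, z) (k, z')" using col(2)[rule_format, of "(k, z)" "(k, z')"] by auto
    then show "4 * A\<^sup>2 * \<alpha> * r k \<le> \<rho> z z'" using kz unfolding R_def by auto
  next
    fix i
    show "disjoint_family_on E {s \<in> S. col s = i}"
      using E(2) by (rule disjoint_family_on_mono[rotated]) auto
  qed (use assms in auto)
  also have "\<dots> = a * ennreal ((real n + 1) * ((Dil (2 * A))\<^sup>2 * c\<^sub>0 * (4 * \<phi> * \<gamma>)))"
    using c0 fn gn by (simp add: ennreal_mult ennreal_of_nat_eq_real_of_nat[symmetric] mult_ac add_ac)
  also have "\<dots> \<le> a * ennreal ((D0 + 1) * ((Dil (2 * A))\<^sup>2 * c\<^sub>0 * (4 * \<phi> * \<gamma>)))"
  proof (intro mult_left_mono ennreal_leI mult_right_mono add_right_mono)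
    show "real n \<le> D0" unfolding n_def D0_def using Dil_pos by (simp add: less_imp_le)
  qed (use c0 fn gn in auto)
  finally show ?thesis unfolding c_def D0_def .
qed

end

section \<open>Dyadic cubes\<close>

text \<open>Cubes in the style of Christ. The point \<open>x\<^sub>0\<close> belongs to every net,
  so that the cube of generation \<open>0\<close> about it contains any prescribed ball about
  \<open>x\<^sub>0\<close> once \<open>R\<close> is large.\<close>

locale dyadic_system = doubling_space +
  fixes R :: real and x\<^sub>0 :: 'a
  assumes R_pos: "0 < R" and x0: "x\<^sub>0 \<in> space M"
begin

text \<open>Small enough for two purposes: \<open>4 * A\<^sup>2 * \<delta> \<le> 1\<close> makes the
  radii admissible for \<open>laminar_enlargement\<close>, and
  \<open>A ^ 4 * \<delta> = 1 / 16\<close> leaves room for the inner ball in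
  \<open>ball_sub_Q\<close>.\<close>

definition \<delta> :: real where "\<delta> = 1 / (16 * A ^ 4)"

definition rad :: "nat \<Rightarrow> real" where "rad k = R * \<delta> ^ k"

definition separated :: "nat \<Rightarrow> 'a set \<Rightarrow> bool" where
  "separated k N \<longleftrightarrow> N \<subseteq> space M \<and> (\<forall>z\<in>N. \<forall>z'\<in>N. z \<noteq> z' \<longrightarrow> rad k \<le> \<rho> z z')"

definition Net :: "nat \<Rightarrow> 'a set" where
  "Net k = (SOME N. separated k N \<and> x\<^sub>0 \<in> N \<and> (\<forall>x\<in>space M. \<exists>z\<in>N. \<rho> x z < rad k))"

text \<open>Several centres may lie within \<open>rad k\<close> of a point. The last clause forces
  the choice where one is closer than \<open>rad k / (2 * A)\<close>; at most one can be that close,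
  and because of this clause each cube contains a ball about its centre.\<close>

definition par :: "nat \<Rightarrow> 'a \<Rightarrow> 'a" where
  "par k z = (SOME a. a \<in> Net k \<and> \<rho> z a < rad k \<and> (\<forall>b\<in>Net k. \<rho> z b < rad k / (2 * A) \<longrightarrow> b = a))"

definition kids :: "nat \<Rightarrow> 'a \<Rightarrow> 'a set" where
  "kids k a = {b \<in> Net (Suc k). par k b = a}"

primrec desc :: "nat \<Rightarrow> nat \<Rightarrow> 'a \<Rightarrow> 'a set" where
  "desc 0 k a = {a}"
| "desc (Suc j) k a = (\<Union>b\<in>kids k a. desc j (Suc k) b)"

text \<open>Recording the points that are approximated at infinitely many (rather than all) scales makes the sets
  of all centres of one generation cover the whole space, not only almost all of it; \<open>Q\<close> then breaks ties by
  an enumeration of the centres.\<close>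

definition lim_set :: "nat \<Rightarrow> 'a \<Rightarrow> 'a set" where
  "lim_set k a = {x \<in> space M. \<forall>n. \<exists>j\<ge>n. \<exists>b\<in>desc j k a. \<rho> b x < rad (k + j)}"

definition num :: "'a \<Rightarrow> nat" where "num = to_nat_on (\<Union>k. Net k)"

primrec Q :: "nat \<Rightarrow> 'a \<Rightarrow> 'a set" where
  "Q 0 a = lim_set 0 a - (\<Union>b\<in>{b\<in>Net 0. num b < num a}. lim_set 0 b)"
| "Q (Suc k) a = Q k (par k a) \<inter> lim_set (Suc k) a
     - (\<Union>b\<in>{b\<in>Net (Suc k). par k b = par k a \<and> num b < num a}. lim_set (Suc k) b)"

lemma A_pos: "0 < A" using A_ge_1 by simp

lemma delta_pos: "0 < \<delta>" unfolding \<delta>_def using A_pos by simp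

lemma delta_A: "A ^ 4 * \<delta> = 1 / 16" unfolding \<delta>_def using A_pos by simp

lemma delta_A_le: "i \<le> 4 \<Longrightarrow> A ^ i * \<delta> \<le> 1 / 16"
  using delta_A power_increasing[of i 4 A] A_ge_1 delta_pos
  by (metis less_imp_le mult_right_mono)

lemma delta_le: "\<delta> \<le> 1 / 16"
  using delta_A_le[of 0] by simp

lemma rad_pos: "0 < rad k"
  unfolding rad_def using R_pos delta_pos by simp

lemma rad_Suc: "rad (Suc k) = \<delta> * rad k"
  unfolding rad_def by simp

lemma rad_antimono: "k \<le> j \<Longrightarrow> rad j \<le> rad k"
  unfolding rad_def using R_pos delta_pos delta_le by (simp add: power_decreasing)

lemma rad_less: "k < j \<Longrightarrow> rad j \<le> \<delta> * rad k"
  using rad_antimono[of "Suc k" j] by (simp add: rad_Suc)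

lemma rad_4A2: "k < j \<Longrightarrow> 4 * A\<^sup>2 * rad j \<le> rad k"
proof -
  assume "k < j"
  then have "4 * A\<^sup>2 * rad j \<le> 4 * A\<^sup>2 * (\<delta> * rad k)" using rad_less by (intro mult_left_mono) auto
  also have "\<dots> = 4 * (A\<^sup>2 * \<delta>) * rad k" by simp
  also have "\<dots> \<le> 1 * rad k" using delta_A_le[of 2] rad_pos[of k] by (intro mult_right_mono) auto
  finally show ?thesis by simp
qed

lemma rad_tendsto: "0 < e \<Longrightarrow> \<exists>k. rad k < e"
proof -
  assume "0 < e"
  then have "\<exists>k. \<delta> ^ k < e / R" using delta_le delta_pos R_pos by (intro real_arch_pow_inv) auto
  then show ?thesis unfolding rad_def using R_pos by (auto simp: pos_less_divide_eq mult.commute)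
qed

text \<open>A maximal separated set covers the space, since a point at distance at least
  \<open>rad k\<close> from all its members could be added.\<close>

lemma Net_exists: "\<exists>N. separated k N \<and> x\<^sub>0 \<in> N \<and> (\<forall>x\<in>space M. \<exists>z\<in>N. \<rho> x z < rad k)"
proof -
  define \<A> where "\<A> = {N. separated k N \<and> x\<^sub>0 \<in> N}"
  have "{x\<^sub>0} \<in> \<A>" unfolding \<A>_def separated_def using x0 by auto
  have "\<exists>N\<in>\<A>. \<forall>X\<in>\<A>. N \<subseteq> X \<longrightarrow> X = N"
  proof (rule subset_Zorn_nonempty)
    show "\<A> \<noteq> {}" using \<open>{x\<^sub>0} \<in> \<A>\<close> by auto
    fix C assume C: "C \<noteq> {}" "subset.chain \<A> C"
    then have CA: "C \<subseteq> \<A>" and ch: "\<And>X Y. X \<in> C \<Longrightarrow> Y \<in> C \<Longrightarrow> X \<subseteq> Y \<or> Y \<subseteq> X"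
      unfolding subset_chain_def by auto
    have "rad k \<le> \<rho> z z'" if z: "z \<in> \<Union>C" "z' \<in> \<Union>C" "z \<noteq> z'" for z z'
    proof -
      obtain X Y where "X \<in> C" "z \<in> X" "Y \<in> C" "z' \<in> Y" using z by auto
      then obtain Z where "Z \<in> C" "z \<in> Z" "z' \<in> Z" using ch[of X Y] by auto
      then show ?thesis using CA z(3) unfolding \<A>_def separated_def by auto
    qed
    then show "\<Union>C \<in> \<A>" using C(1) CA unfolding \<A>_def separated_def by auto
  qed
  then obtain N where N: "N \<in> \<A>" "\<And>X. X \<in> \<A> \<Longrightarrow> N \<subseteq> X \<Longrightarrow> X = N" by auto
  have NX: "N \<subseteq> space M" using N(1) unfolding \<A>_def separated_def by auto
  have "\<exists>z\<in>N. \<rho> x z < rad k" if x: "x \<in> space M" for x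
  proof (rule ccontr)
    assume no: "\<not> ?thesis"
    have far: "rad k \<le> \<rho> x z" "rad k \<le> \<rho> z x" if "z \<in> N" for z
    proof -
      show "rad k \<le> \<rho> x z" using no that by (auto simp: not_less)
      then show "rad k \<le> \<rho> z x" using rho_sym[of x z] x NX that by auto
    qed
    then have "insert x N \<in> \<A>" using N(1) x unfolding \<A>_def separated_def by auto
    then have "x \<in> N" using N(2)[of "insert x N"] by auto
    then show False using far[of x] rho_self[OF x] rad_pos[of k] by auto
  qed
  then show ?thesis using N(1) unfolding \<A>_def by auto
qed

lemma Net: "separated k (Net k) \<and> x\<^sub>0 \<in> Net k \<and> (\<forall>x\<in>space M. \<exists>z\<in>Net k. \<rho> x z < rad k)"
  unfolding Net_def by (rule someI_ex[OF Net_exists])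

lemma Net_space: "a \<in> Net k \<Longrightarrow> a \<in> space M"
  using Net[of k] unfolding separated_def by auto

lemma Net_sep: "a \<in> Net k \<Longrightarrow> b \<in> Net k \<Longrightarrow> a \<noteq> b \<Longrightarrow> rad k \<le> \<rho> a b"
  using Net[of k] unfolding separated_def by auto

lemma Net_cover: "x \<in> space M \<Longrightarrow> \<exists>z\<in>Net k. \<rho> x z < rad k"
  using Net by auto

lemma x0_Net: "x\<^sub>0 \<in> Net k" using Net by auto

lemma Net_local_finite:
  assumes "x \<in> space M" "0 < s" shows "finite (Net k \<inter> B x s)"
  using assms Net_sep rad_pos by (intro separated_finite[of _ x s "rad k"]) auto

lemma countable_Net: "countable (Net k)"
proof -
  have "Net k \<subseteq> (\<Union>n::nat. Net k \<inter> B x\<^sub>0 (real n + 1))"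
  proof
    fix a assume a: "a \<in> Net k"
    obtain n :: nat where "\<rho> x\<^sub>0 a < real n" using reals_Archimedean2 by auto
    then have "a \<in> Net k \<inter> B x\<^sub>0 (real n + 1)" using a Net_space by (auto simp: mem_B)
    then show "a \<in> (\<Union>n::nat. Net k \<inter> B x\<^sub>0 (real n + 1))" by blast
  qed
  moreover have "countable (\<Union>n::nat. Net k \<inter> B x\<^sub>0 (real n + 1))"
    using Net_local_finite[OF x0] by (intro countable_UN) (auto intro: countable_finite)
  ultimately show ?thesis by (rule countable_subset)
qed

lemma num_inj: "a \<in> Net k \<Longrightarrow> b \<in> Net k \<Longrightarrow> num a = num b \<Longrightarrow> a = b"
  using inj_on_to_nat_on[of "\<Union>k. Net k"] countable_Net unfolding num_def inj_on_def by blast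

lemma Net_close_unique:
  assumes "a \<in> Net k" "b \<in> Net k" "x \<in> space M" "\<rho> x a < rad k / (2 * A)" "\<rho> x b < rad k / (2 * A)"
  shows "a = b"
proof (rule ccontr)
  assume "a \<noteq> b"
  have "\<rho> a b \<le> A * (\<rho> a x + \<rho> x b)" using assms Net_space rho_tri by blast
  also have "\<dots> < A * (rad k / (2 * A) + rad k / (2 * A))"
    using assms rho_sym[of a x] Net_space A_pos by (intro mult_strict_left_mono add_strict_mono) auto
  also have "\<dots> = rad k" using A_pos by (simp add: field_simps)
  finally show False using Net_sep[OF assms(1,2) \<open>a \<noteq> b\<close>] by simp
qed

lemma par:
  assumes "z \<in> space M"
  shows "par k z \<in> Net k" "\<rho> z (par k z) < rad k"
    "\<And>b. b \<in> Net k \<Longrightarrow> \<rho> z b < rad k / (2 * A) \<Longrightarrow> par k z = b"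
proof -
  have "\<exists>a. a \<in> Net k \<and> \<rho> z a < rad k \<and> (\<forall>b\<in>Net k. \<rho> z b < rad k / (2 * A) \<longrightarrow> b = a)"
  proof (cases "\<exists>b\<in>Net k. \<rho> z b < rad k / (2 * A)")
    case True
    then obtain b where b: "b \<in> Net k" "\<rho> z b < rad k / (2 * A)" by auto
    have "rad k / (2 * A) \<le> rad k / 1"
      using A_ge_1 rad_pos[of k] by (intro divide_left_mono) auto
    then have bk: "\<rho> z b < rad k" using b(2) by simp
    have "c = b" if "c \<in> Net k" "\<rho> z c < rad k / (2 * A)" for c
      using Net_close_unique[OF that(1) b(1) assms that(2) b(2)] .
    then have "\<forall>c\<in>Net k. \<rho> z c < rad k / (2 * A) \<longrightarrow> c = b" by blast
    then show ?thesis using b(1) bk by blast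
  next
    case False
    then show ?thesis using Net_cover[OF assms, of k] by auto
  qed
  then have "par k z \<in> Net k \<and> \<rho> z (par k z) < rad k \<and> (\<forall>b\<in>Net k. \<rho> z b < rad k / (2 * A) \<longrightarrow> b = par k z)"
    unfolding par_def by (rule someI_ex)
  then show "par k z \<in> Net k" "\<rho> z (par k z) < rad k"
    "\<And>b. b \<in> Net k \<Longrightarrow> \<rho> z b < rad k / (2 * A) \<Longrightarrow> par k z = b" by auto
qed

lemma kids_dist: "b \<in> kids k a \<Longrightarrow> \<rho> b a < rad k"
  using par(2)[of b k] Net_space unfolding kids_def by auto

lemma desc_Net: "a \<in> Net k \<Longrightarrow> b \<in> desc j k a \<Longrightarrow> b \<in> Net (k + j)"
proof (induction j arbitrary: k a)
  case (Suc j)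
  then obtain c where "c \<in> kids k a" "b \<in> desc j (Suc k) c" by auto
  then show ?case using Suc.IH[of c "Suc k"] unfolding kids_def by auto
qed auto

text \<open>As \<open>2 * A * \<delta> \<le> 1\<close>, everything below a kid counts as one more
  \<open>rad k\<close>, so the constant of the quasi-triangle inequality does not accumulate over
  the generations.\<close>

lemma desc_dist: "a \<in> Net k \<Longrightarrow> b \<in> desc j k a \<Longrightarrow> \<rho> a b \<le> 2 * A * rad k"
proof (induction j arbitrary: k a)
  case 0
  then show ?case using Net_space[of a k] rho_self A_pos rad_pos[of k] by auto
next
  case (Suc j)
  then obtain c where c: "c \<in> kids k a" "b \<in> desc j (Suc k) c" by auto
  have cN: "c \<in> Net (Suc k)" using c unfolding kids_def by auto
  have bX: "b \<in> space M" using desc_Net[OF cN c(2)] Net_space by blast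
  have aX: "a \<in> space M" "c \<in> space M" using Suc.prems cN Net_space by auto
  have "2 * A * rad (Suc k) \<le> 1 * rad k"
    using delta_A_le[of 1] rad_pos[of k] unfolding rad_Suc
    by (subst mult.assoc[symmetric], intro mult_right_mono) auto
  then have cb: "\<rho> c b \<le> rad k" using Suc.IH[OF cN c(2)] by simp
  have "\<rho> a b \<le> A * (\<rho> a c + \<rho> c b)" using rho_tri aX bX by blast
  also have "\<dots> \<le> A * (rad k + rad k)"
    using cb kids_dist[OF c(1)] rho_sym[of a c] aX A_pos by (intro mult_left_mono add_mono) auto
  finally show ?case by simp
qed

lemma desc_near:
  assumes "a \<in> Net k" "b \<in> desc j k a" "x \<in> space M" "\<rho> b x < rad (k + j)"
  shows "\<rho> a x < 3 * A\<^sup>2 * rad k"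
proof -
  have X: "a \<in> space M" "b \<in> space M" using assms desc_Net Net_space by blast+
  have "\<rho> b x < rad k" using assms(4) rad_antimono[of k "k + j"] by simp
  have "\<rho> a x \<le> A * (\<rho> a b + \<rho> b x)" using rho_tri X assms by blast
  also have "\<dots> < A * (2 * A * rad k + rad k)"
    using desc_dist[OF assms(1,2)] \<open>\<rho> b x < rad k\<close> A_pos by (intro mult_strict_left_mono) auto
  also have "\<dots> \<le> A * (2 * A * rad k + A * rad k)"
    using A_ge_1 rad_pos[of k] by (intro mult_left_mono add_left_mono) (auto simp: mult_le_cancel_right1)
  also have "\<dots> = 3 * A\<^sup>2 * rad k" by (simp add: power2_eq_square)
  finally show ?thesis .
qed

lemma desc_total: "b \<in> Net (k + j) \<Longrightarrow> \<exists>a\<in>Net k. b \<in> desc j k a"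
proof (induction j arbitrary: k)
  case (Suc j)
  then obtain c where c: "c \<in> Net (Suc k)" "b \<in> desc j (Suc k) c" by force
  then have "c \<in> kids k (par k c)" "par k c \<in> Net k"
    using par(1) Net_space unfolding kids_def by auto
  then show ?case using c by auto
qed auto

lemma lim_set_sub: "a \<in> Net k \<Longrightarrow> lim_set k a \<subseteq> B a (3 * A\<^sup>2 * rad k)"
proof
  fix x assume a: "a \<in> Net k" and "x \<in> lim_set k a"
  then obtain j b where "b \<in> desc j k a" "\<rho> b x < rad (k + j)" "x \<in> space M"
    unfolding lim_set_def by blast
  then show "x \<in> B a (3 * A\<^sup>2 * rad k)" using desc_near a by (auto simp: mem_B)
qed

lemma lim_set_measurable: assumes "a \<in> Net k" shows "lim_set k a \<in> sets M"
proof -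
  have "lim_set k a = (\<Inter>n. \<Union>j\<in>{n..}. \<Union>b\<in>desc j k a. B b (rad (k + j)))"
    unfolding lim_set_def by (auto simp: mem_B Bex_def)
  moreover have "countable (desc j k a)" for j
    by (rule countable_subset[OF _ countable_Net[of "k + j"]]) (auto intro: desc_Net assms)
  then have "(\<Union>b\<in>desc j k a. B b (rad (k + j))) \<in> sets M" for j
    using desc_Net[OF assms] Net_space by (intro sets.countable_UN'') auto
  ultimately show ?thesis by (auto intro!: sets.countable_INT'' sets.countable_UN'')
qed

text \<open>Near \<open>x\<close> there are finitely many centres of generation \<open>0\<close>,
  and at every scale one of them has a descendant close to \<open>x\<close>; by the pigeonhole
  principle one centre serves infinitely many scales. The same argument among the kids proves
  \<open>lim_set_kids\<close>.\<close>

lemma lim_set_top: assumes "x \<in> space M" shows "\<exists>a\<in>Net 0. x \<in> lim_set 0 a"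
proof -
  define C where "C = Net 0 \<inter> B x (3 * A\<^sup>2 * rad 0)"
  have fin: "finite C" unfolding C_def using assms A_pos rad_pos by (intro Net_local_finite) auto
  have "\<exists>a\<in>C. \<exists>b\<in>desc j 0 a. \<rho> b x < rad (0 + j)" for j
  proof -
    obtain b where b: "b \<in> Net (0 + j)" "\<rho> x b < rad (0 + j)" using Net_cover[OF assms] by auto
    then obtain a where a: "a \<in> Net 0" "b \<in> desc j 0 a" using desc_total[of b 0 j] by auto
    have bx: "\<rho> b x < rad (0 + j)" using b rho_sym[of b x] Net_space assms by auto
    then have "\<rho> x a < 3 * A\<^sup>2 * rad 0" using desc_near[OF a assms] rho_sym[of x a] Net_space[OF a(1)] assms by auto
    then have "a \<in> C" unfolding C_def using a Net_space by (auto simp: mem_B)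
    then show ?thesis using a bx by auto
  qed
  then have "\<exists>\<^sub>\<infinity>j. \<exists>a\<in>C. \<exists>b\<in>desc j 0 a. \<rho> b x < rad (0 + j)" by (auto simp: INFM_nat_le)
  then have "\<exists>a\<in>C. \<exists>\<^sub>\<infinity>j. \<exists>b\<in>desc j 0 a. \<rho> b x < rad (0 + j)"
    by (simp only: INFM_finite_Bex_distrib[OF fin])
  then show ?thesis using assms unfolding lim_set_def C_def INFM_nat_le by auto
qed

lemma lim_set_kids: assumes "a \<in> Net k" "x \<in> lim_set k a" shows "\<exists>c\<in>kids k a. x \<in> lim_set (Suc k) c"
proof -
  have x: "x \<in> space M" using assms unfolding lim_set_def by auto
  define C where "C = kids k a \<inter> B x (3 * A\<^sup>2 * rad (Suc k))"
  have "C \<subseteq> Net (Suc k) \<inter> B x (3 * A\<^sup>2 * rad (Suc k))" unfolding C_def kids_def by auto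
  moreover have "finite (Net (Suc k) \<inter> B x (3 * A\<^sup>2 * rad (Suc k)))"
    using x A_pos rad_pos by (intro Net_local_finite) auto
  ultimately have fin: "finite C" by (rule finite_subset)
  have "\<exists>\<^sub>\<infinity>i. \<exists>c\<in>C. \<exists>b\<in>desc i (Suc k) c. \<rho> b x < rad (Suc k + i)"
    unfolding INFM_nat_le
  proof
    fix n
    obtain j where j: "Suc n \<le> j" "\<exists>b\<in>desc j k a. \<rho> b x < rad (k + j)"
      using assms(2) unfolding lim_set_def by blast
    then obtain i where i: "j = Suc i" by (cases j) auto
    then obtain c b where c: "c \<in> kids k a" "b \<in> desc i (Suc k) c" "\<rho> b x < rad (Suc k + i)" using j by auto
    then have cN: "c \<in> Net (Suc k)" unfolding kids_def by auto
    have "\<rho> x c < 3 * A\<^sup>2 * rad (Suc k)"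
      using desc_near[OF cN c(2) x c(3)] rho_sym[of x c] Net_space[OF cN] x by auto
    then have "c \<in> C" unfolding C_def using c cN Net_space by (auto simp: mem_B)
    then show "\<exists>i\<ge>n. \<exists>c\<in>C. \<exists>b\<in>desc i (Suc k) c. \<rho> b x < rad (Suc k + i)" using c i j by auto
  qed
  then have "\<exists>c\<in>C. \<exists>\<^sub>\<infinity>i. \<exists>b\<in>desc i (Suc k) c. \<rho> b x < rad (Suc k + i)"
    by (simp only: INFM_finite_Bex_distrib[OF fin])
  then show ?thesis using x unfolding lim_set_def C_def INFM_nat_le by auto
qed

lemma Q_sub_lim: "Q k a \<subseteq> lim_set k a"
  by (cases k) auto

lemma Q_sub_ball: "a \<in> Net k \<Longrightarrow> Q k a \<subseteq> B a (3 * A\<^sup>2 * rad k)"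
  using Q_sub_lim lim_set_sub by blast

lemma Q_space: "Q k a \<subseteq> space M"
  using Q_sub_lim unfolding lim_set_def by blast

lemma Q_measurable: "a \<in> Net k \<Longrightarrow> Q k a \<in> sets M"
proof (induction k arbitrary: a)
  case 0
  have "(\<Union>b\<in>{b\<in>Net 0. num b < num a}. lim_set 0 b) \<in> sets M"
    using countable_Net[of 0] by (intro sets.countable_UN'') (auto intro: lim_set_measurable countable_subset)
  then show ?case using 0 lim_set_measurable by auto
next
  case (Suc k)
  have "(\<Union>b\<in>{b\<in>Net (Suc k). par k b = par k a \<and> num b < num a}. lim_set (Suc k) b) \<in> sets M"
    using countable_Net[of "Suc k"] by (intro sets.countable_UN'') (auto intro: lim_set_measurable countable_subset)
  then show ?case using Suc.prems Suc.IH[OF par(1)] lim_set_measurable Net_space by auto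
qed

lemma Q_cover: "x \<in> space M \<Longrightarrow> \<exists>a\<in>Net k. x \<in> Q k a"
proof (induction k)
  case 0
  define S where "S = {a\<in>Net 0. x \<in> lim_set 0 a}"
  have "S \<noteq> {}" unfolding S_def using lim_set_top[OF 0] by auto
  then obtain a where a: "a \<in> S" "\<And>b. b \<in> S \<Longrightarrow> num a \<le> num b"
    using arg_min_nat_lemma[of "\<lambda>a. a \<in> S" _ num] by blast
  then have "x \<in> Q 0 a" unfolding S_def by (auto simp: not_less[symmetric])
  then show ?case using a unfolding S_def by auto
next
  case (Suc k)
  then obtain p where p: "p \<in> Net k" "x \<in> Q k p" by auto
  define S where "S = {a\<in>kids k p. x \<in> lim_set (Suc k) a}"
  have "S \<noteq> {}" unfolding S_def using lim_set_kids[OF p(1)] p(2) Q_sub_lim by blast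
  then obtain a where a: "a \<in> S" "\<And>b. b \<in> S \<Longrightarrow> num a \<le> num b"
    using arg_min_nat_lemma[of "\<lambda>a. a \<in> S" _ num] by blast
  then have "x \<in> Q (Suc k) a" using p unfolding S_def kids_def by (auto simp: not_less[symmetric])
  then show ?case using a unfolding S_def kids_def by auto
qed

lemma Q_unique: "a \<in> Net k \<Longrightarrow> b \<in> Net k \<Longrightarrow> x \<in> Q k a \<Longrightarrow> x \<in> Q k b \<Longrightarrow> a = b"
proof (induction k arbitrary: a b)
  case 0
  then have "\<not> num a < num b" "\<not> num b < num a" by auto
  then show ?case using 0 num_inj by (metis linorder_neqE_nat)
next
  case (Suc k)
  then have "par k a = par k b" using Suc.IH[OF par(1) par(1)] Net_space by auto
  then have "\<not> num a < num b" "\<not> num b < num a" using Suc.prems by auto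
  then show ?case using Suc.prems num_inj by (metis linorder_neqE_nat)
qed

lemma Q_parent: "Q (Suc k) a \<subseteq> Q k (par k a)" by auto

lemma Q_ancestor: "j \<le> k \<Longrightarrow> a \<in> Net k \<Longrightarrow> \<exists>b\<in>Net j. Q k a \<subseteq> Q j b"
proof (induction k arbitrary: a)
  case 0
  then show ?case by auto
next
  case (Suc k)
  show ?case
  proof (cases "j = Suc k")
    case True
    then show ?thesis using Suc.prems by blast
  next
    case False
    then obtain b where "b \<in> Net j" "Q k (par k a) \<subseteq> Q j b"
      using Suc.IH[OF _ par(1)] Suc.prems Net_space by (metis le_SucE)
    then show ?thesis using Q_parent by blast
  qed
qed

lemma Q_nested:
  assumes "j \<le> k" "a \<in> Net k" "b \<in> Net j" "Q k a \<inter> Q j b \<noteq> {}" shows "Q k a \<subseteq> Q j b"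
proof -
  obtain c where c: "c \<in> Net j" "Q k a \<subseteq> Q j c" using Q_ancestor assms by blast
  then have "c = b" using assms Q_unique[OF c(1) assms(3)] by blast
  then show ?thesis using c by simp
qed

text \<open>If \<open>x\<close> lies in the cube of \<open>b\<close>, then some kid \<open>c\<close>
  of \<open>b\<close> is close to \<open>x\<close>, hence to \<open>a\<close>: its distance from
  \<open>a\<close> is below \<open>(3 / 16 + 1 / 4) / A * rad k\<close>, which is less than
  \<open>rad k / (2 * A)\<close>. The last clause in the definition of \<open>par\<close> then
  forces \<open>b = a\<close>.\<close>

lemma ball_sub_Q: assumes "a \<in> Net k" shows "B a (rad k / (4 * A\<^sup>2)) \<subseteq> Q k a"
proof
  fix x assume "x \<in> B a (rad k / (4 * A\<^sup>2))"
  then have x: "x \<in> space M" "\<rho> a x < rad k / (4 * A\<^sup>2)" by (auto simp: mem_B)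
  obtain b where b: "b \<in> Net k" "x \<in> Q k b" using Q_cover x by blast
  then have "x \<in> lim_set k b" using Q_sub_lim by blast
  \<comment> \<open>\<open>j \<ge> 1\<close> is needed for the descendant to come from a kid;
    \<open>lim_set\<close> offers arbitrarily large \<open>j\<close>.\<close>
  then obtain j where j: "Suc 0 \<le> j" "\<exists>b'\<in>desc j k b. \<rho> b' x < rad (k + j)" unfolding lim_set_def by blast
  then obtain i where i: "j = Suc i" by (cases j) auto
  then obtain c b' where c: "c \<in> kids k b" "b' \<in> desc i (Suc k) c" "\<rho> b' x < rad (Suc k + i)" using j by auto
  then have cN: "c \<in> Net (Suc k)" "par k c = b" unfolding kids_def by auto
  have X: "c \<in> space M" "a \<in> space M" using cN assms Net_space by auto
  have cx: "\<rho> c x < 3 * A\<^sup>2 * rad (Suc k)" using desc_near[OF cN(1) c(2) x(1) c(3)] .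
  have "\<rho> c a \<le> A * (\<rho> c x + \<rho> x a)" using rho_tri X x by blast
  also have "\<dots> < A * (3 * A\<^sup>2 * rad (Suc k) + rad k / (4 * A\<^sup>2))"
    using cx x(2) rho_sym[of x a] X x A_pos by (intro mult_strict_left_mono add_strict_mono) auto
  also have "\<dots> = (3 * (A ^ 4 * \<delta>) / A + 1 / (4 * A)) * rad k"
    using A_pos unfolding rad_Suc by (simp add: field_simps power2_eq_square power4_eq_xxxx)
  also have "\<dots> \<le> rad k / (2 * A)" unfolding delta_A using A_pos rad_pos[of k] by (simp add: field_simps)
  finally have "par k c = a" using par(3)[OF X(1) assms] by blast
  then show "x \<in> Q k a" using cN b by simp
qed

lemma Net_in_Q: "a \<in> Net k \<Longrightarrow> a \<in> Q k a"
  using ball_sub_Q[of a k] rho_self[of a] Net_space[of a k] rad_pos[of k] A_pos by (auto simp: subset_iff mem_B)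

lemma Q_fmeasurable [intro]: "a \<in> Net k \<Longrightarrow> Q k a \<in> fmeasurable M"
  by (rule fmeasurableI2[OF B_fmeasurable Q_sub_ball]) (auto intro: Net_space Q_measurable)

lemma Q_emeasure: "a \<in> Net k \<Longrightarrow> emeasure M (Q k a) = ennreal (measure M (Q k a))"
  using Q_fmeasurable by (intro emeasure_eq_ennreal_measure) (auto simp: fmeasurableD2)

text \<open>The factor \<open>4 * A\<^sup>2\<close> undoes the radius of the inner ball of the cube.
  This is how volumes of balls are exchanged for measures of cubes.\<close>

lemma V_le_Q:
  assumes "a \<in> Net k"
  shows "V a (c * rad k) \<le> Dil (4 * A\<^sup>2 * c) * measure M (Q k a)"
proof -
  have "V a (c * rad k) = V a (4 * A\<^sup>2 * c * (rad k / (4 * A\<^sup>2)))" using A_pos by simp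
  also have "\<dots> \<le> Dil (4 * A\<^sup>2 * c) * V a (rad k / (4 * A\<^sup>2))"
    using assms Net_space rad_pos A_pos by (intro V_dil) auto
  also have "\<dots> \<le> Dil (4 * A\<^sup>2 * c) * measure M (Q k a)"
    unfolding V_def using ball_sub_Q[OF assms] Q_fmeasurable[OF assms] Dil_pos assms Net_space
    by (intro mult_left_mono measure_mono_fmeasurable) (auto intro: less_imp_le)
  finally show ?thesis .
qed

lemma Q_pos: assumes "a \<in> Net k" shows "0 < measure M (Q k a)"
proof -
  have "0 < V a (1 * rad k)" using assms Net_space rad_pos by (intro V_pos) auto
  then have "0 < Dil (4 * A\<^sup>2 * 1) * measure M (Q k a)" using V_le_Q[OF assms, of 1] by linarith
  then show ?thesis using Dil_pos by (simp add: zero_less_mult_iff)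
qed

end

section \<open>Approximation by cubes, density and stopping cubes\<close>

lemma fmeasurable_Int_sets: "A \<in> sets N \<Longrightarrow> B \<in> fmeasurable N \<Longrightarrow> A \<inter> B \<in> fmeasurable N"
  by (subst Int_commute) (rule fmeasurable_Int_fmeasurable)

lemma measure_decseq_small:
  assumes "\<And>n. X n \<in> fmeasurable N" "decseq X" "(\<Inter>n. X n) = {}" "0 < e"
  shows "\<exists>n. measure N (X n) < e"
proof -
  have "(\<lambda>n. measure N (X n)) \<longlonglongrightarrow> measure N (\<Inter>n. X n)"
    using assms(1,2) by (intro Lim_measure_decseq) (auto simp: fmeasurableD2)
  then have "(\<lambda>n. measure N (X n)) \<longlonglongrightarrow> 0" using assms by simp
  then have "eventually (\<lambda>n. measure N (X n) < e) sequentially"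
    using assms(4) by (rule order_tendstoD)
  then show ?thesis by (auto simp: eventually_sequentially)
qed

context dyadic_system
begin

text \<open>The cubes of generation \<open>n\<close> form a countable partition, so this is the
  sigma-algebra that they generate; it grows with \<open>n\<close>.\<close>

definition gen :: "nat \<Rightarrow> 'a set set" where
  "gen n = {U. U \<subseteq> space M \<and> (\<forall>a\<in>Net n. Q n a \<subseteq> U \<or> Q n a \<inter> U = {})}"

lemma genI:
  assumes "U \<subseteq> space M" "\<And>a x y. a \<in> Net n \<Longrightarrow> x \<in> Q n a \<Longrightarrow> x \<in> U \<Longrightarrow> y \<in> Q n a \<Longrightarrow> y \<in> U"
  shows "U \<in> gen n"
  unfolding gen_def using assms by auto

lemma genD: "U \<in> gen n \<Longrightarrow> a \<in> Net n \<Longrightarrow> x \<in> Q n a \<Longrightarrow> x \<in> U \<Longrightarrow> y \<in> Q n a \<Longrightarrow> y \<in> U"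
  unfolding gen_def by auto

lemma gen_space: "U \<in> gen n \<Longrightarrow> U \<subseteq> space M"
  unfolding gen_def by auto

lemma gen_eq: assumes "U \<in> gen n" shows "U = (\<Union>a\<in>{a\<in>Net n. Q n a \<subseteq> U}. Q n a)"
proof (intro equalityI subsetI)
  fix x assume x: "x \<in> U"
  then have "x \<in> space M" using gen_space[OF assms] by auto
  then obtain a where a: "a \<in> Net n" "x \<in> Q n a" using Q_cover by auto
  then have "Q n a \<subseteq> U" using genD[OF assms a x] by auto
  then show "x \<in> (\<Union>a\<in>{a\<in>Net n. Q n a \<subseteq> U}. Q n a)" using a by auto
qed auto

lemma gen_mono: assumes "n \<le> m" shows "gen n \<subseteq> gen m"
proof
  fix U assume U: "U \<in> gen n"
  show "U \<in> gen m"
  proof (rule genI)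
    fix a x y assume a: "a \<in> Net m" and x: "x \<in> Q m a" "x \<in> U" "y \<in> Q m a"
    obtain b where "b \<in> Net n" "Q m a \<subseteq> Q n b" using Q_ancestor[OF assms a] by auto
    then show "y \<in> U" using genD[OF U, of b x y] x by auto
  qed (rule gen_space[OF U])
qed

lemma gen_cube: assumes "a \<in> Net n" shows "Q n a \<in> gen n"
proof (rule genI)
  fix b x y assume "b \<in> Net n" "x \<in> Q n b" "x \<in> Q n a" "y \<in> Q n b"
  then show "y \<in> Q n a" using Q_unique[of a n b x] assms by auto
qed (rule Q_space)

lemma gen_Int: "U \<in> gen n \<Longrightarrow> U' \<in> gen n \<Longrightarrow> U \<inter> U' \<in> gen n"
  by (rule genI) (auto dest: gen_space intro: genD)

lemma gen_UN: assumes "\<And>i. i \<in> I \<Longrightarrow> U i \<in> gen n" shows "(\<Union>i\<in>I. U i) \<in> gen n"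
proof (rule genI)
  show "(\<Union>i\<in>I. U i) \<subseteq> space M" using gen_space[OF assms] by (intro UN_least)
  fix a x y assume a: "a \<in> Net n" "x \<in> Q n a" "x \<in> (\<Union>i\<in>I. U i)" "y \<in> Q n a"
  then obtain i where "i \<in> I" "x \<in> U i" by auto
  then show "y \<in> (\<Union>i\<in>I. U i)" using genD[OF assms, of i a x y] a by auto
qed

lemma gen_Compl: assumes "U \<in> gen n" shows "space M - U \<in> gen n"
proof (rule genI)
  fix a x y assume a: "a \<in> Net n" "x \<in> Q n a" "x \<in> space M - U" "y \<in> Q n a"
  then show "y \<in> space M - U" using genD[OF assms, of a y x] Q_space[of n a] by auto
qed auto

lemma gen_measurable: assumes "U \<in> gen n" shows "U \<in> sets M"
proof -
  have "countable {a\<in>Net n. Q n a \<subseteq> U}" by (rule countable_subset[OF _ countable_Net[of n]]) auto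
  then have "(\<Union>a\<in>{a\<in>Net n. Q n a \<subseteq> U}. Q n a) \<in> sets M"
    by (intro sets.countable_UN'') (auto intro: Q_measurable)
  then show ?thesis using gen_eq[OF assms] by simp
qed

text \<open>Induction over the sigma-algebra, whose generators are the open sets and not the balls.
  An open set is the increasing union over \<open>n\<close> of the cubes of generation
  \<open>n\<close> inside it, because the cubes around a given point shrink to it. Measuring inside
  \<open>W\<close> keeps all measures finite.\<close>

lemma gen_approximation:
  assumes E: "E \<in> sets M" and W: "W \<in> fmeasurable M" and e: "0 < e"
  shows "\<exists>n. \<exists>U\<in>gen n. measure M (W \<inter> ((E - U) \<union> (U - E))) < e"
  using E[unfolded sets_M] e
proof (induction arbitrary: e rule: sigma_sets.induct)
  case (Basic O')
  have O: "O' \<subseteq> space M" "\<And>x. x \<in> O' \<Longrightarrow> \<exists>r>0. B x r \<subseteq> O'" using Basic.hyps unfolding qopens_def by auto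
  have Om: "O' \<in> sets M" unfolding sets_M using Basic.hyps by auto
  define U where "U n = (\<Union>a\<in>{a\<in>Net n. Q n a \<subseteq> O'}. Q n a)" for n
  have Ug: "U n \<in> gen n" for n unfolding U_def by (intro gen_UN gen_cube) auto
  have "U n \<subseteq> U (Suc n)" for n
  proof
    fix x assume "x \<in> U n"
    then obtain a where a: "a \<in> Net n" "Q n a \<subseteq> O'" "x \<in> Q n a" unfolding U_def by auto
    obtain b where b: "b \<in> Net (Suc n)" "x \<in> Q (Suc n) b" using Q_cover a(3) Q_space by blast
    have "Q (Suc n) b \<subseteq> Q n a" using a b by (intro Q_nested) auto
    then show "x \<in> U (Suc n)" unfolding U_def using a b by blast
  qed
  then have inc: "incseq U" by (rule incseq_SucI)
  have UO: "(\<Union>n. U n) = O'"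
  proof (intro equalityI subsetI)
    fix x assume x: "x \<in> O'"
    then have xX: "x \<in> space M" using O by auto
    obtain r where r: "0 < r" "B x r \<subseteq> O'" using O(2)[OF x] by auto
    obtain n where n: "rad n < r / (6 * A ^ 3)" using rad_tendsto[of "r / (6 * A ^ 3)"] r A_pos by auto
    obtain a where a: "a \<in> Net n" "x \<in> Q n a" using Q_cover[OF xX] by auto
    have "Q n a \<subseteq> B a (3 * A\<^sup>2 * rad n)" using Q_sub_ball a by auto
    also have "\<dots> \<subseteq> B x r"
    proof (rule B_tri)
      have "\<rho> a x < 3 * A\<^sup>2 * rad n" using Q_sub_ball[OF a(1)] a(2) by (auto simp: mem_B)
      then have "A * (\<rho> x a + 3 * A\<^sup>2 * rad n) \<le> A * (3 * A\<^sup>2 * rad n + 3 * A\<^sup>2 * rad n)"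
        using rho_sym[of a x] Net_space[OF a(1)] xX A_pos by (intro mult_left_mono add_right_mono) auto
      also have "\<dots> = (6 * A ^ 3) * rad n" by (simp add: power2_eq_square power3_eq_cube)
      also have "\<dots> \<le> r" using n A_pos by (simp add: field_simps)
      finally show "A * (\<rho> x a + 3 * A\<^sup>2 * rad n) \<le> r" .
    qed (use a Net_space xX in auto)
    finally show "x \<in> (\<Union>n. U n)" unfolding U_def using r a by blast
  qed (auto simp: U_def)
  have "\<exists>n. measure M (W \<inter> (O' - U n)) < e"
  proof (rule measure_decseq_small)
    show "W \<inter> (O' - U n) \<in> fmeasurable M" for n
      using W Om gen_measurable[OF Ug] by (intro fmeasurable_Int_fmeasurable sets.Diff)
    show "decseq (\<lambda>n. W \<inter> (O' - U n))" using inc unfolding incseq_def decseq_def by blast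
    show "(\<Inter>n. W \<inter> (O' - U n)) = {}" using UO by auto
  qed fact
  moreover have "U n - O' = {}" for n unfolding U_def by auto
  ultimately show ?case using Ug by (metis Un_empty_right)
next
  case Empty
  then show ?case by (intro exI[of _ 0] bexI[of _ "{}"]) (auto simp: gen_def)
next
  case (Compl E)
  then obtain n U where U: "U \<in> gen n" "measure M (W \<inter> ((E - U) \<union> (U - E))) < e" by blast
  have "E \<subseteq> space M" using Compl.hyps sets.sets_into_space sets_M by blast
  moreover have "U \<subseteq> space M" using U unfolding gen_def by auto
  ultimately have "(space M - E - (space M - U)) \<union> ((space M - U) - (space M - E)) = (E - U) \<union> (U - E)" by blast
  then show ?case using U gen_Compl[OF U(1)] by metis
next
  case (Union a)
  have am: "a i \<in> sets M" for i using Union.hyps sets_M by simp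
  define X where "X N = W \<inter> ((\<Union>i. a i) - (\<Union>i<N. a i))" for N
  have Xf: "X N \<in> fmeasurable M" for N unfolding X_def
    using W am by (intro fmeasurable_Int_fmeasurable sets.Diff) auto
  have "\<exists>N. measure M (X N) < e / 2"
  proof (rule measure_decseq_small[OF Xf])
    show "decseq X" unfolding X_def decseq_def using lessThan_subset_iff by fastforce
    show "(\<Inter>N. X N) = {}"
    proof (rule ccontr)
      assume "(\<Inter>N. X N) \<noteq> {}"
      then obtain x where x: "\<And>N. x \<in> X N" by auto
      then obtain i where "x \<in> a i" unfolding X_def by auto
      then show False using x[of "Suc i"] unfolding X_def by auto
    qed
  qed (use Union.prems in auto)
  then obtain N where N: "measure M (X N) < e / 2" by auto
  \<comment> \<open>\<open>N\<close> sets share the remaining \<open>e / 2\<close>;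
    \<open>Suc N\<close> avoids a division by zero for \<open>N = 0\<close>.\<close>
  define e' where "e' = e / (2 * real (Suc N))"
  have "0 < e'" unfolding e'_def using Union.prems by simp
  then have "\<forall>i. \<exists>n. \<exists>U\<in>gen n. measure M (W \<inter> ((a i - U) \<union> (U - a i))) < e'" using Union.IH by blast
  then obtain n U where nU: "\<And>i. U i \<in> gen (n i)" "\<And>i. measure M (W \<inter> ((a i - U i) \<union> (U i - a i))) < e'" by metis
  define m where "m = Max (n ` {..N})"
  define U' where "U' = (\<Union>i<N. U i)"
  have "U i \<in> gen m" if "i < N" for i
    using nU(1)[of i] gen_mono[of "n i" m] that unfolding m_def by (meson Max_ge atMost_iff finite_atMost finite_imageI imageI less_imp_le subsetD)
  then have U': "U' \<in> gen m" unfolding U'_def by (intro gen_UN) auto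
  define Y where "Y i = W \<inter> ((a i - U i) \<union> (U i - a i))" for i
  have Yf: "Y i \<in> fmeasurable M" for i unfolding Y_def
    using W am gen_measurable[OF nU(1)] by (intro fmeasurable_Int_fmeasurable) auto
  have "W \<inter> (((\<Union>i. a i) - U') \<union> (U' - (\<Union>i. a i))) \<subseteq> X N \<union> (\<Union>i<N. Y i)"
    unfolding X_def Y_def U'_def by blast
  then have "measure M (W \<inter> (((\<Union>i. a i) - U') \<union> (U' - (\<Union>i. a i)))) \<le> measure M (X N \<union> (\<Union>i<N. Y i))"
    using W am gen_measurable[OF U'] Xf Yf by (intro measure_mono_fmeasurable fmeasurable.Un fmeasurable.finite_UN) auto
  also have "\<dots> \<le> measure M (X N) + measure M (\<Union>i<N. Y i)"
    using Xf Yf by (intro measure_Un_le) auto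
  also have "measure M (\<Union>i<N. Y i) \<le> (\<Sum>i<N. measure M (Y i))"
    using Yf by (intro measure_UNION_le) auto
  also have "(\<Sum>i<N. measure M (Y i)) \<le> (\<Sum>i<N. e')" using nU(2) unfolding Y_def by (intro sum_mono less_imp_le)
  also have "\<dots> \<le> e / 2" unfolding e'_def using Union.prems by (simp add: field_simps)
  finally show ?case using N U' by (intro exI[of _ m] bexI[of _ U']) auto
qed

text \<open>Plays the role of the Lebesgue differentiation theorem.\<close>

lemma density_null_cube:
  assumes E: "E \<in> sets M" "E \<subseteq> Q k\<^sub>0 a\<^sub>0" and a0: "a\<^sub>0 \<in> Net k\<^sub>0" and \<theta>: "0 \<le> \<theta>" "\<theta> < 1"
    and low: "\<And>k a. k\<^sub>0 \<le> k \<Longrightarrow> a \<in> Net k \<Longrightarrow> measure M (E \<inter> Q k a) \<le> \<theta> * measure M (Q k a)"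
  shows "measure M E = 0"
proof -
  define W where "W = Q k\<^sub>0 a\<^sub>0"
  have W: "W \<in> fmeasurable M" unfolding W_def using a0 by auto
  have Ef: "E \<in> fmeasurable M" using E W unfolding W_def by (metis fmeasurableI2)
  \<comment> \<open>On an approximation \<open>U'\<close> of \<open>E\<close> by whole cubes the
    hypothesis sums up to \<open>measure M (E \<inter> U') \<le> \<theta> * measure M U'\<close>.
    Replacing \<open>E \<inter> U'\<close> and \<open>U'\<close> by \<open>E\<close> costs
    \<open>e\<close> on either side, so that up to \<open>2 * e\<close> the measure of
    \<open>E\<close> is at most \<open>\<theta>\<close> times itself.\<close>
  have key: "(1 - \<theta>) * measure M E \<le> 2 * e" if e: "0 < e" for e
  proof -
    obtain n U where U: "U \<in> gen n" "measure M (W \<inter> ((E - U) \<union> (U - E))) < e"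
      using gen_approximation[OF E(1) W e] by blast
    \<comment> \<open>\<open>m \<ge> k\<^sub>0\<close> makes \<open>low\<close> applicable to the
      cubes of generation \<open>m\<close>, and \<open>W\<close> a union of such cubes.\<close>
    define m where "m = max n k\<^sub>0"
    define U' where "U' = U \<inter> W"
    have U': "U' \<in> gen m" unfolding U'_def W_def
      using gen_mono[of n m] gen_mono[of k\<^sub>0 m] gen_cube[OF a0] U(1) unfolding m_def by (intro gen_Int) auto
    have U'f: "U' \<in> fmeasurable M" using gen_measurable[OF U'] W unfolding U'_def by (metis fmeasurableI2 inf_le2)
    define I where "I = {a\<in>Net m. Q m a \<subseteq> U'}"
    have cI: "countable I" unfolding I_def by (rule countable_subset[OF _ countable_Net[of m]]) auto
    have dI: "disjoint_family_on (Q m) I" unfolding I_def disjoint_family_on_def using Q_unique by blast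
    have UI: "U' = (\<Union>a\<in>I. Q m a)" using gen_eq[OF U'] unfolding I_def .
    have QI: "Q m a \<in> sets M" if "a \<in> I" for a using that Q_measurable unfolding I_def by auto
    have "emeasure M (E \<inter> U') = emeasure M (\<Union>a\<in>I. E \<inter> Q m a)" unfolding UI by simp
    also have "\<dots> = (\<integral>\<^sup>+a. emeasure M (E \<inter> Q m a) \<partial>count_space I)"
      using QI E(1) cI dI by (intro emeasure_UN_countable) (auto simp: disjoint_family_on_def)
    also have "\<dots> \<le> (\<integral>\<^sup>+a. ennreal \<theta> * emeasure M (Q m a) \<partial>count_space I)"
    proof (intro nn_integral_mono)
      fix a assume "a \<in> space (count_space I)"
      then have a: "a \<in> Net m" unfolding I_def by auto
      have "E \<inter> Q m a \<in> fmeasurable M" using Ef Q_measurable[OF a] by (rule fmeasurable_Int_fmeasurable)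
      then have "emeasure M (E \<inter> Q m a) = ennreal (measure M (E \<inter> Q m a))"
        by (intro emeasure_eq_ennreal_measure) (auto simp: fmeasurableD2)
      also have "\<dots> \<le> ennreal (\<theta> * measure M (Q m a))" using low[OF _ a] unfolding m_def by (intro ennreal_leI) auto
      also have "\<dots> = ennreal \<theta> * emeasure M (Q m a)" using \<theta> Q_emeasure[OF a] by (simp add: ennreal_mult)
      finally show "emeasure M (E \<inter> Q m a) \<le> ennreal \<theta> * emeasure M (Q m a)" .
    qed
    also have "\<dots> = ennreal \<theta> * (\<integral>\<^sup>+a. emeasure M (Q m a) \<partial>count_space I)"
      by (intro nn_integral_cmult) auto
    also have "(\<integral>\<^sup>+a. emeasure M (Q m a) \<partial>count_space I) = emeasure M U'"
      unfolding UI using QI cI dI by (intro emeasure_UN_countable[symmetric])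
    finally have "measure M (E \<inter> U') \<le> \<theta> * measure M U'"
      using Ef U'f \<theta> by (simp add: emeasure_eq_measure2 fmeasurableD2 fmeasurable_Int_fmeasurable fmeasurableD ennreal_mult[symmetric])
    have "measure M E \<le> measure M (E \<inter> U' \<union> (W \<inter> ((E - U) \<union> (U - E))))"
      using E(2) Ef U'f W gen_measurable[OF U(1)] unfolding U'_def W_def
      by (intro measure_mono_fmeasurable fmeasurable.Un fmeasurable_Int_fmeasurable[of "Q k\<^sub>0 a\<^sub>0"] fmeasurable_Int_fmeasurable[of E]) (auto dest: fmeasurableD)
    also have "\<dots> \<le> measure M (E \<inter> U') + measure M (W \<inter> ((E - U) \<union> (U - E)))"
      using Ef U'f W U(1) gen_measurable by (intro measure_Un_le) auto
    finally have 1: "measure M E \<le> measure M (E \<inter> U') + e" using U(2) by simp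
    have "measure M U' \<le> measure M (E \<union> (W \<inter> ((E - U) \<union> (U - E))))"
      using Ef U'f W gen_measurable[OF U(1)] unfolding U'_def
      by (intro measure_mono_fmeasurable fmeasurable.Un fmeasurable_Int_fmeasurable[of W]) (auto dest: fmeasurableD)
    also have "\<dots> \<le> measure M E + measure M (W \<inter> ((E - U) \<union> (U - E)))"
      using Ef U'f W U(1) gen_measurable by (intro measure_Un_le) auto
    finally have "\<theta> * measure M U' \<le> \<theta> * (measure M E + e)" using U(2) \<theta> by (intro mult_left_mono) auto
    moreover have "\<theta> * e \<le> 1 * e" using \<theta> e by (intro mult_right_mono) auto
    ultimately show ?thesis using 1 \<open>measure M (E \<inter> U') \<le> \<theta> * measure M U'\<close> by (simp add: algebra_simps)
  qed
  have "(1 - \<theta>) * measure M E \<le> 0 + e" if "0 < e" for e using key[of "e / 2"] that by simp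
  then have "(1 - \<theta>) * measure M E \<le> 0" by (rule field_le_epsilon)
  then show ?thesis using \<theta> measure_nonneg[of M E] by (auto simp: mult_le_0_iff intro: antisym)
qed

text \<open>Cutting \<open>E\<close> along the countably many cubes of generation
  \<open>k\<^sub>0\<close> reduces the claim to sets of finite measure.\<close>

lemma density_null:
  assumes E: "E \<in> sets M" and \<theta>: "0 \<le> \<theta>" "\<theta> < 1"
    and low: "\<And>k a. k\<^sub>0 \<le> k \<Longrightarrow> a \<in> Net k \<Longrightarrow> measure M (E \<inter> Q k a) \<le> \<theta> * measure M (Q k a)"
  shows "E \<in> null_sets M"
proof -
  have "E \<inter> Q k\<^sub>0 a \<in> null_sets M" if a: "a \<in> Net k\<^sub>0" for a
  proof -
    have f: "E \<inter> Q k\<^sub>0 a \<in> fmeasurable M" using E Q_fmeasurable[OF a] by (rule fmeasurable_Int_sets)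
    have "measure M (E \<inter> Q k\<^sub>0 a) = 0"
    proof (rule density_null_cube[OF _ _ a \<theta>])
      fix k b assume kb: "k\<^sub>0 \<le> k" "b \<in> Net k"
      have "measure M (E \<inter> Q k\<^sub>0 a \<inter> Q k b) \<le> measure M (E \<inter> Q k b)"
        using E Q_fmeasurable[OF kb(2)] Q_measurable[OF a] Q_measurable[OF kb(2)]
        by (intro measure_mono_fmeasurable fmeasurable_Int_sets) auto
      then show "measure M (E \<inter> Q k\<^sub>0 a \<inter> Q k b) \<le> \<theta> * measure M (Q k b)" using low[OF kb] by linarith
    qed (use f in auto)
    then show ?thesis using f by (auto simp: null_sets_def emeasure_eq_measure2 fmeasurableD2 emeasure_eq_ennreal_measure)
  qed
  then have "(\<Union>a\<in>Net k\<^sub>0. E \<inter> Q k\<^sub>0 a) \<in> null_sets M"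
    using countable_Net by (intro null_sets_UN') auto
  moreover have "(\<Union>a\<in>Net k\<^sub>0. E \<inter> Q k\<^sub>0 a) = E" using Q_cover[of _ k\<^sub>0] sets.sets_into_space[OF E] by auto
  ultimately show ?thesis by simp
qed

text \<open>The maximal bad cubes. They are recorded as pairs because the same set may be a cube of
  several generations, and the generation carries the radius.\<close>

definition stop :: "(nat \<Rightarrow> 'a \<Rightarrow> bool) \<Rightarrow> (nat \<times> 'a) set" where
  "stop Bad = {(k, a). a \<in> Net k \<and> Bad k a \<and> (\<forall>j<k. \<forall>b\<in>Net j. Q k a \<subseteq> Q j b \<longrightarrow> \<not> Bad j b)}"

abbreviation cube :: "nat \<times> 'a \<Rightarrow> 'a set" where "cube s \<equiv> Q (fst s) (snd s)"

lemma stop_disjoint: "disjoint_family_on cube (stop Bad)"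
proof -
  have *: "Q k a \<inter> Q j b = {}" if "(k, a) \<in> stop Bad" "(j, b) \<in> stop Bad" "(k, a) \<noteq> (j, b)" "j \<le> k" for k a j b
  proof (rule ccontr)
    assume ne: "Q k a \<inter> Q j b \<noteq> {}"
    have N: "a \<in> Net k" "b \<in> Net j" using that unfolding stop_def by auto
    have sub: "Q k a \<subseteq> Q j b" using Q_nested[OF that(4) N ne] .
    show False
    proof (cases "j = k")
      case True
      then have "a = b" using ne N Q_unique by blast
      then show False using that True by simp
    next
      case False
      then show False using that sub N unfolding stop_def by auto
    qed
  qed
  show ?thesis unfolding disjoint_family_on_def
  proof (intro ballI impI)
    fix s t assume "s \<in> stop Bad" "t \<in> stop Bad" "s \<noteq> t"
    then show "cube s \<inter> cube t = {}"
      using *[of "fst s" "snd s" "fst t" "snd t"] *[of "fst t" "snd t" "fst s" "snd s"]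
      by (cases "fst t \<le> fst s") (auto simp: Int_commute)
  qed
qed

text \<open>Generations start at \<open>0\<close>, so among the bad cubes around a given one there
  is one of least generation.\<close>

lemma stop_cover:
  assumes "a \<in> Net k" "Bad k a" shows "\<exists>s\<in>stop Bad. Q k a \<subseteq> cube s"
proof -
  define P where "P j \<longleftrightarrow> (\<exists>b\<in>Net j. Q k a \<subseteq> Q j b \<and> Bad j b)" for j
  have "P k" unfolding P_def using assms by auto
  then have P: "P (LEAST j. P j)" by (rule LeastI)
  then obtain b where b: "b \<in> Net (LEAST j. P j)" "Q k a \<subseteq> Q (LEAST j. P j) b" "Bad (LEAST j. P j) b"
    unfolding P_def by auto
  have "\<not> Bad i c" if "i < (LEAST j. P j)" "c \<in> Net i" "Q (LEAST j. P j) b \<subseteq> Q i c" for i c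
    using not_less_Least[OF that(1)] that b(2) unfolding P_def by blast
  then have "((LEAST j. P j), b) \<in> stop Bad" unfolding stop_def using b by auto
  then show ?thesis using b by force
qed

lemma stop_countable: "countable (stop Bad)"
proof (rule countable_subset)
  show "stop Bad \<subseteq> (SIGMA k:UNIV. Net k)" unfolding stop_def by auto
  show "countable (SIGMA k:(UNIV::nat set). Net k)" using countable_Net by (intro countable_SIGMA) auto
qed

lemma stop_Net: "s \<in> stop Bad \<Longrightarrow> snd s \<in> Net (fst s)"
  unfolding stop_def by auto

lemma stop_Bad: "s \<in> stop Bad \<Longrightarrow> Bad (fst s) (snd s)"
  unfolding stop_def by auto

lemma stop_not_Bad: "s \<in> stop Bad \<Longrightarrow> j < fst s \<Longrightarrow> b \<in> Net j \<Longrightarrow> cube s \<subseteq> Q j b \<Longrightarrow> \<not> Bad j b"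
  unfolding stop_def by auto

text \<open>Where all averages are at most \<open>t\<close>, a set with
  \<open>\<bar>f\<bar> \<ge> t * c\<close> fills at most the fraction \<open>1 / c\<close> of each
  cube, so for \<open>c > 1\<close> it is null by \<open>density_null\<close>. Letting
  \<open>c\<close> decrease to \<open>1\<close> along a sequence gives the bound \<open>t\<close>
  itself.\<close>

lemma AE_le_average:
  assumes f: "integrable M f" and t: "0 < t"
  shows "AE x in M. (\<forall>k. \<forall>a\<in>Net k. x \<in> Q k a \<longrightarrow> (LINT y:Q k a|M. \<bar>f y\<bar>) \<le> t * measure M (Q k a)) \<longrightarrow> \<bar>f x\<bar> \<le> t"
proof -
  have [measurable]: "f \<in> borel_measurable M" using f by auto
  define bad where "bad = {s \<in> (SIGMA k:UNIV. Net k). t * measure M (cube s) < (LINT y:cube s|M. \<bar>f y\<bar>)}"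
  define \<Omega> where "\<Omega> = (\<Union>s\<in>bad. cube s)"
  have "countable (SIGMA k:(UNIV::nat set). Net k)" using countable_Net by (intro countable_SIGMA) auto
  then have cb: "countable bad" unfolding bad_def by (rule countable_subset[rotated]) auto
  then have [measurable]: "\<Omega> \<in> sets M" unfolding \<Omega>_def bad_def
    by (intro sets.countable_UN'') (auto intro: Q_measurable)
  have "AE x in M. x \<notin> {x \<in> space M - \<Omega>. t * (1 + 1 / real (Suc n)) \<le> \<bar>f x\<bar>}" for n
  proof (rule AE_not_in)
    define c where "c = 1 + 1 / real (Suc n)"
    have c: "1 < c" unfolding c_def by simp
    define E where "E = {x \<in> space M - \<Omega>. t * c \<le> \<bar>f x\<bar>}"
    have Em [measurable]: "E \<in> sets M" unfolding E_def by measurable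
    have "E \<in> null_sets M"
    proof (rule density_null[where \<theta> = "1 / c" and k\<^sub>0 = 0])
      fix k a assume a: "a \<in> Net k"
      have Qf: "Q k a \<in> fmeasurable M" using a by auto
      have [measurable]: "Q k a \<in> sets M" using Q_measurable[OF a] .
      show "measure M (E \<inter> Q k a) \<le> 1 / c * measure M (Q k a)"
      proof (cases "(k, a) \<in> bad")
        case True
        then have "E \<inter> Q k a = {}" unfolding E_def \<Omega>_def by force
        then show ?thesis using c by simp
      next
        case False
        then have le: "(LINT y:Q k a|M. \<bar>f y\<bar>) \<le> t * measure M (Q k a)" using a unfolding bad_def by auto
        have EQ: "E \<inter> Q k a \<in> fmeasurable M" using Em Qf by (rule fmeasurable_Int_sets)
        have "t * c * measure M (E \<inter> Q k a) = (LINT y|M. t * c * indicator (E \<inter> Q k a) y)"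
          using EQ by simp
        also have "\<dots> \<le> (LINT y|M. indicator (Q k a) y *\<^sub>R \<bar>f y\<bar>)"
        proof (intro integral_mono)
          show "integrable M (\<lambda>y. t * c * indicator (E \<inter> Q k a) y)"
            using EQ fmeasurableD2[OF EQ] by (intro integrable_mult_right) (auto simp: integrable_indicator_iff fmeasurableD less_top[symmetric])
          show "integrable M (\<lambda>y. indicator (Q k a) y *\<^sub>R \<bar>f y\<bar>)"
            using f by (intro integrable_mult_indicator integrable_abs) auto
          show "t * c * indicator (E \<inter> Q k a) y \<le> indicator (Q k a) y *\<^sub>R \<bar>f y\<bar>" for y
            unfolding E_def by (auto simp: indicator_def)
        qed
        also have "\<dots> \<le> t * measure M (Q k a)" using le unfolding set_lebesgue_integral_def .
        finally have "c * measure M (E \<inter> Q k a) \<le> measure M (Q k a)" using t by simp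
        then show ?thesis using c by (simp add: field_simps)
      qed
    qed (use c in auto)
    then show "{x \<in> space M - \<Omega>. t * (1 + 1 / real (Suc n)) \<le> \<bar>f x\<bar>} \<in> null_sets M" unfolding E_def c_def .
  qed
  then have "AE x in M. \<forall>n. x \<notin> {x \<in> space M - \<Omega>. t * (1 + 1 / real (Suc n)) \<le> \<bar>f x\<bar>}" by (subst AE_all_countable) blast
  then show ?thesis
  proof (rule AE_mp, intro AE_I2 impI)
    fix x assume x: "x \<in> space M" and n: "\<forall>n. x \<notin> {x \<in> space M - \<Omega>. t * (1 + 1 / real (Suc n)) \<le> \<bar>f x\<bar>}"
      and good: "\<forall>k. \<forall>a\<in>Net k. x \<in> Q k a \<longrightarrow> (LINT y:Q k a|M. \<bar>f y\<bar>) \<le> t * measure M (Q k a)"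
    have "x \<notin> \<Omega>" unfolding \<Omega>_def bad_def using good by force
    then have "\<bar>f x\<bar> \<le> t * (1 + 1 / real (Suc n))" for n using n x by (auto simp: not_le intro: less_imp_le)
    moreover have "(\<lambda>n. t * (1 + 1 / real (Suc n))) \<longlonglongrightarrow> t * (1 + 0)"
      by (intro tendsto_intros LIMSEQ_Suc[OF lim_1_over_n])
    ultimately show "\<bar>f x\<bar> \<le> t" by (intro LIMSEQ_le_const[of "\<lambda>n. t * (1 + 1 / real (Suc n))"]) auto
  qed
qed

end

section \<open>Calderon--Zygmund operators\<close>

text \<open>Membership in unweighted \<open>L\<^sup>2\<close> in terms of the Bochner integral;
  \<open>L2_space_one_iff\<close> identifies it with \<open>L2_space M one_weight\<close>.\<close>

definition sqint :: "'b measure \<Rightarrow> ('b \<Rightarrow> real) \<Rightarrow> bool" where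
  "sqint M f \<longleftrightarrow> f \<in> borel_measurable M \<and> integrable M (\<lambda>x. (f x)\<^sup>2)"

lemma sqintD: "sqint M f \<Longrightarrow> f \<in> borel_measurable M" "sqint M f \<Longrightarrow> integrable M (\<lambda>x. (f x)\<^sup>2)"
  unfolding sqint_def by auto

lemma sqint_bound:
  assumes "sqint M f" "g \<in> borel_measurable M" "\<And>x. x \<in> space M \<Longrightarrow> \<bar>g x\<bar> \<le> \<bar>f x\<bar>"
  shows "sqint M g"
proof -
  have "integrable M (\<lambda>x. (g x)\<^sup>2)"
  proof (rule Bochner_Integration.integrable_bound[OF sqintD(2)[OF assms(1)]])
    show "AE x in M. norm ((g x)\<^sup>2) \<le> norm ((f x)\<^sup>2)"
      using assms(3) by (intro AE_I2) (simp add: abs_le_square_iff)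
  qed (use assms(2) in simp)
  then show ?thesis using assms unfolding sqint_def by auto
qed

lemma sqint_scale: "sqint M f \<Longrightarrow> sqint M (\<lambda>x. c * f x)"
  unfolding sqint_def by (auto simp: power_mult_distrib)

lemma sqint_add: assumes "sqint M f" "sqint M g" shows "sqint M (\<lambda>x. f x + g x)"
proof -
  have [measurable]: "f \<in> borel_measurable M" "g \<in> borel_measurable M" using assms sqintD by auto
  have "integrable M (\<lambda>x. (f x + g x)\<^sup>2)"
  proof (rule Bochner_Integration.integrable_bound)
    show "integrable M (\<lambda>x. 2 * (f x)\<^sup>2 + 2 * (g x)\<^sup>2)" using sqintD(2)[OF assms(1)] sqintD(2)[OF assms(2)] by auto
    have "(a + b)\<^sup>2 \<le> 2 * a\<^sup>2 + 2 * b\<^sup>2" for a b :: real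
      using sum_squares_bound[of a b] by (simp add: power2_sum)
    then show "AE x in M. norm ((f x + g x)\<^sup>2) \<le> norm (2 * (f x)\<^sup>2 + 2 * (g x)\<^sup>2)" by auto
  qed simp
  then show ?thesis unfolding sqint_def by auto
qed

lemma sqint_lincomb: "sqint M f \<Longrightarrow> sqint M g \<Longrightarrow> sqint M (\<lambda>x. a * f x + b * g x)"
  by (intro sqint_add sqint_scale)

lemma sqint_sum: "finite I \<Longrightarrow> (\<And>i. i \<in> I \<Longrightarrow> sqint M (f i)) \<Longrightarrow> sqint M (\<lambda>x. \<Sum>i\<in>I. f i x)"
  by (induction I rule: finite_induct) (auto intro: sqint_add simp: sqint_def[of _ "\<lambda>x. 0"])

lemma sqint_indicator:
  assumes "sqint M f" "E \<in> sets M" shows "sqint M (\<lambda>x. f x * indicator E x)"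
proof (rule sqint_bound[OF assms(1)])
  have [measurable]: "f \<in> borel_measurable M" "E \<in> sets M" using assms sqintD by auto
  show "(\<lambda>x. f x * indicator E x) \<in> borel_measurable M" by measurable
qed (simp add: indicator_def)

lemma sqint_indicator_const:
  assumes "E \<in> fmeasurable M" shows "sqint M (\<lambda>x. c * indicator E x)"
proof -
  have "integrable M (\<lambda>x. c\<^sup>2 * indicator E x)"
    using assms fmeasurableD2[OF assms] by (intro integrable_mult_right integrable_real_indicator) (auto simp: less_top)
  moreover have "(\<lambda>x. (c * indicator E x)\<^sup>2) = (\<lambda>x. c\<^sup>2 * indicator E x)" by (auto simp: indicator_def)
  ultimately show ?thesis using assms unfolding sqint_def by auto
qed

lemma sqint_integrable_on:
  assumes "sqint M f" "E \<in> fmeasurable M" shows "integrable M (\<lambda>x. f x * indicator E x)"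
proof (rule Bochner_Integration.integrable_bound)
  have [measurable]: "f \<in> borel_measurable M" "E \<in> sets M" using assms sqintD by auto
  show "integrable M (\<lambda>x. (f x)\<^sup>2 + indicator E x)"
    using sqintD(2)[OF assms(1)] assms(2) fmeasurableD2[OF assms(2)]
    by (intro Bochner_Integration.integrable_add integrable_real_indicator) (auto simp: less_top)
  have "\<bar>a\<bar> \<le> a\<^sup>2 + 1" for a :: real
    using sum_squares_bound[of "\<bar>a\<bar>" 1] by simp
  then show "AE x in M. norm (f x * indicator E x) \<le> norm ((f x)\<^sup>2 + indicator E x)"
    by (intro AE_I2) (auto simp: indicator_def intro: order_trans[OF _ abs_ge_self])
  show "(\<lambda>x. f x * indicator E x) \<in> borel_measurable M" by measurable
qed

context doubling_space
begin

section \<open>Integrals over dyadic annuli\<close>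

lemma rho_measurable [measurable]: "z \<in> space M \<Longrightarrow> \<rho> z \<in> borel_measurable M"
  using B_sets[of z] unfolding borel_measurable_iff_less by (simp add: qball_def)

lemma annulus_weight_measurable [measurable]:
  assumes "z \<in> space M" shows "(\<lambda>y. (s / \<rho> z y) powr e / V z (\<rho> z y)) \<in> borel_measurable M"
proof -
  have "V z \<in> borel_measurable borel"
    using V_mono[OF assms] by (intro borel_measurable_mono) (auto simp: mono_def)
  then have "(\<lambda>y. V z (\<rho> z y)) \<in> borel_measurable M"
    using rho_measurable[OF assms] by (rule measurable_compose[rotated])
  then show ?thesis using rho_measurable[OF assms] by measurable
qed

text \<open>On the annulus between the radii \<open>2 ^ m * s\<close> and
  \<open>2 ^ Suc m * s\<close> the weight is at most \<open>q ^ m\<close> over the volume of the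
  smaller ball, and doubling compares this with the volume of the larger one. What remains is a
  geometric series. The function \<open>h\<close> is constant in the weak type bound and is
  \<open>2 * \<bar>f\<bar>\<close> in \<open>T_oscillation_bound\<close>.\<close>

lemma annular_bound:
  fixes h :: "'a \<Rightarrow> ennreal"
  assumes z: "z \<in> space M" and s: "0 < s" and H: "0 \<le> H" and e: "0 < e"
    and [measurable]: "h \<in> borel_measurable M"
    and le: "\<And>t. s \<le> t \<Longrightarrow> (\<integral>\<^sup>+y\<in>B z t. h y \<partial>M) \<le> ennreal (H * V z t)"
  shows "(\<integral>\<^sup>+y. ennreal ((s / \<rho> z y) powr e / V z (\<rho> z y)) * h y * indicator (space M - B z s) y \<partial>M)
           \<le> ennreal (D / (1 - 2 powr - e) * H)"
proof -
  define q where "q = 2 powr - e"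
  have q: "0 < q" "q < 1" unfolding q_def using e by (auto simp: powr_less_one)
  define c where "c m = q ^ m / V z (2 ^ m * s)" for m :: nat
  have Vp: "0 < V z (2 ^ m * s)" for m :: nat using z s by (intro V_pos) auto
  have c0: "0 \<le> c m" for m unfolding c_def using q Vp[of m] by simp
  have pw: "ennreal ((s / \<rho> z y) powr e / V z (\<rho> z y)) * h y * indicator (space M - B z s) y
      \<le> (\<Sum>m. ennreal (c m) * (h y * indicator (B z (2 ^ Suc m * s)) y))" if y: "y \<in> space M" for y
  proof (cases "y \<in> B z s")
    case False
    then have sy: "s \<le> \<rho> z y" using y by (auto simp: mem_B)
    have "\<exists>n::nat. \<rho> z y / s < 2 ^ n" by (intro real_arch_pow) auto
    then have ex: "\<exists>n::nat. \<rho> z y < 2 ^ n * s" using s by (simp add: pos_divide_less_eq)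
    \<comment> \<open>\<open>n > 0\<close> because \<open>s \<le> \<rho> z y\<close>, so
      \<open>y\<close> belongs to the annulus with index \<open>n - 1\<close>.\<close>
    define n where "n = (LEAST n::nat. \<rho> z y < 2 ^ n * s)"
    have n: "\<rho> z y < 2 ^ n * s" unfolding n_def using ex by (rule LeastI_ex)
    have "n \<noteq> 0" using n sy by (cases n) auto
    then obtain m where m: "n = Suc m" by (cases n) auto
    have lo: "2 ^ m * s \<le> \<rho> z y"
      using not_less_Least[of m "\<lambda>n. \<rho> z y < 2 ^ n * s"] m unfolding n_def[symmetric] by auto
    have pos: "0 < \<rho> z y" using s sy by linarith
    have "(s / \<rho> z y) powr e \<le> (1 / 2 ^ m) powr e"
      using lo s pos e by (intro powr_mono2) (auto simp: field_simps)
    also have "(1 / 2 ^ m) = 2 powr (- real m)" by (simp add: powr_minus powr_realpow divide_inverse)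
    also have "(2 powr (- real m)) powr e = q ^ m" unfolding q_def by (simp add: powr_powr powr_power mult.commute)
    finally have "(s / \<rho> z y) powr e / V z (\<rho> z y) \<le> c m"
      unfolding c_def using V_mono[OF z lo] Vp[of m] q by (intro frac_le) auto
    then have "ennreal ((s / \<rho> z y) powr e / V z (\<rho> z y)) * h y * indicator (space M - B z s) y \<le> ennreal (c m) * (h y * indicator (B z (2 ^ Suc m * s)) y)"
      using n m y False by (auto simp: mem_B intro!: mult_right_mono ennreal_leI)
    also have "\<dots> = (\<Sum>i\<in>{m}. ennreal (c i) * (h y * indicator (B z (2 ^ Suc i * s)) y))" by simp
    also have "\<dots> \<le> (\<Sum>m. ennreal (c m) * (h y * indicator (B z (2 ^ Suc m * s)) y))"
      by (intro sum_le_suminf) auto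
    finally show ?thesis .
  qed auto
  have "(\<integral>\<^sup>+y. ennreal ((s / \<rho> z y) powr e / V z (\<rho> z y)) * h y * indicator (space M - B z s) y \<partial>M)
      \<le> (\<integral>\<^sup>+y. (\<Sum>m. ennreal (c m) * (h y * indicator (B z (2 ^ Suc m * s)) y)) \<partial>M)"
    using pw by (intro nn_integral_mono)
  also have "\<dots> = (\<Sum>m. ennreal (c m) * (\<integral>\<^sup>+y\<in>B z (2 ^ Suc m * s). h y \<partial>M))"
    using z B_sets by (subst nn_integral_suminf) (auto intro!: suminf_cong nn_integral_cmult)
  also have "\<dots> \<le> (\<Sum>m. ennreal (D * H * q ^ m))"
  proof (intro suminf_le)
    fix m
    have "s \<le> 2 ^ Suc m * s" using s mult_right_mono[OF one_le_power[of "2::real" "Suc m"], of s] by simp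
    then have "ennreal (c m) * (\<integral>\<^sup>+y\<in>B z (2 ^ Suc m * s). h y \<partial>M) \<le> ennreal (c m) * ennreal (H * V z (2 ^ Suc m * s))"
      by (intro mult_left_mono le) auto
    also have "\<dots> = ennreal (c m * (H * V z (2 ^ Suc m * s)))" using c0 H by (simp add: ennreal_mult V_def)
    also have "\<dots> \<le> ennreal (c m * (H * (D * V z (2 ^ m * s))))"
      using ball_doubling[OF z, of "2 ^ m * s"] s c0 H
      by (intro ennreal_leI mult_left_mono) (auto simp: V_def mult.assoc)
    also have "c m * (H * (D * V z (2 ^ m * s))) = D * H * q ^ m" unfolding c_def using Vp[of m] by simp
    finally show "ennreal (c m) * (\<integral>\<^sup>+y\<in>B z (2 ^ Suc m * s). h y \<partial>M) \<le> ennreal (D * H * q ^ m)" .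
  qed auto
  also have "\<dots> = ennreal (\<Sum>m. D * H * q ^ m)"
    using q H D_ge_1 by (intro suminf_ennreal2 summable_mult summable_geometric) auto
  also have "(\<Sum>m. D * H * q ^ m) = D / (1 - 2 powr - e) * H"
    using q by (simp add: suminf_mult suminf_geometric q_def[symmetric] summable_geometric)
  finally show ?thesis .
qed

end

text \<open>Its parameters \<open>A\<close>, \<open>D\<close>, \<open>\<eta>\<close> and
  \<open>b\<^sub>T\<close> are all that the final constant depends on. Note that
  \<open>b\<^sub>T\<close> bounds the square of the operator norm.\<close>

locale cz_space = doubling_space +
  fixes T :: "('a \<Rightarrow> real) \<Rightarrow> 'a \<Rightarrow> real" and K :: "'a \<Rightarrow> 'a \<Rightarrow> real" and \<eta> b\<^sub>T :: real
  assumes eta_pos: "0 < \<eta>" and bT_nonneg: "0 \<le> b\<^sub>T"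
    and T_linear: "\<And>f g a b. sqint M f \<Longrightarrow> sqint M g \<Longrightarrow>
          AE x in M. T (\<lambda>y. a * f y + b * g y) x = a * T f x + b * T g x"
    and T_sqint: "\<And>f. sqint M f \<Longrightarrow> sqint M (T f)"
    and T_bounded: "\<And>f. sqint M f \<Longrightarrow> (LINT x|M. (T f x)\<^sup>2) \<le> b\<^sub>T * (LINT x|M. (f x)\<^sup>2)"
    and T_kernel: "\<And>f. sqint M f \<Longrightarrow> AE x in M. x \<notin> ess_support M \<rho> f \<longrightarrow>
          has_bochner_integral M (\<lambda>y. K x y * f y) (T f x)"
    and K_smooth1: "\<And>x\<^sub>0 x y. x\<^sub>0 \<in> space M \<Longrightarrow> x \<in> space M \<Longrightarrow> y \<in> space M \<Longrightarrow> x\<^sub>0 \<noteq> y \<Longrightarrow> x \<noteq> y \<Longrightarrow>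
          \<rho> x\<^sub>0 x \<le> \<eta> * \<rho> x\<^sub>0 y \<Longrightarrow>
          \<bar>K x y - K x\<^sub>0 y\<bar> \<le> (\<rho> x\<^sub>0 x / \<rho> x\<^sub>0 y) powr \<eta> / measure M (qball M \<rho> x\<^sub>0 (\<rho> x\<^sub>0 y))"
    and K_smooth2: "\<And>x\<^sub>0 x y. x\<^sub>0 \<in> space M \<Longrightarrow> x \<in> space M \<Longrightarrow> y \<in> space M \<Longrightarrow> x\<^sub>0 \<noteq> y \<Longrightarrow> x \<noteq> y \<Longrightarrow>
          \<rho> x\<^sub>0 x \<le> \<eta> * \<rho> x\<^sub>0 y \<Longrightarrow>
          \<bar>K y x - K y x\<^sub>0\<bar> \<le> (\<rho> x\<^sub>0 x / \<rho> x\<^sub>0 y) powr \<eta> / measure M (qball M \<rho> x\<^sub>0 (\<rho> x\<^sub>0 y))"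
begin

text \<open>The kernel estimates are used for \<open>x\<close> in a cube of radius \<open>r\<close> and \<open>y\<close> outside the ball of radius \<open>\<alpha> * r\<close>
  with the same centre.\<close>

definition \<alpha> :: real where "\<alpha> = 6 * A ^ 3 * (1 + 1 / \<eta>)"

text \<open>The constant of \<open>annular_bound\<close> for the exponent \<open>\<eta>\<close> of
  the kernel.\<close>

definition C\<^sub>\<eta> :: real where "C\<^sub>\<eta> = D / (1 - 2 powr - \<eta>)"

lemma A_pow_le: "i \<le> j \<Longrightarrow> A ^ i \<le> A ^ j"
  using A_ge_1 by (simp add: power_increasing)

lemma alpha_ge: "6 * A ^ 3 \<le> \<alpha>" "3 * A\<^sup>2 \<le> \<eta> * \<alpha>" "0 < \<alpha>"
proof -
  have A: "0 < A ^ 3" using A_ge_1 by simp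
  show "6 * A ^ 3 \<le> \<alpha>" unfolding \<alpha>_def using A eta_pos by (simp add: mult_le_cancel_left1)
  then show "0 < \<alpha>" using A by linarith
  have "\<eta> * \<alpha> = 6 * A ^ 3 * (\<eta> + 1)" unfolding \<alpha>_def using eta_pos by (simp add: field_simps)
  also have "\<dots> \<ge> 6 * A ^ 3 * 1" using A eta_pos by (intro mult_left_mono) auto
  finally show "3 * A\<^sup>2 \<le> \<eta> * \<alpha>" using A_pow_le[of 2 3] A by linarith
qed

lemma alpha_gt: "3 * A\<^sup>2 < \<alpha>"
  using alpha_ge(1) A_pow_le[of 2 3] A_pow_le[of 0 3] by simp

lemma C_eta_nonneg: "0 \<le> C\<^sub>\<eta>"
  unfolding C\<^sub>\<eta>_def using D_ge_1 powr_less_one[of 2 "- \<eta>"] eta_pos by simp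

text \<open>Collects what \<open>\<alpha>\<close> was chosen for. For \<open>p\<close> in a cube and
  \<open>y\<close> far from it the smoothness estimates at the centre apply, since
  \<open>3 * A\<^sup>2 \<le> \<eta> * \<alpha>\<close>; and \<open>p\<close> keeps the distance
  \<open>r\<close> from \<open>y\<close>, since \<open>3 * A ^ 3 + A \<le> \<alpha>\<close>, so that
  \<open>p\<close> stays off the support of a function living out there.\<close>

lemma near_far:
  assumes "z \<in> space M" "p \<in> space M" "y \<in> space M" "0 < r" "\<rho> z p < 3 * A\<^sup>2 * r" "\<alpha> * r \<le> \<rho> z y"
  shows "z \<noteq> y" "p \<noteq> y" "\<rho> z p \<le> \<eta> * \<rho> z y"
    "(\<rho> z p / \<rho> z y) powr \<eta> / V z (\<rho> z y) \<le> (\<alpha> * r / \<rho> z y) powr \<eta> / V z (\<rho> z y)" "r \<le> \<rho> p y"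
proof -
  have A0: "0 < A" using A_ge_1 by simp
  have pos: "0 < \<rho> z y" using assms(4,6) alpha_ge(3) by (meson less_le_trans mult_pos_pos)
  then show "z \<noteq> y" using rho_self assms by auto
  have "3 * A\<^sup>2 * r \<le> \<alpha> * r" using alpha_gt assms(4) by (intro mult_right_mono) auto
  then show "p \<noteq> y" using assms(5,6) by auto
  have "3 * A\<^sup>2 * r \<le> \<eta> * \<alpha> * r" using alpha_ge(2) assms(4) by (intro mult_right_mono) auto
  also have "\<dots> \<le> \<eta> * \<rho> z y" using eta_pos assms(6) by (simp add: mult.assoc)
  finally show "\<rho> z p \<le> \<eta> * \<rho> z y" using assms(5) by simp
  show "(\<rho> z p / \<rho> z y) powr \<eta> / V z (\<rho> z y) \<le> (\<alpha> * r / \<rho> z y) powr \<eta> / V z (\<rho> z y)"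
    using pos eta_pos assms rho_nonneg V_pos[OF assms(1) pos] order_trans[OF less_imp_le[OF assms(5)] \<open>3 * A\<^sup>2 * r \<le> \<alpha> * r\<close>]
    by (intro divide_right_mono powr_mono2) auto
  show "r \<le> \<rho> p y"
  proof (rule ccontr)
    assume "\<not> r \<le> \<rho> p y"
    have "\<rho> z y \<le> A * (\<rho> z p + \<rho> p y)" using rho_tri assms by blast
    also have "\<dots> < A * (3 * A\<^sup>2 * r + r)" using \<open>\<not> r \<le> \<rho> p y\<close> assms(5) A0 by (intro mult_strict_left_mono) auto
    also have "\<dots> = (3 * A ^ 3 + A) * r" by (simp add: power2_eq_square power3_eq_cube algebra_simps)
    also have "\<dots> \<le> \<alpha> * r" using alpha_ge(1) A_pow_le[of 1 3] A0 assms(4) by (intro mult_right_mono) auto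
    finally show False using assms(6) by simp
  qed
qed

lemma not_in_ess_support:
  assumes "x \<in> space M" "0 < r" "\<And>y. y \<in> space M \<Longrightarrow> \<rho> x y < r \<Longrightarrow> f y = 0"
  shows "x \<notin> ess_support M \<rho> f"
proof -
  have "AE y in M. y \<in> qball M \<rho> x r \<longrightarrow> f y = 0" using assms(3) by (intro AE_I2) (auto simp: mem_B)
  then show ?thesis unfolding ess_support_def using assms(2) by auto
qed

text \<open>The kernel is not assumed to be jointly measurable, so that Fubini's theorem is not available; the bound
  is therefore stated pointwise, with a right-hand side that depends only on the distance to the centre.\<close>

lemma T_cancellation_bound:
  assumes b: "sqint M b" "integrable M b" "(LINT y|M. b y) = 0"
    and z: "z \<in> space M" and r: "0 < r"
    and supp: "\<And>y. y \<in> space M \<Longrightarrow> y \<notin> B z (3 * A\<^sup>2 * r) \<Longrightarrow> b y = 0"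
  shows "AE x in M. x \<notin> B z (\<alpha> * r) \<longrightarrow>
     \<bar>T b x\<bar> \<le> (\<alpha> * r / \<rho> z x) powr \<eta> / V z (\<rho> z x) * (LINT y|M. \<bar>b y\<bar>)"
  using T_kernel[OF b(1)] AE_space
proof eventually_elim
  case (elim x)
  show ?case
  proof
    assume "x \<notin> B z (\<alpha> * r)"
    then have far: "\<alpha> * r \<le> \<rho> z x" using elim(2) by (auto simp: mem_B)
    have "x \<notin> ess_support M \<rho> b"
    proof (rule not_in_ess_support[OF elim(2) r])
      fix y assume y: "y \<in> space M" "\<rho> x y < r"
      show "b y = 0"
      proof (rule ccontr)
        assume "b y \<noteq> 0"
        then have "\<rho> z y < 3 * A\<^sup>2 * r" using supp[OF y(1)] y(1) by (auto simp: mem_B)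
        then have "r \<le> \<rho> y x" using near_far(5)[OF z y(1) elim(2) r _ far] by simp
        then show False using y rho_sym[of x y] elim(2) by simp
      qed
    qed
    then have i1: "has_bochner_integral M (\<lambda>y. K x y * b y) (T b x)" using elim(1) by simp
    \<comment> \<open>As \<open>b\<close> has integral zero, the kernel at the centre may be
      subtracted at no cost.\<close>
    have i2: "has_bochner_integral M (\<lambda>y. K x z * b y) (K x z * 0)"
      using b by (intro has_bochner_integral_mult_right) (simp add: has_bochner_integral_iff)
    have i3: "has_bochner_integral M (\<lambda>y. K x y * b y - K x z * b y) (T b x)"
      using has_bochner_integral_diff[OF i1 i2] by simp
    define c where "c = (\<alpha> * r / \<rho> z x) powr \<eta> / V z (\<rho> z x)"
    have "\<bar>T b x\<bar> \<le> (LINT y|M. \<bar>K x y * b y - K x z * b y\<bar>)"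
      using i3 integral_abs_bound[of M "\<lambda>y. K x y * b y - K x z * b y"] by (simp add: has_bochner_integral_iff)
    also have "\<dots> \<le> (LINT y|M. c * \<bar>b y\<bar>)"
    proof (rule integral_mono)
      show "integrable M (\<lambda>y. \<bar>K x y * b y - K x z * b y\<bar>)" using i3 by (auto simp: has_bochner_integral_iff)
      show "integrable M (\<lambda>y. c * \<bar>b y\<bar>)" using b by auto
      fix y assume y: "y \<in> space M"
      show "\<bar>K x y * b y - K x z * b y\<bar> \<le> c * \<bar>b y\<bar>"
      proof (cases "b y = 0")
        case False
        then have ny: "\<rho> z y < 3 * A\<^sup>2 * r" using supp[OF y] y by (auto simp: mem_B)
        note nf = near_far[OF z y elim(2) r ny far]
        have "\<bar>K x y - K x z\<bar> \<le> (\<rho> z y / \<rho> z x) powr \<eta> / V z (\<rho> z x)"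
          unfolding V_def using K_smooth2[OF z y elim(2) nf(1,2,3)] .
        also have "\<dots> \<le> c" unfolding c_def by (rule nf(4))
        finally have "\<bar>K x y - K x z\<bar> * \<bar>b y\<bar> \<le> c * \<bar>b y\<bar>" by (intro mult_right_mono) auto
        then show ?thesis by (simp add: abs_mult[symmetric] left_diff_distrib)
      qed simp
    qed
    finally show "\<bar>T b x\<bar> \<le> c * (LINT y|M. \<bar>b y\<bar>)" by simp
  qed
qed

text \<open>The kernels at \<open>x\<close> and \<open>x'\<close> are both compared with the one at
  the centre \<open>z\<close>, whence the factor \<open>2\<close>. The null set is exhibited rather
  than hidden in \<open>AE\<close>, because one chosen point \<open>x'\<close> will be compared with
  all others.\<close>

lemma T_oscillation_bound:
  assumes f: "sqint M f" and z: "z \<in> space M" and r: "0 < r" and H: "0 \<le> H"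
    and supp: "\<And>y. y \<in> B z (\<alpha> * r) \<Longrightarrow> f y = 0"
    and le: "\<And>t. \<alpha> * r \<le> t \<Longrightarrow> (\<integral>\<^sup>+y\<in>B z t. ennreal \<bar>f y\<bar> \<partial>M) \<le> ennreal (H * V z t)"
  shows "\<exists>N\<in>null_sets M. \<forall>x\<in>B z (3 * A\<^sup>2 * r) - N. \<forall>x'\<in>B z (3 * A\<^sup>2 * r) - N.
     \<bar>T f x - T f x'\<bar> \<le> 2 * (C\<^sub>\<eta> * H)"
proof -
  have [measurable]: "f \<in> borel_measurable M" using f sqintD by auto
  have nonsupp: "x \<notin> ess_support M \<rho> f" if x: "x \<in> B z (3 * A\<^sup>2 * r)" for x
  proof (rule not_in_ess_support[OF _ r])
    show xX: "x \<in> space M" using x by (auto simp: mem_B)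
    fix y assume y: "y \<in> space M" "\<rho> x y < r"
    show "f y = 0"
    proof (rule supp, rule ccontr)
      assume "y \<notin> B z (\<alpha> * r)"
      then have "\<alpha> * r \<le> \<rho> z y" using y by (auto simp: mem_B)
      then show False using near_far(5)[OF z xX y(1) r] x y(2) by (auto simp: mem_B)
    qed
  qed
  have "AE x in M. x \<in> B z (3 * A\<^sup>2 * r) \<longrightarrow> has_bochner_integral M (\<lambda>y. K x y * f y) (T f x)"
    using T_kernel[OF f] by eventually_elim (use nonsupp in auto)
  then obtain N where N: "\<And>x. x \<in> space M - N \<Longrightarrow> x \<in> B z (3 * A\<^sup>2 * r) \<longrightarrow> has_bochner_integral M (\<lambda>y. K x y * f y) (T f x)"
      "N \<in> null_sets M"
    using AE_E3 by blast
  show ?thesis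
  proof (intro bexI[OF _ N(2)] ballI)
    fix x x' assume x: "x \<in> B z (3 * A\<^sup>2 * r) - N" and x': "x' \<in> B z (3 * A\<^sup>2 * r) - N"
    have X: "x \<in> space M" "x' \<in> space M" "\<rho> z x < 3 * A\<^sup>2 * r" "\<rho> z x' < 3 * A\<^sup>2 * r"
      using x x' by (auto simp: mem_B)
    have i1: "has_bochner_integral M (\<lambda>y. K x y * f y) (T f x)" using N(1) x X by auto
    have i2: "has_bochner_integral M (\<lambda>y. K x' y * f y) (T f x')" using N(1) x' X by auto
    have i3: "has_bochner_integral M (\<lambda>y. K x y * f y - K x' y * f y) (T f x - T f x')"
      using has_bochner_integral_diff[OF i1 i2] .
    define \<psi> where "\<psi> y = (\<alpha> * r / \<rho> z y) powr \<eta> / V z (\<rho> z y)" for y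
    have pw: "ennreal \<bar>K x y * f y - K x' y * f y\<bar> \<le> ennreal (\<psi> y) * (2 * ennreal \<bar>f y\<bar>) * indicator (space M - B z (\<alpha> * r)) y"
      if y: "y \<in> space M" for y
    proof (cases "y \<in> B z (\<alpha> * r)")
      case True
      then show ?thesis using supp by simp
    next
      case False
      then have far: "\<alpha> * r \<le> \<rho> z y" using y by (auto simp: mem_B)
      have psi0: "0 \<le> \<psi> y" unfolding \<psi>_def V_def by simp
      have *: "\<bar>K p y - K z y\<bar> \<le> \<psi> y" if p: "p \<in> space M" "\<rho> z p < 3 * A\<^sup>2 * r" for p
      proof -
        note nf = near_far[OF z p(1) y r p(2) far]
        have "\<bar>K p y - K z y\<bar> \<le> (\<rho> z p / \<rho> z y) powr \<eta> / V z (\<rho> z y)"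
          unfolding V_def using K_smooth1[OF z p(1) y nf(1,2,3)] .
        also have "\<dots> \<le> \<psi> y" unfolding \<psi>_def by (rule nf(4))
        finally show ?thesis .
      qed
      have "\<bar>K x y - K x' y\<bar> \<le> 2 * \<psi> y" using *[OF X(1,3)] *[OF X(2,4)] by linarith
      then have "\<bar>K x y - K x' y\<bar> * \<bar>f y\<bar> \<le> 2 * (\<psi> y * \<bar>f y\<bar>)"
        by (metis abs_ge_zero mult.assoc mult_right_mono)
      then have "ennreal \<bar>K x y * f y - K x' y * f y\<bar> \<le> ennreal (\<psi> y * (2 * \<bar>f y\<bar>))"
        by (intro ennreal_leI) (simp add: abs_mult[symmetric] left_diff_distrib mult.assoc mult.left_commute)
      also have "\<dots> = ennreal (\<psi> y) * (2 * ennreal \<bar>f y\<bar>)" using psi0 by (simp add: ennreal_mult)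
      finally show ?thesis using False y by simp
    qed
    have "ennreal \<bar>T f x - T f x'\<bar> \<le> (\<integral>\<^sup>+y. ennreal \<bar>K x y * f y - K x' y * f y\<bar> \<partial>M)"
      using i3 integral_norm_bound_ennreal[of M "\<lambda>y. K x y * f y - K x' y * f y"]
      by (simp add: has_bochner_integral_iff)
    also have "\<dots> \<le> (\<integral>\<^sup>+y. ennreal (\<psi> y) * (2 * ennreal \<bar>f y\<bar>) * indicator (space M - B z (\<alpha> * r)) y \<partial>M)"
      using pw by (intro nn_integral_mono)
    also have "\<dots> \<le> ennreal (C\<^sub>\<eta> * (2 * H))"
      unfolding \<psi>_def C\<^sub>\<eta>_def
    proof (intro annular_bound z)
      fix t assume t: "\<alpha> * r \<le> t"
      have "(\<integral>\<^sup>+y\<in>B z t. 2 * ennreal \<bar>f y\<bar> \<partial>M) = 2 * (\<integral>\<^sup>+y\<in>B z t. ennreal \<bar>f y\<bar> \<partial>M)"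
        using B_sets[OF z] by (subst nn_integral_cmult[symmetric]) (auto simp: mult.assoc)
      also have "\<dots> \<le> 2 * ennreal (H * V z t)" by (intro mult_left_mono le t) simp
      also have "\<dots> = ennreal (2 * H * V z t)" using H by (simp add: ennreal_mult V_def mult.assoc)
      finally show "(\<integral>\<^sup>+y\<in>B z t. 2 * ennreal \<bar>f y\<bar> \<partial>M) \<le> ennreal (2 * H * V z t)" .
    qed (use alpha_ge r H eta_pos in auto)
    finally show "\<bar>T f x - T f x'\<bar> \<le> 2 * (C\<^sub>\<eta> * H)" using C_eta_nonneg H by simp
  qed
qed

end

section \<open>The weak type bound\<close>

text \<open>The finite measure with density \<open>g\<close> is continuous along the tails of an
  enumeration, which decrease to the empty set. Countable families of stopping cubes can thus be
  replaced by finite ones at an arbitrarily small loss.\<close>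

lemma countable_union_finite_tail:
  fixes g :: "'b \<Rightarrow> real"
  assumes S: "countable S" "\<And>s. s \<in> S \<Longrightarrow> E s \<in> sets M"
    and g: "integrable M g" "\<And>x. 0 \<le> g x" and e: "0 < e"
  shows "\<exists>F\<subseteq>S. finite F \<and> (LINT x|M. g x * indicator ((\<Union>s\<in>S. E s) - (\<Union>s\<in>F. E s)) x) < e"
proof -
  define F where "F n = {s\<in>S. to_nat_on S s < n}" for n
  have finF: "finite (F n)" for n
  proof -
    have "finite (to_nat_on S -` {..<n} \<inter> S)"
      using S(1) by (intro finite_vimage_IntI inj_on_to_nat_on) auto
    then show ?thesis unfolding F_def by (rule finite_subset[rotated]) auto
  qed
  define X where "X n = (\<Union>s\<in>S. E s) - (\<Union>s\<in>F n. E s)" for n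
  have [measurable]: "g \<in> borel_measurable M" using g by auto
  have [measurable]: "(\<Union>s\<in>S. E s) \<in> sets M" using S by (intro sets.countable_UN'') auto
  have [measurable]: "(\<Union>s\<in>F n. E s) \<in> sets M" for n
    using S finF[of n] by (intro sets.finite_UN) (auto simp: F_def)
  have Xm [measurable]: "X n \<in> sets M" for n unfolding X_def by measurable
  define N where "N = density M (\<lambda>x. ennreal (g x))"
  have Xe: "emeasure N (X n) = ennreal (LINT x|M. g x * indicator (X n) x)" for n
  proof -
    have "emeasure N (X n) = (\<integral>\<^sup>+x. ennreal (g x * indicator (X n) x) \<partial>M)"
      unfolding N_def by (subst emeasure_density) (auto intro!: nn_integral_cong simp: indicator_def)
    also have "\<dots> = ennreal (LINT x|M. g x * indicator (X n) x)"
      using g by (intro nn_integral_eq_integral integrable_real_mult_indicator) auto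
    finally show ?thesis .
  qed
  have "\<exists>n. measure N (X n) < e"
  proof (rule measure_decseq_small[OF _ _ _ e])
    show "X n \<in> fmeasurable N" for n
      using Xe[of n] by (intro fmeasurableI) (auto simp: N_def)
    show "decseq X" unfolding decseq_def X_def F_def by (auto dest: less_le_trans)
    show "(\<Inter>n. X n) = {}"
    proof (rule ccontr)
      assume "(\<Inter>n. X n) \<noteq> {}"
      then obtain x where x: "\<And>n. x \<in> X n" by auto
      then obtain s where "s \<in> S" "x \<in> E s" unfolding X_def by auto
      then show False using x[of "Suc (to_nat_on S s)"] unfolding X_def F_def by auto
    qed
  qed
  then obtain n where "measure N (X n) < e" by auto
  then have "(LINT x|M. g x * indicator (X n) x) < e"
    using Xe[of n] g by (simp add: measure_def integral_nonneg_AE)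
  then show ?thesis using finF[of n] unfolding X_def by (intro exI[of _ "F n"]) (auto simp: F_def)
qed

context cz_space
begin

text \<open>Bounds the measure of a parent by that of its child: the parent lies in a ball about the
  centre of the child of radius \<open>6 * A ^ 3 * rad k\<close>, which equals
  \<open>96 * A ^ 7 * rad (Suc k)\<close>.\<close>

definition C\<^sub>p :: real where "C\<^sub>p = Dil (96 * A ^ 7) * Dil (4 * A\<^sup>2)"

text \<open>The summands belong, in this order, to the good part (\<open>9\<close> from Chebyshev at
  level \<open>t / 3\<close>), to the dilated cubes, and to the bad part off them
  (\<open>6 = 3 * 2\<close>, from the level \<open>t / 3\<close> and from subtracting the
  mean).\<close>

definition C\<^sub>w :: real where "C\<^sub>w = 9 * b\<^sub>T * C\<^sub>p + Dil (4 * A\<^sup>2 * \<alpha>) + 6 * C\<^sub>\<eta>"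

lemma Cp_ge_1: "1 \<le> C\<^sub>p"
  unfolding C\<^sub>p_def using mult_mono[OF Dil_ge_1 Dil_ge_1, of "96 * A ^ 7" "4 * A\<^sup>2"] Dil_pos[of "96 * A ^ 7"] by simp

lemma Cw_nonneg: "0 \<le> C\<^sub>w"
  unfolding C\<^sub>w_def using bT_nonneg Cp_ge_1 C_eta_nonneg Dil_pos[of "4 * A\<^sup>2 * \<alpha>"] by (intro add_nonneg_nonneg mult_nonneg_nonneg) auto

lemma T_sum:
  assumes "finite I" "\<And>i. i \<in> I \<Longrightarrow> sqint M (f i)"
  shows "AE x in M. T (\<lambda>y. \<Sum>i\<in>I. f i y) x = (\<Sum>i\<in>I. T (f i) x)"
  using assms
proof (induction I rule: finite_induct)
  case empty
  have "sqint M (\<lambda>x. 0::real)" by (auto simp: sqint_def)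
  from T_linear[OF this this, of 0 0] show ?case by simp
next
  case (insert i I)
  have "AE x in M. T (\<lambda>y. 1 * f i y + 1 * (\<Sum>i\<in>I. f i y)) x = 1 * T (f i) x + 1 * T (\<lambda>y. \<Sum>i\<in>I. f i y) x"
    using insert.prems insert.hyps by (intro T_linear sqint_sum) auto
  moreover have "AE x in M. T (\<lambda>y. \<Sum>i\<in>I. f i y) x = (\<Sum>i\<in>I. T (f i) x)" using insert by auto
  ultimately show ?case by eventually_elim (use insert.hyps in simp)
qed

lemma T_add:
  assumes "sqint M f" "sqint M g"
  shows "AE x in M. T (\<lambda>y. f y + g y) x = T f x + T g x"
  using T_linear[OF assms, of 1 1] by simp

lemma T_chebyshev:
  assumes u: "sqint M u" and c: "0 < c"
  shows "emeasure M {x \<in> space M. c \<le> \<bar>T u x\<bar>} \<le> ennreal (b\<^sub>T * (LINT x|M. (u x)\<^sup>2) / c\<^sup>2)"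
proof -
  have "{x \<in> space M. c \<le> \<bar>T u x\<bar>} = {x \<in> space M. c\<^sup>2 \<le> (T u x)\<^sup>2}"
    using c by (auto simp: abs_le_square_iff[symmetric])
  also have "emeasure M \<dots> \<le> ennreal (1 / c\<^sup>2 * (LINT x|M. (T u x)\<^sup>2))"
    using c sqintD(2)[OF T_sqint[OF u]] by (intro integral_Markov_inequality) auto
  also have "\<dots> \<le> ennreal (b\<^sub>T * (LINT x|M. (u x)\<^sup>2) / c\<^sup>2)"
    using T_bounded[OF u] c by (intro ennreal_leI) (simp add: divide_right_mono)
  finally show ?thesis .
qed

end

locale cz_dyadic = cz_space + dyadic_system
begin

declare Q.simps [simp del]

lemma parent_measure:
  assumes "a \<in> Net (Suc k)" "b \<in> Net k" "Q (Suc k) a \<subseteq> Q k b"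
  shows "measure M (Q k b) \<le> C\<^sub>p * measure M (Q (Suc k) a)"
proof -
  have X: "a \<in> space M" "b \<in> space M" using assms Net_space by auto
  have "\<rho> b a < 3 * A\<^sup>2 * rad k" using Net_in_Q[OF assms(1)] assms(3) Q_sub_ball[OF assms(2)] by (auto simp: mem_B)
  then have "A * (\<rho> a b + 3 * A\<^sup>2 * rad k) \<le> A * (3 * A\<^sup>2 * rad k + 3 * A\<^sup>2 * rad k)"
    using rho_sym[OF X] A_pos by (intro mult_left_mono add_right_mono) auto
  also have "\<dots> = 6 * A ^ 3 * rad k" by (simp add: power2_eq_square power3_eq_cube)
  also have "\<dots> = 96 * A ^ 7 * rad (Suc k)"
    using A_pos unfolding rad_Suc \<delta>_def by (simp add: field_simps power_add[symmetric])
  finally have "V b (3 * A\<^sup>2 * rad k) \<le> Dil (96 * A ^ 7) * V a (rad (Suc k))"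
    using X rad_pos by (intro V_le) auto
  also have "V a (rad (Suc k)) \<le> Dil (4 * A\<^sup>2) * measure M (Q (Suc k) a)" using V_le_Q[OF assms(1), of 1] by simp
  finally have "V b (3 * A\<^sup>2 * rad k) \<le> C\<^sub>p * measure M (Q (Suc k) a)"
    unfolding C\<^sub>p_def using Dil_pos by (simp add: mult.assoc)
  moreover have "measure M (Q k b) \<le> V b (3 * A\<^sup>2 * rad k)"
    unfolding V_def using Q_sub_ball[OF assms(2)] Q_measurable[OF assms(2)] X by (intro measure_mono_fmeasurable) auto
  ultimately show ?thesis by linarith
qed

text \<open>Only finitely many of the bad parts are separated from \<open>f\<close>. The rest has small \<open>L\<^sup>2\<close> norm, and so no
  convergence of an infinite sum under \<open>T\<close> is needed.\<close>

lemma weak_type: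
  assumes f: "sqint M f" "integrable M f" and t: "0 < t"
    and top: "\<And>a. a \<in> Net 0 \<Longrightarrow> (LINT y:Q 0 a|M. \<bar>f y\<bar>) \<le> t * measure M (Q 0 a)"
  shows "emeasure M {x \<in> space M. t < \<bar>T f x\<bar>} \<le> ennreal (C\<^sub>w / t * (LINT y|M. \<bar>f y\<bar>))"
proof -
  define Bad where "Bad k a \<longleftrightarrow> t * measure M (Q k a) < (LINT y:Q k a|M. \<bar>f y\<bar>)" for k a
  define S where "S = stop Bad"
  define I where "I s = (LINT y:cube s|M. \<bar>f y\<bar>)" for s
  define m where "m s = measure M (cube s)" for s
  define nf where "nf = (LINT y|M. \<bar>f y\<bar>)"
  define \<Omega> where "\<Omega> = (\<Union>s\<in>S. cube s)"
  have fm [measurable]: "f \<in> borel_measurable M" using f by auto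
  have SN: "snd s \<in> Net (fst s)" if "s \<in> S" for s using that stop_Net unfolding S_def by auto
  have SX: "snd s \<in> space M" if "s \<in> S" for s using Net_space[OF SN[OF that]] .
  have cm [measurable]: "cube s \<in> sets M" and cf: "cube s \<in> fmeasurable M" and m_pos: "0 < m s" if "s \<in> S" for s
    using SN[OF that] Q_measurable Q_pos unfolding m_def by auto
  have cS: "countable S" unfolding S_def by (rule stop_countable)
  have dS: "disjoint_family_on cube S" unfolding S_def by (rule stop_disjoint)
  have \<Omega>m [measurable]: "\<Omega> \<in> sets M" unfolding \<Omega>_def using cS cm by (intro sets.countable_UN'') auto
  have absf: "integrable M (\<lambda>y. \<bar>f y\<bar>)" using f by auto
  have I_int: "integrable M (\<lambda>y. \<bar>f y\<bar> * indicator (cube s) y)" if "s \<in> S" for s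
    using absf cm[OF that] by (intro integrable_real_mult_indicator) auto
  have I_eq: "I s = (LINT y|M. \<bar>f y\<bar> * indicator (cube s) y)" for s
    unfolding I_def set_lebesgue_integral_def by (simp add: mult.commute)
  have I0: "0 \<le> I s" for s unfolding I_eq by (intro integral_nonneg_AE) auto
  have I_low: "t * m s < I s" if "s \<in> S" for s
    using stop_Bad[of s Bad] that unfolding S_def Bad_def m_def I_def by auto
  have I_up: "I s \<le> C\<^sub>p * t * m s" if s: "s \<in> S" for s
  proof -
    \<comment> \<open>The hypothesis \<open>top\<close> keeps the cubes of generation
      \<open>0\<close> from being bad, so every stopping cube has a parent, and this parent is not
      bad.\<close>
    have "fst s \<noteq> 0"
    proof
      assume "fst s = 0"
      then show False using I_low[OF s] top[of "snd s"] SN[OF s] unfolding I_def m_def by auto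
    qed
    then obtain k where k: "fst s = Suc k" by (cases "fst s") auto
    have a: "snd s \<in> Net (Suc k)" using SN[OF s] k by simp
    define b where "b = par k (snd s)"
    have b: "b \<in> Net k" "Q (Suc k) (snd s) \<subseteq> Q k b"
      unfolding b_def using par(1) Net_space[OF a] Q_parent by auto
    have "\<not> Bad k b" using stop_not_Bad[of s Bad k b] s b k unfolding S_def by auto
    then have "(LINT y:Q k b|M. \<bar>f y\<bar>) \<le> t * measure M (Q k b)" unfolding Bad_def by auto
    moreover have "I s \<le> (LINT y:Q k b|M. \<bar>f y\<bar>)"
      unfolding I_eq set_lebesgue_integral_def real_scaleR_def mult.commute[of "indicator _ _"]
      using b k absf Q_measurable[OF b(1)] Q_measurable[OF a] I_int[OF s]
      by (intro integral_mono integrable_real_mult_indicator) (auto simp: indicator_def subset_iff)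
    moreover have "t * measure M (Q k b) \<le> t * (C\<^sub>p * m s)"
      using parent_measure[OF a b] t k unfolding m_def by (intro mult_left_mono) auto
    ultimately show ?thesis by (simp add: mult_ac)
  qed
  have sumI: "(\<Sum>s\<in>F. I s) \<le> nf" and sumI': "(LINT y|M. \<bar>f y\<bar> * (1 - indicator \<Omega> y)) + (\<Sum>s\<in>F. I s) \<le> nf"
    if F: "finite F" "F \<subseteq> S" for F
  proof -
    have ind: "(\<Sum>s\<in>F. indicator (cube s) y) = (indicator (\<Union>s\<in>F. cube s) y :: real)" for y
      using F dS by (intro indicator_UN_disjoint[symmetric]) (auto intro: disjoint_family_on_mono)
    have "integrable M (\<lambda>y. \<bar>f y\<bar> * indicator (- \<Omega>) y)"
      by (rule Bochner_Integration.integrable_bound[OF absf]) (auto simp: indicator_def)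
    moreover have "(\<lambda>y. \<bar>f y\<bar> * indicator (- \<Omega>) y) = (\<lambda>y. \<bar>f y\<bar> * (1 - indicator \<Omega> y))"
      by (auto simp: indicator_def)
    ultimately have i1: "integrable M (\<lambda>y. \<bar>f y\<bar> * (1 - indicator \<Omega> y))" by simp
    have i2: "integrable M (\<lambda>y. \<Sum>s\<in>F. \<bar>f y\<bar> * indicator (cube s) y)"
      using F I_int by (intro Bochner_Integration.integrable_sum) auto
    have "(\<Sum>s\<in>F. I s) = (LINT y|M. (\<Sum>s\<in>F. \<bar>f y\<bar> * indicator (cube s) y))"
      unfolding I_eq using F I_int by (intro Bochner_Integration.integral_sum[symmetric]) auto
    then have "(LINT y|M. \<bar>f y\<bar> * (1 - indicator \<Omega> y)) + (\<Sum>s\<in>F. I s)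
        = (LINT y|M. \<bar>f y\<bar> * (1 - indicator \<Omega> y) + (\<Sum>s\<in>F. \<bar>f y\<bar> * indicator (cube s) y))"
      using i1 i2 by simp
    also have "\<dots> \<le> nf" unfolding nf_def
    proof (rule integral_mono[OF Bochner_Integration.integrable_add[OF i1 i2] absf])
      fix y
      have "(\<Sum>s\<in>F. \<bar>f y\<bar> * indicator (cube s) y) = \<bar>f y\<bar> * indicator (\<Union>s\<in>F. cube s) y"
        using ind[of y] by (simp add: sum_distrib_left[symmetric])
      moreover have "indicator (\<Union>s\<in>F. cube s) y \<le> (indicator \<Omega> y :: real)"
        using F unfolding \<Omega>_def by (auto simp: indicator_def)
      then have "\<bar>f y\<bar> * (1 - indicator \<Omega> y + indicator (\<Union>s\<in>F. cube s) y) \<le> \<bar>f y\<bar> * 1" by (intro mult_left_mono) auto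
      ultimately show "\<bar>f y\<bar> * (1 - indicator \<Omega> y) + (\<Sum>s\<in>F. \<bar>f y\<bar> * indicator (cube s) y) \<le> \<bar>f y\<bar>"
        by (simp add: algebra_simps)
    qed
    finally show A: "(LINT y|M. \<bar>f y\<bar> * (1 - indicator \<Omega> y)) + (\<Sum>s\<in>F. I s) \<le> nf" .
    have "0 \<le> (LINT y|M. \<bar>f y\<bar> * (1 - indicator \<Omega> y))"
      by (intro integral_nonneg_AE AE_I2 mult_nonneg_nonneg) (auto simp: indicator_def)
    then show "(\<Sum>s\<in>F. I s) \<le> nf" using A by linarith
  qed
  have nf0: "0 \<le> nf" unfolding nf_def by simp
  have main: "emeasure M {x \<in> space M. t < \<bar>T f x\<bar>} \<le> ennreal (C\<^sub>w / t * nf) + ennreal e" if e: "0 < e" for e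
  proof -
    \<comment> \<open>Chosen so that Chebyshev for \<open>T h\<close> at level \<open>t / 3\<close>
      costs \<open>e\<close>; \<open>b\<^sub>T + 1\<close> is used because \<open>b\<^sub>T\<close>
      may be \<open>0\<close>.\<close>
    define e' where "e' = e * t\<^sup>2 / (9 * (b\<^sub>T + 1))"
    have e': "0 < e'" unfolding e'_def using e t bT_nonneg by simp
    obtain F where F: "F \<subseteq> S" "finite F"
      "(LINT x|M. (f x)\<^sup>2 * indicator ((\<Union>s\<in>S. cube s) - (\<Union>s\<in>F. cube s)) x) < e'"
      using countable_union_finite_tail[of S cube, OF cS cm sqintD(2)[OF f(1)] _ e'] by auto
    define \<Omega>F where "\<Omega>F = (\<Union>s\<in>F. cube s)"
    have FS: "s \<in> F \<Longrightarrow> s \<in> S" for s using F by auto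
    have FX: "s \<in> F \<Longrightarrow> snd s \<in> space M" for s using SX FS by simp
    have [measurable]: "\<Omega>F \<in> sets M" unfolding \<Omega>F_def by (intro sets.finite_UN F(2) cm FS)
    have dF: "disjoint_family_on cube F" using dS F by (auto intro: disjoint_family_on_mono)
    define av where "av s = (LINT y|M. f y * indicator (cube s) y) / m s" for s
    have fint: "integrable M (\<lambda>y. f y * indicator (cube s) y)" if "s \<in> S" for s
      using f cm[OF that] by (intro integrable_real_mult_indicator) auto
    have av_le: "\<bar>av s\<bar> * m s \<le> I s" if s: "s \<in> S" for s
    proof -
      have "\<bar>LINT y|M. f y * indicator (cube s) y\<bar> \<le> (LINT y|M. \<bar>f y * indicator (cube s) y\<bar>)" by (rule integral_abs_bound)
      also have "\<dots> = I s" unfolding I_eq by (intro Bochner_Integration.integral_cong) (auto simp: abs_mult)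
      finally show ?thesis unfolding av_def using m_pos[OF s] by simp
    qed
    have av_bd: "\<bar>av s\<bar> \<le> C\<^sub>p * t" if s: "s \<in> S" for s
      using av_le[OF s] I_up[OF s] m_pos[OF s] by (meson mult_le_cancel_right_pos order_trans)
    \<comment> \<open>On the stopping cubes outside \<open>F\<close> both \<open>g\<close> and the
      \<open>b s\<close> vanish, and \<open>f\<close> goes into \<open>h\<close> unchanged.\<close>
    define g where "g y = f y * (1 - indicator \<Omega> y) + (\<Sum>s\<in>F. av s * indicator (cube s) y)" for y
    define b where "b s y = f y * indicator (cube s) y + (- av s) * indicator (cube s) y" for s y
    define h where "h y = f y * indicator (\<Omega> - \<Omega>F) y" for y
    have indF: "(\<Sum>s\<in>F. indicator (cube s) y) = (indicator \<Omega>F y :: real)" for y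
      unfolding \<Omega>F_def using F dF by (intro indicator_UN_disjoint[symmetric]) auto
    have split: "f y = (g y + h y) + (\<Sum>s\<in>F. b s y)" for y
    proof -
      have "(\<Sum>s\<in>F. b s y) = f y * indicator \<Omega>F y - (\<Sum>s\<in>F. av s * indicator (cube s) y)"
        unfolding b_def by (simp add: sum_subtractf sum_distrib_left[symmetric] indF)
      moreover have ii: "indicator (\<Omega> - \<Omega>F) y = indicator \<Omega> y - (indicator \<Omega>F y :: real)"
        using F unfolding \<Omega>F_def \<Omega>_def by (auto simp: indicator_def)
      ultimately show ?thesis unfolding g_def h_def ii by (simp add: right_diff_distrib)
    qed
    have sq_b: "sqint M (b s)" if "s \<in> F" for s
      unfolding b_def[abs_def] using cm[OF FS[OF that]] cf[OF FS[OF that]]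
      by (intro sqint_add sqint_indicator sqint_indicator_const f)
    have sq_h: "sqint M h" unfolding h_def[abs_def] by (intro sqint_indicator f) measurable
    have sq_g: "sqint M g" unfolding g_def[abs_def]
    proof (intro sqint_add sqint_sum sqint_indicator_const)
      show "sqint M (\<lambda>x. f x * (1 - indicator \<Omega> x))"
        by (rule sqint_bound[OF f(1)]) (auto simp: indicator_def)
    qed (use F cf FS in auto)
    have sq_bF: "sqint M (\<lambda>y. \<Sum>s\<in>F. b s y)" using F sq_b by (intro sqint_sum) auto
    have T_split: "AE x in M. T f x = T g x + T h x + (\<Sum>s\<in>F. T (b s) x)"
    proof -
      have "f = (\<lambda>y. (g y + h y) + (\<Sum>s\<in>F. b s y))" using split by auto
      then have "AE x in M. T f x = T (\<lambda>y. g y + h y) x + T (\<lambda>y. \<Sum>s\<in>F. b s y) x"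
        using T_add[OF sqint_add[OF sq_g sq_h] sq_bF] by simp
      moreover have "AE x in M. T (\<lambda>y. g y + h y) x = T g x + T h x" by (rule T_add[OF sq_g sq_h])
      moreover have "AE x in M. T (\<lambda>y. \<Sum>s\<in>F. b s y) x = (\<Sum>s\<in>F. T (b s) x)" by (rule T_sum[OF F(2) sq_b])
      ultimately show ?thesis by eventually_elim simp
    qed
    \<comment> \<open>Off \<open>\<Omega>\<close> no cube around the point is bad, and
      \<open>AE_le_average\<close> bounds \<open>f\<close>; on \<open>\<Omega>\<close> only the
      averages over the cubes in \<open>F\<close> occur, which are bounded through their
      parents.\<close>
    have AEg: "AE x in M. \<bar>g x\<bar> \<le> C\<^sub>p * t"
    proof -
      have tC: "t \<le> C\<^sub>p * t" using Cp_ge_1 t by simp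
      show ?thesis using AE_le_average[OF f(2) t] AE_space
      proof eventually_elim
        case (elim x)
        show ?case
        proof (cases "x \<in> \<Omega>")
          case False
          have "(LINT y:Q k a|M. \<bar>f y\<bar>) \<le> t * measure M (Q k a)" if a: "a \<in> Net k" "x \<in> Q k a" for k a
          proof (rule ccontr)
            assume "\<not> ?thesis"
            then have "Bad k a" unfolding Bad_def by simp
            from stop_cover[OF a(1), of Bad, OF this] show False
              using a(2) False unfolding \<Omega>_def S_def by auto
          qed
          then have "\<bar>f x\<bar> \<le> t" using elim by auto
          moreover have "g x = f x"
            using False F unfolding g_def \<Omega>_def by (simp add: indicator_def) (intro sum.neutral, auto)
          ultimately show ?thesis using tC by simp
        next
          case True
          then have gx: "g x = (\<Sum>s\<in>F. av s * indicator (cube s) x)" unfolding g_def by simp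
          have "\<bar>g x\<bar> \<le> (\<Sum>s\<in>F. \<bar>av s * indicator (cube s) x\<bar>)" unfolding gx by (rule sum_abs)
          also have "\<dots> \<le> (\<Sum>s\<in>F. (C\<^sub>p * t) * indicator (cube s) x)"
            using av_bd FS by (intro sum_mono) (auto simp: indicator_def)
          also have "\<dots> = (C\<^sub>p * t) * indicator \<Omega>F x" by (simp add: sum_distrib_left[symmetric] indF)
          also have "\<dots> \<le> C\<^sub>p * t" using tC t by (auto simp: indicator_def)
          finally show ?thesis .
        qed
      qed
    qed
    have i0: "integrable M (\<lambda>y. \<bar>f y\<bar> * (1 - indicator \<Omega> y))"
      by (rule Bochner_Integration.integrable_bound[OF absf]) (auto simp: indicator_def)
    have i1: "integrable M (\<lambda>y. \<Sum>s\<in>F. \<bar>av s\<bar> * indicator (cube s) y)"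
      using F cf FS by (intro Bochner_Integration.integrable_sum integrable_mult_right integrable_real_indicator)
        (auto simp: fmeasurableD2 less_top[symmetric])
    have g_int: "(LINT y|M. (g y)\<^sup>2) \<le> C\<^sub>p * t * nf"
    proof -
      have "(LINT y|M. (g y)\<^sup>2) \<le> (LINT y|M. C\<^sub>p * t * (\<bar>f y\<bar> * (1 - indicator \<Omega> y) + (\<Sum>s\<in>F. \<bar>av s\<bar> * indicator (cube s) y)))"
      proof (rule integral_mono_AE)
        show "integrable M (\<lambda>y. (g y)\<^sup>2)" using sqintD(2)[OF sq_g] .
        show "integrable M (\<lambda>y. C\<^sub>p * t * (\<bar>f y\<bar> * (1 - indicator \<Omega> y) + (\<Sum>s\<in>F. \<bar>av s\<bar> * indicator (cube s) y)))"
          using i0 i1 by auto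
        show "AE y in M. (g y)\<^sup>2 \<le> C\<^sub>p * t * (\<bar>f y\<bar> * (1 - indicator \<Omega> y) + (\<Sum>s\<in>F. \<bar>av s\<bar> * indicator (cube s) y))"
          using AEg
        proof eventually_elim
          case (elim y)
          have "\<bar>g y\<bar> \<le> \<bar>f y * (1 - indicator \<Omega> y)\<bar> + \<bar>\<Sum>s\<in>F. av s * indicator (cube s) y\<bar>"
            unfolding g_def by (rule abs_triangle_ineq)
          also have "\<dots> \<le> \<bar>f y\<bar> * (1 - indicator \<Omega> y) + (\<Sum>s\<in>F. \<bar>av s * indicator (cube s) y\<bar>)"
            by (intro add_mono sum_abs) (simp add: abs_mult indicator_def)
          also have "(\<Sum>s\<in>F. \<bar>av s * indicator (cube s) y\<bar>) = (\<Sum>s\<in>F. \<bar>av s\<bar> * indicator (cube s) y)"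
            by (simp add: abs_mult)
          finally have "\<bar>g y\<bar> * \<bar>g y\<bar> \<le> (C\<^sub>p * t) * (\<bar>f y\<bar> * (1 - indicator \<Omega> y) + (\<Sum>s\<in>F. \<bar>av s\<bar> * indicator (cube s) y))"
            using elim by (intro mult_mono) auto
          then show ?case by (simp add: power2_eq_square)
        qed
      qed
      also have "\<dots> = C\<^sub>p * t * ((LINT y|M. \<bar>f y\<bar> * (1 - indicator \<Omega> y)) + (\<Sum>s\<in>F. \<bar>av s\<bar> * m s))"
      proof -
        have "(LINT y|M. (\<Sum>s\<in>F. \<bar>av s\<bar> * indicator (cube s) y)) = (\<Sum>s\<in>F. \<bar>av s\<bar> * m s)"
          using F cf FS unfolding m_def
          by (subst Bochner_Integration.integral_sum)
             (auto intro!: integrable_mult_right integrable_real_indicator sum.cong simp: fmeasurableD2 less_top[symmetric])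
        then show ?thesis using i0 i1 by simp
      qed
      also have "\<dots> \<le> C\<^sub>p * t * ((LINT y|M. \<bar>f y\<bar> * (1 - indicator \<Omega> y)) + (\<Sum>s\<in>F. I s))"
        using av_le FS Cp_ge_1 t by (intro mult_left_mono add_left_mono sum_mono) auto
      also have "\<dots> \<le> C\<^sub>p * t * nf" using sumI'[OF F(2,1)] Cp_ge_1 t by (intro mult_left_mono) auto
      finally show ?thesis .
    qed
    have h_int: "(LINT y|M. (h y)\<^sup>2) < e'"
    proof -
      have "(LINT y|M. (h y)\<^sup>2) = (LINT x|M. (f x)\<^sup>2 * indicator ((\<Union>s\<in>S. cube s) - (\<Union>s\<in>F. cube s)) x)"
        unfolding h_def \<Omega>_def \<Omega>F_def by (intro Bochner_Integration.integral_cong) (auto simp: indicator_def)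
      then show ?thesis using F(3) by simp
    qed
    define Es where "Es = (\<Union>s\<in>F. B (snd s) (\<alpha> * rad (fst s)))"
    have [measurable]: "Es \<in> sets M" unfolding Es_def using F FS SN Net_space by (intro sets.finite_UN) auto
    define \<psi> where "\<psi> s x = (\<alpha> * rad (fst s) / \<rho> (snd s) x) powr \<eta> / V (snd s) (\<rho> (snd s) x)" for s x
    define nb where "nb s = (LINT y|M. \<bar>b s y\<bar>)" for s
    \<comment> \<open>A measurable majorant, off \<open>Es\<close>, of the images of the bad parts.
      It can be integrated by \<open>annular_bound\<close> with \<open>h = 1\<close>, which replaces
      Fubini's theorem for the kernel.\<close>
    define U where "U x = (\<Sum>s\<in>F. ennreal (nb s) * (ennreal (\<psi> s x) * 1 * indicator (space M - B (snd s) (\<alpha> * rad (fst s))) x))" for x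
    have psi_m [measurable]: "\<psi> s \<in> borel_measurable M" if "s \<in> S" for s
      unfolding \<psi>_def[abs_def] using SN[OF that] Net_space by (intro annulus_weight_measurable) auto
    have U_m [measurable]: "U \<in> borel_measurable M"
      unfolding U_def[abs_def] using FS psi_m SN Net_space by (intro borel_measurable_sum) auto
    have b_int: "integrable M (b s)" "(LINT y|M. b s y) = 0" "nb s \<le> 2 * I s" if s: "s \<in> F" for s
    proof -
      have k: "integrable M (\<lambda>y. - av s * indicator (cube s) y)"
        using cf[OF FS[OF s]] by (intro integrable_mult_right integrable_real_indicator) (auto simp: fmeasurableD2 less_top[symmetric])
      show 1: "integrable M (b s)" unfolding b_def[abs_def] using fint[OF FS[OF s]] k by (rule Bochner_Integration.integrable_add)
      have "(LINT y|M. b s y) = (LINT y|M. f y * indicator (cube s) y) + (LINT y|M. - av s * indicator (cube s) y)"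
        unfolding b_def using fint[OF FS[OF s]] k by (rule Bochner_Integration.integral_add)
      also have "\<dots> = 0" unfolding av_def using m_pos[OF FS[OF s]] cm[OF FS[OF s]] by (simp add: m_def)
      finally show "(LINT y|M. b s y) = 0" .
      have k': "integrable M (\<lambda>y. \<bar>av s\<bar> * indicator (cube s) y)"
        using cf[OF FS[OF s]] by (intro integrable_mult_right integrable_real_indicator) (auto simp: fmeasurableD2 less_top[symmetric])
      have "nb s \<le> (LINT y|M. \<bar>f y\<bar> * indicator (cube s) y + \<bar>av s\<bar> * indicator (cube s) y)"
        unfolding nb_def
      proof (rule integral_mono)
        show "integrable M (\<lambda>y. \<bar>b s y\<bar>)" using 1 by auto
        show "integrable M (\<lambda>y. \<bar>f y\<bar> * indicator (cube s) y + \<bar>av s\<bar> * indicator (cube s) y)"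
          using I_int[OF FS[OF s]] k' by (rule Bochner_Integration.integrable_add)
        show "\<bar>b s y\<bar> \<le> \<bar>f y\<bar> * indicator (cube s) y + \<bar>av s\<bar> * indicator (cube s) y" for y
          unfolding b_def by (auto simp: indicator_def)
      qed
      also have "\<dots> = I s + \<bar>av s\<bar> * m s"
        using I_int[OF FS[OF s]] k' cm[OF FS[OF s]] unfolding I_eq m_def by simp
      also have "\<dots> \<le> 2 * I s" using av_le[OF FS[OF s]] by simp
      finally show "nb s \<le> 2 * I s" .
    qed
    have bad_pw: "AE x in M. x \<notin> Es \<longrightarrow> ennreal \<bar>\<Sum>s\<in>F. T (b s) x\<bar> \<le> U x"
    proof -
      have "AE x in M. \<forall>s\<in>F. x \<notin> B (snd s) (\<alpha> * rad (fst s)) \<longrightarrow> \<bar>T (b s) x\<bar> \<le> \<psi> s x * nb s"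
        unfolding \<psi>_def nb_def
      proof (intro AE_finite_allI F(2) T_cancellation_bound sq_b b_int rad_pos)
        fix s y assume s: "s \<in> F" and y: "y \<in> space M" "y \<notin> B (snd s) (3 * A\<^sup>2 * rad (fst s))"
        then have "y \<notin> cube s" using Q_sub_ball[OF SN[OF FS[OF s]]] by auto
        then show "b s y = 0" unfolding b_def by simp
      qed (use FX in simp_all)
      then show ?thesis using AE_space
      proof eventually_elim
        case (elim x)
        show ?case
        proof
          assume x: "x \<notin> Es"
          have "\<bar>\<Sum>s\<in>F. T (b s) x\<bar> \<le> (\<Sum>s\<in>F. \<bar>T (b s) x\<bar>)" by (rule sum_abs)
          also have "\<dots> \<le> (\<Sum>s\<in>F. nb s * \<psi> s x)" using elim x unfolding Es_def by (intro sum_mono) (auto simp: mult.commute)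
          finally have "ennreal \<bar>\<Sum>s\<in>F. T (b s) x\<bar> \<le> ennreal (\<Sum>s\<in>F. nb s * \<psi> s x)" by (rule ennreal_leI)
          also have "\<dots> = (\<Sum>s\<in>F. ennreal (nb s * \<psi> s x))"
            by (intro sum_ennreal[symmetric] mult_nonneg_nonneg) (auto simp: nb_def \<psi>_def V_def)
          also have "\<dots> = U x" unfolding U_def
            using x elim(2) unfolding Es_def
            by (intro sum.cong refl, subst ennreal_mult) (auto simp: nb_def \<psi>_def V_def)
          finally show "ennreal \<bar>\<Sum>s\<in>F. T (b s) x\<bar> \<le> U x" .
        qed
      qed
    qed
    have U_int: "(\<integral>\<^sup>+x. U x \<partial>M) \<le> ennreal (2 * C\<^sub>\<eta> * nf)"
    proof -
      have "(\<integral>\<^sup>+x. U x \<partial>M) = (\<Sum>s\<in>F. ennreal (nb s) * (\<integral>\<^sup>+x. ennreal (\<psi> s x) * 1 * indicator (space M - B (snd s) (\<alpha> * rad (fst s))) x \<partial>M))"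
        unfolding U_def using FS psi_m SN Net_space
        by (subst nn_integral_sum) (auto intro!: sum.cong nn_integral_cmult)
      also have "\<dots> \<le> (\<Sum>s\<in>F. ennreal (2 * I s) * ennreal (C\<^sub>\<eta> * 1))"
        unfolding \<psi>_def C\<^sub>\<eta>_def
      proof (intro sum_mono mult_mono annular_bound ennreal_leI b_int)
        fix s t' assume "s \<in> F"
        then show "(\<integral>\<^sup>+y\<in>B (snd s) t'. 1 \<partial>M) \<le> ennreal (1 * V (snd s) t')"
          using FX[of s] emeasure_B[of "snd s" t'] B_sets[of "snd s" t'] by simp
      qed (use FX eta_pos alpha_ge(3) rad_pos in \<open>simp_all\<close>)
      also have "\<dots> = (\<Sum>s\<in>F. ennreal (2 * I s * C\<^sub>\<eta>))" using I0 C_eta_nonneg by (simp add: ennreal_mult)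
      also have "\<dots> = ennreal (\<Sum>s\<in>F. 2 * I s * C\<^sub>\<eta>)" using I0 C_eta_nonneg by (intro sum_ennreal) auto
      also have "(\<Sum>s\<in>F. 2 * I s * C\<^sub>\<eta>) = 2 * C\<^sub>\<eta> * (\<Sum>s\<in>F. I s)" by (simp add: sum_distrib_left sum_distrib_right mult_ac)
      also have "ennreal (2 * C\<^sub>\<eta> * (\<Sum>s\<in>F. I s)) \<le> ennreal (2 * C\<^sub>\<eta> * nf)"
        using sumI[OF F(2,1)] C_eta_nonneg by (intro ennreal_leI mult_left_mono) auto
      finally show ?thesis .
    qed
    have [measurable]: "T g \<in> borel_measurable M" "T h \<in> borel_measurable M" "T f \<in> borel_measurable M"
      using T_sqint[OF sq_g] T_sqint[OF sq_h] T_sqint[OF f(1)] sqintD by auto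
    define G1 where "G1 = {x \<in> space M. t / 3 \<le> \<bar>T g x\<bar>}"
    define G2 where "G2 = {x \<in> space M. t / 3 \<le> \<bar>T h x\<bar>}"
    define G3 where "G3 = {x \<in> space M. 1 \<le> ennreal (3 / t) * U x}"
    have [measurable]: "G1 \<in> sets M" "G2 \<in> sets M" "G3 \<in> sets M" unfolding G1_def G2_def G3_def by measurable
    have "emeasure M {x \<in> space M. t < \<bar>T f x\<bar>} \<le> emeasure M (G1 \<union> G2 \<union> Es \<union> G3)"
    proof (rule emeasure_mono_AE)
      show "AE x in M. x \<in> {x \<in> space M. t < \<bar>T f x\<bar>} \<longrightarrow> x \<in> G1 \<union> G2 \<union> Es \<union> G3"
        using T_split bad_pw AE_space
      proof eventually_elim
        case (elim x)
        show ?case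
        proof
          assume "x \<in> {x \<in> space M. t < \<bar>T f x\<bar>}"
          then have "t < \<bar>T g x + T h x + (\<Sum>s\<in>F. T (b s) x)\<bar>" using elim(1) by simp
          also have "\<dots> \<le> \<bar>T g x\<bar> + \<bar>T h x\<bar> + \<bar>\<Sum>s\<in>F. T (b s) x\<bar>" by linarith
          finally consider "t / 3 \<le> \<bar>T g x\<bar>" | "t / 3 \<le> \<bar>T h x\<bar>" | "t / 3 \<le> \<bar>\<Sum>s\<in>F. T (b s) x\<bar>" by linarith
          then show "x \<in> G1 \<union> G2 \<union> Es \<union> G3"
          proof cases
            case 3
            show ?thesis
            proof (cases "x \<in> Es")
              case False
              have "1 = ennreal (3 / t * (t / 3))" using t by simp
              also have "\<dots> \<le> ennreal (3 / t * \<bar>\<Sum>s\<in>F. T (b s) x\<bar>)" using 3 t by (intro ennreal_leI mult_left_mono) auto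
              also have "\<dots> = ennreal (3 / t) * ennreal \<bar>\<Sum>s\<in>F. T (b s) x\<bar>" using t by (intro ennreal_mult) auto
              also have "\<dots> \<le> ennreal (3 / t) * U x" using elim(2) False by (intro mult_left_mono) auto
              finally show ?thesis using elim(3) unfolding G3_def by auto
            qed auto
          qed (use elim(3) in \<open>auto simp: G1_def G2_def\<close>)
        qed
      qed
    qed measurable
    also have "\<dots> \<le> emeasure M G1 + emeasure M G2 + emeasure M Es + emeasure M G3"
      by (intro order_trans[OF emeasure_subadditive] add_mono order_refl; measurable)
    also have "\<dots> \<le> ennreal (9 * b\<^sub>T * C\<^sub>p / t * nf) + ennreal e + ennreal (Dil (4 * A\<^sup>2 * \<alpha>) / t * nf) + ennreal (6 * C\<^sub>\<eta> / t * nf)"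
    proof (intro add_mono)
      have "emeasure M G1 \<le> ennreal (b\<^sub>T * (LINT x|M. (g x)\<^sup>2) / (t / 3)\<^sup>2)"
        unfolding G1_def using t by (intro T_chebyshev sq_g) auto
      also have "\<dots> \<le> ennreal (b\<^sub>T * (C\<^sub>p * t * nf) / (t / 3)\<^sup>2)"
        using g_int bT_nonneg by (intro ennreal_leI divide_right_mono mult_left_mono) auto
      also have "b\<^sub>T * (C\<^sub>p * t * nf) / (t / 3)\<^sup>2 = 9 * b\<^sub>T * C\<^sub>p / t * nf" using t by (simp add: field_simps power2_eq_square)
      finally show "emeasure M G1 \<le> ennreal (9 * b\<^sub>T * C\<^sub>p / t * nf)" .
      have "emeasure M G2 \<le> ennreal (b\<^sub>T * (LINT x|M. (h x)\<^sup>2) / (t / 3)\<^sup>2)"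
        unfolding G2_def using t by (intro T_chebyshev sq_h) auto
      also have "\<dots> \<le> ennreal ((b\<^sub>T + 1) * e' / (t / 3)\<^sup>2)"
        using h_int bT_nonneg by (intro ennreal_leI divide_right_mono mult_mono) auto
      also have "(b\<^sub>T + 1) * e' / (t / 3)\<^sup>2 = e"
      proof -
        have "q * (e * t\<^sup>2 / (9 * q)) / (t / 3)\<^sup>2 = e" if "q \<noteq> 0" for q :: real
          using t that by (simp add: power_divide)
        from this[of "b\<^sub>T + 1"] show ?thesis unfolding e'_def using bT_nonneg by argo
      qed
      finally show "emeasure M G2 \<le> ennreal e" .
      have "emeasure M Es \<le> (\<Sum>s\<in>F. emeasure M (B (snd s) (\<alpha> * rad (fst s))))"
        unfolding Es_def by (intro emeasure_subadditive_finite F(2) image_subsetI B_sets FX)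
      also have "\<dots> = (\<Sum>s\<in>F. ennreal (V (snd s) (\<alpha> * rad (fst s))))"
        by (intro sum.cong refl emeasure_B FX)
      also have "\<dots> = ennreal (\<Sum>s\<in>F. V (snd s) (\<alpha> * rad (fst s)))" by (intro sum_ennreal) (simp add: V_def)
      also have "\<dots> \<le> ennreal (\<Sum>s\<in>F. Dil (4 * A\<^sup>2 * \<alpha>) / t * I s)"
      proof (intro ennreal_leI sum_mono)
        fix s assume s: "s \<in> F"
        have "V (snd s) (\<alpha> * rad (fst s)) \<le> Dil (4 * A\<^sup>2 * \<alpha>) * m s" unfolding m_def by (intro V_le_Q SN FS s)
        also have "\<dots> \<le> Dil (4 * A\<^sup>2 * \<alpha>) * (I s / t)"
          using I_low[OF FS[OF s]] t Dil_pos[of "4 * A\<^sup>2 * \<alpha>"] by (intro mult_left_mono) (auto simp: field_simps)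
        finally show "V (snd s) (\<alpha> * rad (fst s)) \<le> Dil (4 * A\<^sup>2 * \<alpha>) / t * I s" by simp
      qed
      also have "\<dots> \<le> ennreal (Dil (4 * A\<^sup>2 * \<alpha>) / t * nf)"
        unfolding sum_distrib_left[symmetric]
        using sumI[OF F(2,1)] t Dil_pos[of "4 * A\<^sup>2 * \<alpha>"] by (intro ennreal_leI mult_left_mono) auto
      finally show "emeasure M Es \<le> ennreal (Dil (4 * A\<^sup>2 * \<alpha>) / t * nf)" .
      have "emeasure M G3 \<le> ennreal (3 / t) * (\<integral>\<^sup>+x. U x * indicator (space M) x \<partial>M)"
        unfolding G3_def by (intro nn_integral_Markov_inequality) measurable
      also have "(\<integral>\<^sup>+x. U x * indicator (space M) x \<partial>M) = (\<integral>\<^sup>+x. U x \<partial>M)" by (intro nn_integral_cong) auto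
      also have "ennreal (3 / t) * \<dots> \<le> ennreal (3 / t) * ennreal (2 * C\<^sub>\<eta> * nf)" using U_int by (intro mult_left_mono) auto
      also have "\<dots> = ennreal (3 / t * (2 * C\<^sub>\<eta> * nf))" using t C_eta_nonneg nf0 by (intro ennreal_mult[symmetric]) auto
      also have "3 / t * (2 * C\<^sub>\<eta> * nf) = 6 * C\<^sub>\<eta> / t * nf" by simp
      finally show "emeasure M G3 \<le> ennreal (6 * C\<^sub>\<eta> / t * nf)" .
    qed
    also have "\<dots> = ennreal (C\<^sub>w / t * nf) + ennreal e"
    proof -
      have p: "0 \<le> 9 * b\<^sub>T * C\<^sub>p / t * nf" "0 \<le> Dil (4 * A\<^sup>2 * \<alpha>) / t * nf" "0 \<le> 6 * C\<^sub>\<eta> / t * nf"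
        using t nf0 bT_nonneg Cp_ge_1 C_eta_nonneg Dil_pos[of "4 * A\<^sup>2 * \<alpha>"] by auto
      have "C\<^sub>w / t * nf = 9 * b\<^sub>T * C\<^sub>p / t * nf + Dil (4 * A\<^sup>2 * \<alpha>) / t * nf + 6 * C\<^sub>\<eta> / t * nf"
        unfolding C\<^sub>w_def by (simp add: distrib_right add_divide_distrib)
      then show ?thesis using p e by (simp add: ac_simps)
    qed
    finally show ?thesis .
  qed
  show ?thesis unfolding nf_def[symmetric]
    by (rule ennreal_le_epsilon) (rule main)
qed

end

context cz_space
begin

section \<open>Sparse domination\<close>

text \<open>\<open>L\<^sub>1\<close>, \<open>L\<^sub>2\<close> and \<open>L\<^sub>3\<close> are thresholds that make exceptional sets so small that each takes up at most a
  quarter of a cube, \<open>C\<^sub>t\<close> is what \<open>weak_type\<close> requires on the cubes of generation \<open>0\<close>.\<close>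

definition \<kappa> :: real where "\<kappa> = Dil (4 * A\<^sup>2 * \<alpha>)"
definition C\<^sub>t :: real where "C\<^sub>t = Dil (4 * A\<^sup>2 * (A * (A * (3 * A\<^sup>2 + \<alpha>) + \<alpha>)))"
definition L\<^sub>1 :: real where "L\<^sub>1 = C\<^sub>t + 16 * C\<^sub>w * \<kappa> * C\<^sub>p"
definition L\<^sub>2 :: real where "L\<^sub>2 = 4 * Dil (3 * A\<^sup>2) * \<kappa>"
definition L\<^sub>3 :: real where "L\<^sub>3 = C\<^sub>t + 4 * C\<^sub>w * \<kappa>"
text \<open>\<open>C\<^sub>H * t\<close> bounds averages over balls about the centre of a stopping
  cube. The first summand is for radii at which an ancestor passed its test, with
  \<open>64 * A ^ 6 = 4 * A\<^sup>2 / \<delta>\<close> from one generation of loss; the second is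
  for balls comparable to or larger than \<open>bd s\<close>.\<close>

definition C\<^sub>H :: real where "C\<^sub>H = L\<^sub>2 * Dil (64 * A ^ 6) + Dil (2 * A)"
text \<open>\<open>L\<^sub>1 + L\<^sub>3 * C\<^sub>H\<close> comes from the point at which both
  functions are small, \<open>2 * C\<^sub>\<eta> * C\<^sub>H\<close> from the oscillation away from
  it.\<close>

definition C\<^sub>S :: real where "C\<^sub>S = L\<^sub>1 + L\<^sub>3 * C\<^sub>H + 2 * C\<^sub>\<eta> * C\<^sub>H"

lemma kappa_ge_1: "1 \<le> \<kappa>" unfolding \<kappa>_def by (rule Dil_ge_1)
lemma Ct_ge_1: "1 \<le> C\<^sub>t" unfolding C\<^sub>t_def by (rule Dil_ge_1)

lemma lambda1: "C\<^sub>t \<le> L\<^sub>1" "0 < L\<^sub>1" "C\<^sub>w * \<kappa> / L\<^sub>1 \<le> 1 / (16 * C\<^sub>p)"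
proof -
  have n: "0 \<le> 16 * C\<^sub>w * \<kappa> * C\<^sub>p" using Cw_nonneg kappa_ge_1 Cp_ge_1 by simp
  then show 1: "C\<^sub>t \<le> L\<^sub>1" and 2: "0 < L\<^sub>1" unfolding L\<^sub>1_def using Ct_ge_1 by linarith+
  have "C\<^sub>w * \<kappa> * (16 * C\<^sub>p) \<le> L\<^sub>1" unfolding L\<^sub>1_def using Ct_ge_1 by (simp add: mult_ac)
  then show "C\<^sub>w * \<kappa> / L\<^sub>1 \<le> 1 / (16 * C\<^sub>p)" using 2 Cp_ge_1 by (simp add: field_simps)
qed

lemma lambda3: "C\<^sub>t \<le> L\<^sub>3" "0 < L\<^sub>3" "C\<^sub>w * \<kappa> / L\<^sub>3 \<le> 1 / 4"
proof -
  have n: "0 \<le> 4 * C\<^sub>w * \<kappa>" using Cw_nonneg kappa_ge_1 by simp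
  then show 1: "C\<^sub>t \<le> L\<^sub>3" and 2: "0 < L\<^sub>3" unfolding L\<^sub>3_def using Ct_ge_1 by linarith+
  have "C\<^sub>w * \<kappa> * 4 \<le> L\<^sub>3" unfolding L\<^sub>3_def using Ct_ge_1 by (simp add: mult_ac)
  then show "C\<^sub>w * \<kappa> / L\<^sub>3 \<le> 1 / 4" using 2 by (simp add: field_simps)
qed

lemma lambda2: "1 \<le> L\<^sub>2"
  unfolding L\<^sub>2_def using mult_mono[of 1 "4 * Dil (3 * A\<^sup>2)" 1 \<kappa>] Dil_ge_1[of "3 * A\<^sup>2"] kappa_ge_1 by simp

lemma CH_pos: "0 < C\<^sub>H"
  unfolding C\<^sub>H_def using lambda2 Dil_pos[of "64 * A ^ 6"] Dil_pos[of "2 * A"] by (intro add_nonneg_pos) auto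

lemma CS_nonneg: "0 \<le> C\<^sub>S"
  unfolding C\<^sub>S_def using lambda1(2) lambda3(2) CH_pos C_eta_nonneg by (intro add_nonneg_nonneg mult_nonneg_nonneg) auto

end

context cz_dyadic
begin

abbreviation bd :: "nat \<times> 'a \<Rightarrow> 'a set" where "bd s \<equiv> B (snd s) (\<alpha> * rad (fst s))"

definition loc :: "('a \<Rightarrow> real) \<Rightarrow> nat \<times> 'a \<Rightarrow> 'a \<Rightarrow> real" where
  "loc f s = (\<lambda>y. f y * indicator (bd s) y)"

definition avb :: "('a \<Rightarrow> real) \<Rightarrow> nat \<times> 'a \<Rightarrow> real" where
  "avb f s = (LINT y|M. \<bar>f y\<bar> * indicator (bd s) y) / V (snd s) (\<alpha> * rad (fst s))"

definition is_cube :: "nat \<times> 'a \<Rightarrow> bool" where "is_cube s \<longleftrightarrow> snd s \<in> Net (fst s)"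

lemma cubeD: assumes "is_cube s"
  shows "snd s \<in> Net (fst s)" "snd s \<in> space M" "cube s \<in> sets M" "cube s \<in> fmeasurable M"
    "0 < measure M (cube s)" "bd s \<in> sets M" "bd s \<in> fmeasurable M"
    "0 < V (snd s) (\<alpha> * rad (fst s))" "cube s \<subseteq> bd s"
    "V (snd s) (\<alpha> * rad (fst s)) \<le> \<kappa> * measure M (cube s)"
proof -
  show a: "snd s \<in> Net (fst s)" using assms unfolding is_cube_def .
  then show x: "snd s \<in> space M" by (rule Net_space)
  show "cube s \<in> sets M" "cube s \<in> fmeasurable M" "0 < measure M (cube s)"
    using a Q_measurable Q_pos by auto
  show "bd s \<in> sets M" "bd s \<in> fmeasurable M" using x by auto
  show "0 < V (snd s) (\<alpha> * rad (fst s))" using x alpha_ge(3) rad_pos by (intro V_pos) auto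
  have "3 * A\<^sup>2 * rad (fst s) \<le> \<alpha> * rad (fst s)" using alpha_gt rad_pos[of "fst s"] by (intro mult_right_mono) auto
  then show "cube s \<subseteq> bd s" using Q_sub_ball[OF a] B_mono by blast
  show "V (snd s) (\<alpha> * rad (fst s)) \<le> \<kappa> * measure M (cube s)" unfolding \<kappa>_def by (rule V_le_Q[OF a])
qed

lemma avb_nonneg: "0 \<le> avb f s"
  unfolding avb_def V_def by (intro divide_nonneg_nonneg integral_nonneg_AE) auto

lemma loc_sqint: "sqint M f \<Longrightarrow> is_cube s \<Longrightarrow> sqint M (loc f s)"
  unfolding loc_def by (intro sqint_indicator cubeD)

lemma loc_integrable: "sqint M f \<Longrightarrow> is_cube s \<Longrightarrow> integrable M (loc f s)"
  unfolding loc_def by (intro sqint_integrable_on cubeD)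

lemma loc_abs: "\<bar>loc f s y\<bar> = \<bar>f y\<bar> * indicator (bd s) y"
  unfolding loc_def by (simp add: abs_mult)

lemma loc_norm: "is_cube s \<Longrightarrow> (LINT y|M. \<bar>loc f s y\<bar>) = avb f s * V (snd s) (\<alpha> * rad (fst s))"
  unfolding avb_def loc_abs using cubeD(8)[of s] by simp

text \<open>\<open>weak_type\<close> asks for small averages on the cubes of generation
  \<open>0\<close>. Only those that meet \<open>bd s\<close> count, and the volume of
  \<open>bd s\<close> is at most \<open>C\<^sub>t\<close> times the measure of each of them, so
  \<open>u \<ge> C\<^sub>t\<close> suffices. The level may be any positive \<open>t\<close> above
  the average, since the average itself may vanish.\<close>

lemma local_weak_type:
  assumes f: "sqint M f" and s: "is_cube s" and t: "0 < t" "avb f s \<le> t" and u: "C\<^sub>t \<le> u"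
  shows "measure M {x \<in> space M. u * t < \<bar>T (loc f s) x\<bar>} \<le> C\<^sub>w * \<kappa> / u * measure M (cube s)"
proof -
  have u0: "0 < u" using u Ct_ge_1 by linarith
  have top: "(LINT y:Q 0 b|M. \<bar>loc f s y\<bar>) \<le> u * t * measure M (Q 0 b)" if b: "b \<in> Net 0" for b
  proof (cases "Q 0 b \<inter> bd s = {}")
    case True
    then have "(LINT y:Q 0 b|M. \<bar>loc f s y\<bar>) = (LINT y|M. 0)"
      unfolding set_lebesgue_integral_def loc_abs
      by (intro Bochner_Integration.integral_cong) (auto simp: indicator_def)
    then show ?thesis using u0 t by simp
  next
    case False
    then obtain y where y: "y \<in> Q 0 b" "y \<in> bd s" by auto
    have bX: "b \<in> space M" using b by (rule Net_space)
    have r0: "rad (fst s) \<le> rad 0" by (rule rad_antimono) simp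
    have by1: "\<rho> b y < 3 * A\<^sup>2 * rad 0" using Q_sub_ball[OF b] y(1) by (auto simp: mem_B)
    have yX: "y \<in> space M" and sy: "\<rho> (snd s) y < \<alpha> * rad (fst s)" using y(2) by (auto simp: mem_B)
    have ar: "\<alpha> * rad (fst s) \<le> \<alpha> * rad 0" using r0 alpha_ge(3) by simp
    have "\<rho> b (snd s) \<le> A * (\<rho> b y + \<rho> y (snd s))" using rho_tri bX yX cubeD(2)[OF s] by blast
    also have "\<dots> \<le> A * (3 * A\<^sup>2 * rad 0 + \<alpha> * rad 0)"
      using by1 sy ar rho_sym[of y "snd s"] yX cubeD(2)[OF s] A_pos by (intro mult_left_mono add_mono) auto
    finally have bz: "\<rho> b (snd s) \<le> A * (3 * A\<^sup>2 * rad 0 + \<alpha> * rad 0)" .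
    have "A * (\<rho> b (snd s) + \<alpha> * rad (fst s)) \<le> A * (A * (3 * A\<^sup>2 * rad 0 + \<alpha> * rad 0) + \<alpha> * rad 0)"
      by (rule mult_left_mono[OF add_mono[OF bz ar] less_imp_le[OF A_pos]])
    also have "\<dots> = (A * (A * (3 * A\<^sup>2 + \<alpha>) + \<alpha>)) * rad 0" by (simp add: algebra_simps)
    finally have sub: "bd s \<subseteq> B b ((A * (A * (3 * A\<^sup>2 + \<alpha>) + \<alpha>)) * rad 0)" using bX cubeD(2)[OF s] by (intro B_tri) auto
    have "V (snd s) (\<alpha> * rad (fst s)) \<le> V b ((A * (A * (3 * A\<^sup>2 + \<alpha>) + \<alpha>)) * rad 0)"
      unfolding V_def using sub bX cubeD(6)[OF s] by (intro measure_mono_fmeasurable) auto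
    also have "\<dots> \<le> C\<^sub>t * measure M (Q 0 b)" unfolding C\<^sub>t_def by (rule V_le_Q[OF b])
    also have "\<dots> \<le> u * measure M (Q 0 b)" using u by (intro mult_right_mono) auto
    finally have Vb: "V (snd s) (\<alpha> * rad (fst s)) \<le> u * measure M (Q 0 b)" .
    have "(LINT y:Q 0 b|M. \<bar>loc f s y\<bar>) \<le> (LINT y|M. \<bar>loc f s y\<bar>)"
      unfolding set_lebesgue_integral_def using loc_integrable[OF f s] Q_measurable[OF b]
      by (intro integral_mono integrable_mult_indicator integrable_abs) (auto simp: indicator_def)
    also have "\<dots> \<le> t * V (snd s) (\<alpha> * rad (fst s))"
      unfolding loc_norm[OF s] using t cubeD(8)[OF s] by (intro mult_right_mono) auto
    also have "\<dots> \<le> t * (u * measure M (Q 0 b))" using Vb t by (intro mult_left_mono) auto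
    finally show ?thesis by (simp add: mult_ac)
  qed
  have "emeasure M {x \<in> space M. u * t < \<bar>T (loc f s) x\<bar>} \<le> ennreal (C\<^sub>w / (u * t) * (LINT y|M. \<bar>loc f s y\<bar>))"
    using u0 t(1) by (intro weak_type loc_sqint loc_integrable f s top) auto
  also have "\<dots> \<le> ennreal (C\<^sub>w * \<kappa> / u * measure M (cube s))"
  proof (rule ennreal_leI)
    have "C\<^sub>w / (u * t) * (LINT y|M. \<bar>loc f s y\<bar>) \<le> C\<^sub>w / (u * t) * (t * V (snd s) (\<alpha> * rad (fst s)))"
      unfolding loc_norm[OF s] using t u0 Cw_nonneg cubeD(8)[OF s] by (intro mult_left_mono mult_right_mono) auto
    also have "\<dots> = C\<^sub>w / u * V (snd s) (\<alpha> * rad (fst s))" using t by simp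
    also have "\<dots> \<le> C\<^sub>w / u * (\<kappa> * measure M (cube s))"
      using cubeD(10)[OF s] Cw_nonneg u0 by (intro mult_left_mono) auto
    finally show "C\<^sub>w / (u * t) * (LINT y|M. \<bar>loc f s y\<bar>) \<le> C\<^sub>w * \<kappa> / u * measure M (cube s)" by simp
  qed
  finally show ?thesis using Cw_nonneg kappa_ge_1 u0 by (simp add: measure_def enn2real_leI)
qed

lemma T_zero:
  assumes "sqint M u" "AE x in M. u x = 0" shows "AE x in M. T u x = 0"
proof -
  have "(LINT x|M. (u x)\<^sup>2) = 0" using assms(2) by (intro integral_eq_zero_AE) auto
  then have "(LINT x|M. (T u x)\<^sup>2) \<le> 0" using T_bounded[OF assms(1)] by simp
  moreover have "0 \<le> (LINT x|M. (T u x)\<^sup>2)" by simp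
  ultimately have "(LINT x|M. (T u x)\<^sup>2) = 0" by linarith
  then have "AE x in M. (T u x)\<^sup>2 = 0"
    using integral_nonneg_eq_0_iff_AE[OF sqintD(2)[OF T_sqint[OF assms(1)]]] by simp
  then show ?thesis by eventually_elim simp
qed

lemma child_dist:
  assumes "is_cube s" "is_cube p" "cube p \<subseteq> cube s"
  shows "\<rho> (snd s) (snd p) < 3 * A\<^sup>2 * rad (fst s)"
proof -
  have "snd p \<in> cube s" using Net_in_Q[OF cubeD(1)[OF assms(2)]] assms(3) by auto
  then show ?thesis using Q_sub_ball[OF cubeD(1)[OF assms(1)]] by (auto simp: mem_B)
qed

text \<open>The later generation gains a factor with \<open>A * \<delta> \<le> 1 / 16\<close>, and
  \<open>3 * A ^ 3 \<le> \<alpha> / 2\<close> covers the distance of the centres.\<close>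

lemma bd_mono:
  assumes "is_cube s" "is_cube p" "cube p \<subseteq> cube s" "fst s < fst p"
  shows "bd p \<subseteq> bd s"
proof (rule B_tri[OF cubeD(2)[OF assms(1)] cubeD(2)[OF assms(2)]])
  have ch: "\<alpha> * rad (fst p) \<le> \<alpha> * (\<delta> * rad (fst s))"
    using rad_less[OF assms(4)] alpha_ge(3) by (intro mult_left_mono) auto
  have "A * (\<rho> (snd s) (snd p) + \<alpha> * rad (fst p)) \<le> A * (3 * A\<^sup>2 * rad (fst s) + \<alpha> * (\<delta> * rad (fst s)))"
    by (intro mult_left_mono[OF add_mono[OF less_imp_le[OF child_dist[OF assms(1-3)]] ch] less_imp_le[OF A_pos]])
  also have "\<dots> = (3 * A ^ 3 + (A * \<delta>) * \<alpha>) * rad (fst s)" by (simp add: algebra_simps power2_eq_square power3_eq_cube)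
  also have "\<dots> \<le> \<alpha> * rad (fst s)"
  proof (rule mult_right_mono)
    have "(A * \<delta>) * \<alpha> \<le> 1 / 16 * \<alpha>" using delta_A_le[of 1] alpha_ge(3) by (intro mult_right_mono) auto
    then show "3 * A ^ 3 + (A * \<delta>) * \<alpha> \<le> \<alpha>" using alpha_ge(1,3) by linarith
  qed (use rad_pos[of "fst s"] in simp)
  finally show "A * (\<rho> (snd s) (snd p) + \<alpha> * rad (fst p)) \<le> \<alpha> * rad (fst s)" .
qed

text \<open>A cube is bad if either \<open>T (loc f s)\<close> is large on a fixed proportion of it or \<open>\<bar>f\<bar>\<close> has a large average
  over a dilation. Since the parent of a stopping cube \<open>p\<close> is good, some point of \<open>p\<close> has small values of
  both \<open>T (loc f s)\<close> and \<open>T (loc f p)\<close>; the oscillation bound for their difference does the rest.\<close>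

lemma sparse_step:
  assumes f: "sqint M f" and s: "is_cube s"
  shows "\<exists>\<P>. countable \<P> \<and> (\<forall>p\<in>\<P>. is_cube p \<and> fst s < fst p \<and> cube p \<subseteq> cube s)
    \<and> disjoint_family_on cube \<P>
    \<and> (\<forall>F\<subseteq>\<P>. finite F \<longrightarrow> (\<Sum>p\<in>F. measure M (cube p)) \<le> measure M (cube s) / 2)
    \<and> (AE x in M. x \<in> cube s \<and> x \<notin> (\<Union>p\<in>\<P>. cube p) \<longrightarrow> \<bar>T (loc f s) x\<bar> \<le> C\<^sub>S * avb f s)
    \<and> (\<forall>p\<in>\<P>. AE x in M. x \<in> cube p \<longrightarrow> \<bar>T (loc f s) x\<bar> \<le> C\<^sub>S * avb f s + \<bar>T (loc f p) x\<bar>)"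
proof (cases "avb f s = 0")
  case True
  \<comment> \<open>Here there is no positive level to compare with; \<open>loc f s\<close> vanishes
    almost everywhere and no subcubes are selected.\<close>
  have "(LINT y|M. \<bar>loc f s y\<bar>) = 0" using True loc_norm[OF s] by simp
  then have "AE y in M. \<bar>loc f s y\<bar> = 0"
    using integral_nonneg_eq_0_iff_AE[of M "\<lambda>y. \<bar>loc f s y\<bar>"] loc_integrable[OF f s] by auto
  then have "AE y in M. loc f s y = 0" by simp
  then have "AE x in M. T (loc f s) x = 0" by (intro T_zero loc_sqint f s)
  then show ?thesis using True by (intro exI[of _ "{}"]) (auto simp: disjoint_family_on_def)
next
  case False
  define t where "t = avb f s"
  have t: "0 < t" using False avb_nonneg[of f s] unfolding t_def by simp
  \<comment> \<open>From a good parent to its child the proportion of \<open>E\<close> grows at most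
    by \<open>C\<^sub>p\<close>, hence to \<open>\<theta> * C\<^sub>p = 1 / 4\<close>.\<close>
  define \<theta> where "\<theta> = 1 / (4 * C\<^sub>p)"
  have \<theta>: "0 < \<theta>" "\<theta> < 1" "\<theta> * C\<^sub>p = 1 / 4" unfolding \<theta>_def using Cp_ge_1 by (auto simp: field_simps)
  define k z where "k = fst s" and "z = snd s"
  define E where "E = {x \<in> space M. L\<^sub>1 * t < \<bar>T (loc f s) x\<bar>}"
  have [measurable]: "T (loc f s) \<in> borel_measurable M" using T_sqint[OF loc_sqint[OF f s]] sqintD by auto
  have Em [measurable]: "E \<in> sets M" unfolding E_def by measurable
  \<comment> \<open>If \<open>E\<close> fills the fraction \<open>\<theta>\<close> of disjoint
    cubes, their total measure is at most that of \<open>E\<close> over \<open>\<theta>\<close>,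
    hence a quarter of the cube. This is where the \<open>16\<close> in \<open>L\<^sub>1\<close>
    comes from.\<close>
  have Ebd: "measure M E \<le> \<theta> / 4 * measure M (cube s)"
  proof -
    have "measure M E \<le> C\<^sub>w * \<kappa> / L\<^sub>1 * measure M (cube s)"
      unfolding E_def using t lambda1 by (intro local_weak_type f s) (auto simp: t_def)
    also have "\<dots> \<le> 1 / (16 * C\<^sub>p) * measure M (cube s)" using lambda1(3) by (intro mult_right_mono) auto
    finally show ?thesis unfolding \<theta>_def by simp
  qed
  have Efm: "E \<inter> P \<in> fmeasurable M" if "P \<in> fmeasurable M" for P using Em that by (rule fmeasurable_Int_sets)
  have Eem: "E \<in> fmeasurable M"
  proof (rule fmeasurableI[OF Em])
    have l0: "0 < L\<^sub>1 * t" using t lambda1 by simp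
    have "emeasure M E \<le> emeasure M {x \<in> space M. L\<^sub>1 * t \<le> \<bar>T (loc f s) x\<bar>}"
      unfolding E_def by (intro emeasure_mono) (auto, measurable)
    also have "\<dots> \<le> ennreal (b\<^sub>T * (LINT x|M. (loc f s x)\<^sup>2) / (L\<^sub>1 * t)\<^sup>2)"
      by (intro T_chebyshev loc_sqint f s l0)
    finally show "emeasure M E < \<infinity>" by (simp add: le_less_trans)
  qed
  define F where "F = (\<lambda>y. \<bar>loc f s y\<bar>)"
  have Fi: "integrable M F" unfolding F_def using loc_integrable[OF f s] by auto
  have F0: "0 \<le> F y" for y unfolding F_def by simp
  have Fm [measurable]: "F \<in> borel_measurable M" using Fi by auto
  have Fn: "(LINT y|M. F y) = t * V z (\<alpha> * rad k)" unfolding F_def t_def z_def k_def by (rule loc_norm[OF s])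
  have FB: "integrable M (\<lambda>y. F y * indicator U y)" if "U \<in> sets M" for U
    using Fi that by (intro integrable_real_mult_indicator)
  have FB_le: "(LINT y|M. F y * indicator U y) \<le> t * V z (\<alpha> * rad k)" if "U \<in> sets M" for U
    unfolding Fn[symmetric] using Fi FB[OF that] F0 by (intro integral_mono) (auto simp: indicator_def)
  \<comment> \<open>With this dilation, a ball of radius at most \<open>\<alpha> * rad i\<close>
    about a point of a cube of generation \<open>i\<close> lies in the ball on which that cube is
    tested.\<close>
  define \<beta> where "\<beta> = 2 * A * \<alpha>"
  have \<beta>: "0 < \<beta>" "\<alpha> \<le> \<beta>" unfolding \<beta>_def using A_ge_1 alpha_ge(3) by auto
  define Bad1 where "Bad1 j a \<longleftrightarrow> \<theta> * measure M (Q j a) < measure M (E \<inter> Q j a)" for j a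
  define Bad2 where "Bad2 j a \<longleftrightarrow> L\<^sub>2 * t * V a (\<beta> * rad j) < (LINT y|M. F y * indicator (B a (\<beta> * rad j)) y)" for j a
  \<comment> \<open>Only later generations are tested, so \<open>s\<close> itself is never selected;
    that it satisfies both estimates anyway is the case \<open>j = k\<close> of
    \<open>notbad\<close>.\<close>
  define Bad where "Bad j a \<longleftrightarrow> k < j \<and> Q j a \<subseteq> cube s \<and> (Bad1 j a \<or> Bad2 j a)" for j a
  define \<P> where "\<P> = stop Bad"
  have zN: "z \<in> Net k" "z \<in> space M" unfolding z_def k_def using cubeD[OF s] by auto
  have P: "is_cube p" "k < fst p" "cube p \<subseteq> cube s" "Bad1 (fst p) (snd p) \<or> Bad2 (fst p) (snd p)" if "p \<in> \<P>" for p
    using stop_Net[of p Bad] stop_Bad[of p Bad] that unfolding \<P>_def Bad_def is_cube_def by auto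
  have notbad: "\<not> Bad1 j a \<and> \<not> Bad2 j a" if p: "p \<in> \<P>" and j: "k \<le> j" "j < fst p" and a: "a \<in> Net j" "cube p \<subseteq> Q j a" for p j a
  proof -
    have pc: "snd p \<in> Net (fst p)" using P(1)[OF p] cubeD by auto
    have "snd p \<in> Q j a \<inter> cube s" using Net_in_Q[OF pc] P(3)[OF p] a by auto
    then have sub: "Q j a \<subseteq> cube s" using Q_nested[of k j a z] j a zN unfolding z_def k_def by auto
    show ?thesis
    proof (cases "j = k")
      case False
      then show ?thesis using stop_not_Bad[of p Bad j a] p j a sub unfolding \<P>_def Bad_def by auto
    next
      case True
      have az: "a = z" using Q_unique[of a k z "snd p"] True a zN \<open>snd p \<in> Q j a \<inter> cube s\<close> unfolding z_def k_def by auto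
      have "measure M (E \<inter> cube s) \<le> measure M E"
        using Eem Em cubeD(3)[OF s] by (intro measure_mono_fmeasurable) auto
      also have "\<dots> \<le> \<theta> * measure M (cube s)" using Ebd mult_nonneg_nonneg[OF less_imp_le[OF \<theta>(1)] measure_nonneg[of M "cube s"]] by linarith
      finally have 1: "\<not> Bad1 j a" unfolding Bad1_def az True z_def k_def by simp
      have "(LINT y|M. F y * indicator (B z (\<beta> * rad k)) y) \<le> t * V z (\<alpha> * rad k)" using zN by (intro FB_le) auto
      also have "\<dots> \<le> t * V z (\<beta> * rad k)" using t \<beta> rad_pos[of k] zN by (intro mult_left_mono V_mono mult_right_mono) auto
      also have "\<dots> \<le> L\<^sub>2 * (t * V z (\<beta> * rad k))" using mult_right_mono[OF lambda2, of "t * V z (\<beta> * rad k)"] t by (simp add: V_def)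
      finally have 2: "\<not> Bad2 j a" unfolding Bad2_def az True by (simp add: mult_ac)
      show ?thesis using 1 2 by simp
    qed
  qed
  have dis: "disjoint_family_on cube \<P>" unfolding \<P>_def by (rule stop_disjoint)
  have cnt: "countable \<P>" unfolding \<P>_def by (rule stop_countable)
  have small: "(\<Sum>p\<in>G. measure M (cube p)) \<le> measure M (cube s) / 2" if G: "G \<subseteq> \<P>" "finite G" for G
  proof -
    define G1 where "G1 = {p\<in>G. Bad1 (fst p) (snd p)}"
    define G2 where "G2 = {p\<in>G. \<not> Bad1 (fst p) (snd p)}"
    have GP: "p \<in> G1 \<Longrightarrow> p \<in> \<P>" "p \<in> G2 \<Longrightarrow> p \<in> \<P>" for p using G unfolding G1_def G2_def by auto
    have fin: "finite G1" "finite G2" using G unfolding G1_def G2_def by auto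
    have dG: "disjoint_family_on cube G1" "disjoint_family_on cube G2"
      by (rule disjoint_family_on_mono[OF _ dis], use GP in blast)+
    have "(\<Sum>p\<in>G. measure M (cube p)) = (\<Sum>p\<in>G1. measure M (cube p)) + (\<Sum>p\<in>G2. measure M (cube p))"
      unfolding G1_def G2_def using G(2) by (subst sum.union_disjoint[symmetric]) (auto intro!: sum.cong)
    moreover have "(\<Sum>p\<in>G1. measure M (cube p)) \<le> measure M (cube s) / 4"
    proof -
      have "\<theta> * (\<Sum>p\<in>G1. measure M (cube p)) \<le> (\<Sum>p\<in>G1. measure M (E \<inter> cube p))"
        unfolding sum_distrib_left by (intro sum_mono) (auto simp: G1_def Bad1_def)
      also have "\<dots> = measure M (\<Union>p\<in>G1. E \<inter> cube p)"
      proof (rule measure_finite_Union[symmetric])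
        show "(\<lambda>p. E \<inter> cube p) ` G1 \<subseteq> sets M" by (intro image_subsetI fmeasurableD Efm cubeD(4) P(1) GP(1))
        show "disjoint_family_on (\<lambda>p. E \<inter> cube p) G1" unfolding disjoint_family_on_def
        proof (intro ballI impI)
          fix p q assume "p \<in> G1" "q \<in> G1" "p \<noteq> q"
          then have "cube p \<inter> cube q = {}" using dG(1) unfolding disjoint_family_on_def by simp
          then show "E \<inter> cube p \<inter> (E \<inter> cube q) = {}" by auto
        qed
        show "emeasure M (E \<inter> cube p) \<noteq> \<infinity>" if "p \<in> G1" for p
          using fmeasurableD2[OF Efm[OF cubeD(4)[OF P(1)[OF GP(1)[OF that]]]]] by simp
      qed (rule fin)
      also have "\<dots> \<le> measure M E"
        by (intro measure_mono_fmeasurable sets.finite_UN fin Eem fmeasurableD Efm cubeD(4) P(1) GP(1)) auto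
      also have "\<dots> \<le> \<theta> * (measure M (cube s) / 4)" using Ebd by simp
      finally show ?thesis using \<theta>(1) by simp
    qed
    moreover have "(\<Sum>p\<in>G2. measure M (cube p)) \<le> measure M (cube s) / 4"
    proof -
      have X: "snd p \<in> space M" if "p \<in> G2" for p using cubeD(2)[OF P(1)[OF GP(2)[OF that]]] .
      have rp: "0 < \<beta> * rad (fst p)" for p :: "nat \<times> 'a" using \<beta> rad_pos by simp
      \<comment> \<open>The balls on which these cubes were tested overlap. Over a disjoint Vitali
        subfamily the integrals of \<open>F\<close> add up to at most the integral of
        \<open>F\<close> over the whole space.\<close>
      obtain J where J: "J \<subseteq> G2" "disjoint_family_on (\<lambda>p. B (snd p) (\<beta> * rad (fst p))) J"
        "\<forall>p\<in>G2. \<exists>q\<in>J. B (snd p) (\<beta> * rad (fst p)) \<subseteq> B (snd q) (3 * A\<^sup>2 * (\<beta> * rad (fst q)))"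
        using vitali_finite[OF fin(2), of snd "\<lambda>p. \<beta> * rad (fst p)"] X rp by auto
      have finJ: "finite J" using J(1) fin(2) finite_subset by blast
      have JX: "snd q \<in> space M" if "q \<in> J" for q using X subsetD[OF J(1) that] by simp
      have sub: "(\<Union>p\<in>G2. cube p) \<subseteq> (\<Union>q\<in>J. B (snd q) (3 * A\<^sup>2 * (\<beta> * rad (fst q))))"
      proof (rule UN_least)
        fix p assume p: "p \<in> G2"
        obtain q where q: "q \<in> J" "B (snd p) (\<beta> * rad (fst p)) \<subseteq> B (snd q) (3 * A\<^sup>2 * (\<beta> * rad (fst q)))" using J(3) p by auto
        have "bd p \<subseteq> B (snd p) (\<beta> * rad (fst p))" using \<beta> rad_pos[of "fst p"] by (intro B_mono mult_right_mono) auto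
        then show "cube p \<subseteq> (\<Union>q\<in>J. B (snd q) (3 * A\<^sup>2 * (\<beta> * rad (fst q))))"
          using cubeD(9)[OF P(1)[OF GP(2)[OF p]]] q by auto
      qed
      have "(\<Sum>p\<in>G2. measure M (cube p)) = measure M (\<Union>p\<in>G2. cube p)"
      proof (rule measure_finite_Union[symmetric])
        show "cube ` G2 \<subseteq> sets M" by (intro image_subsetI cubeD(3) P(1) GP(2))
        show "emeasure M (cube p) \<noteq> \<infinity>" if "p \<in> G2" for p
          using fmeasurableD2[OF cubeD(4)[OF P(1)[OF GP(2)[OF that]]]] by simp
      qed (rule fin dG)+
      also have "\<dots> \<le> measure M (\<Union>q\<in>J. B (snd q) (3 * A\<^sup>2 * (\<beta> * rad (fst q))))"
        using sub finJ JX fin cubeD(3)[OF P(1)[OF GP(2)]]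
        by (intro measure_mono_fmeasurable sets.finite_UN fmeasurable.finite_UN B_fmeasurable) simp_all
      also have "\<dots> \<le> (\<Sum>q\<in>J. V (snd q) (3 * A\<^sup>2 * (\<beta> * rad (fst q))))"
        unfolding V_def by (intro measure_UNION_le finJ B_sets JX)
      also have "\<dots> \<le> (\<Sum>q\<in>J. Dil (3 * A\<^sup>2) / (L\<^sub>2 * t) * (LINT y|M. F y * indicator (B (snd q) (\<beta> * rad (fst q))) y))"
      proof (rule sum_mono)
        fix q assume q: "q \<in> J"
        then have "q \<in> G2" using J(1) by auto
        then have "Bad2 (fst q) (snd q)" using P(4)[OF GP(2)] unfolding G2_def by auto
        then have b: "L\<^sub>2 * t * V (snd q) (\<beta> * rad (fst q)) \<le> (LINT y|M. F y * indicator (B (snd q) (\<beta> * rad (fst q))) y)"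
          unfolding Bad2_def by simp
        have lt: "0 < L\<^sub>2 * t" using lambda2 t by simp
        have "V (snd q) (3 * A\<^sup>2 * (\<beta> * rad (fst q))) \<le> Dil (3 * A\<^sup>2) * V (snd q) (\<beta> * rad (fst q))"
          by (intro V_dil JX q rp)
        also have "\<dots> \<le> Dil (3 * A\<^sup>2) * ((LINT y|M. F y * indicator (B (snd q) (\<beta> * rad (fst q))) y) / (L\<^sub>2 * t))"
          using b lt Dil_pos[of "3 * A\<^sup>2"] by (intro mult_left_mono) (simp_all add: pos_le_divide_eq mult.commute)
        finally show "V (snd q) (3 * A\<^sup>2 * (\<beta> * rad (fst q))) \<le> Dil (3 * A\<^sup>2) / (L\<^sub>2 * t) * (LINT y|M. F y * indicator (B (snd q) (\<beta> * rad (fst q))) y)"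
          by simp
      qed
      also have "\<dots> = Dil (3 * A\<^sup>2) / (L\<^sub>2 * t) * (LINT y|M. F y * indicator (\<Union>q\<in>J. B (snd q) (\<beta> * rad (fst q))) y)"
      proof -
        have "(\<Sum>q\<in>J. (LINT y|M. F y * indicator (B (snd q) (\<beta> * rad (fst q))) y)) = (LINT y|M. (\<Sum>q\<in>J. F y * indicator (B (snd q) (\<beta> * rad (fst q))) y))"
          by (intro Bochner_Integration.integral_sum[symmetric] FB B_sets JX)
        also have "\<dots> = (LINT y|M. F y * indicator (\<Union>q\<in>J. B (snd q) (\<beta> * rad (fst q))) y)"
          unfolding indicator_UN_disjoint[OF finJ J(2)] sum_distrib_left ..
        finally show ?thesis by (simp only: sum_distrib_left[symmetric])
      qed
      also have "\<dots> \<le> Dil (3 * A\<^sup>2) / (L\<^sub>2 * t) * (t * V z (\<alpha> * rad k))"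
        using finJ JX lambda2 t Dil_pos[of "3 * A\<^sup>2"] by (intro mult_left_mono FB_le sets.finite_UN B_sets) auto
      also have "\<dots> = Dil (3 * A\<^sup>2) / L\<^sub>2 * V z (\<alpha> * rad k)" using t by simp
      also have "\<dots> \<le> Dil (3 * A\<^sup>2) / L\<^sub>2 * (\<kappa> * measure M (cube s))"
        using cubeD(10)[OF s] lambda2 Dil_pos[of "3 * A\<^sup>2"] unfolding z_def k_def by (intro mult_left_mono) auto
      also have "\<dots> = measure M (cube s) / 4"
        unfolding L\<^sub>2_def using Dil_pos[of "3 * A\<^sup>2"] kappa_ge_1 by simp
      finally show ?thesis .
    qed
    ultimately show ?thesis by simp
  qed
  have outside: "AE x in M. x \<in> cube s \<and> x \<notin> (\<Union>p\<in>\<P>. cube p) \<longrightarrow> \<bar>T (loc f s) x\<bar> \<le> L\<^sub>1 * t"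
  proof -
    define E' where "E' = E \<inter> cube s - (\<Union>p\<in>\<P>. cube p)"
    have "(\<Union>p\<in>\<P>. cube p) \<in> sets M" using cnt cubeD(3)[OF P(1)] by (intro sets.countable_UN'') simp_all
    then have E'm: "E' \<in> sets M" unfolding E'_def using cubeD(3)[OF s] by auto
    \<comment> \<open>A cube of a generation after \<open>k\<close> that meets \<open>E'\<close>
      lies in \<open>cube s\<close> and is not bad, so \<open>E\<close> fills at most the fraction
      \<open>\<theta> < 1\<close> of it.\<close>
    have "E' \<in> null_sets M"
    proof (rule density_null[where \<theta> = \<theta> and k\<^sub>0 = "Suc k"])
      fix j a assume j: "Suc k \<le> j" and a: "a \<in> Net j"
      show "measure M (E' \<inter> Q j a) \<le> \<theta> * measure M (Q j a)"
      proof (cases "E' \<inter> Q j a = {}")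
        case True
        then show ?thesis using \<theta>(1) by simp
      next
        case ne: False
        then have "Q j a \<inter> Q k z \<noteq> {}" unfolding E'_def z_def k_def by auto
        then have sub: "Q j a \<subseteq> cube s" using Q_nested[of k j a z] j a zN unfolding z_def k_def by auto
        have "\<not> Bad j a"
        proof
          assume "Bad j a"
          from stop_cover[OF a, of Bad, OF this] show False using ne unfolding E'_def \<P>_def by auto
        qed
        then have "measure M (E \<inter> Q j a) \<le> \<theta> * measure M (Q j a)" using sub j unfolding Bad_def Bad1_def by auto
        moreover have "measure M (E' \<inter> Q j a) \<le> measure M (E \<inter> Q j a)"
          using E'm Efm[OF Q_fmeasurable[OF a]] Q_measurable[OF a] by (intro measure_mono_fmeasurable) (auto simp: E'_def)
        ultimately show ?thesis by linarith
      qed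
    qed (use \<theta> E'm in auto)
    then have "AE x in M. x \<notin> E'" by (rule AE_not_in)
    then show ?thesis using AE_space
    proof eventually_elim
      case (elim x)
      then show ?case unfolding E'_def E_def by auto
    qed
  qed
  have inside: "AE x in M. x \<in> cube p \<longrightarrow> \<bar>T (loc f s) x\<bar> \<le> C\<^sub>S * t + \<bar>T (loc f p) x\<bar>" if p: "p \<in> \<P>" for p
  proof -
    define j a where "j = fst p" and "a = snd p"
    have pc: "is_cube p" "k < j" "cube p \<subseteq> cube s" using P[OF p] unfolding j_def by auto
    note cp = cubeD[OF pc(1), folded j_def a_def]
    have bsub: "bd p \<subseteq> bd s" using bd_mono[OF s pc(1,3)] pc(2) unfolding k_def j_def by auto
    define H where "H = C\<^sub>H * t"
    have H0: "0 < H" unfolding H_def using CH_pos t by simp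
    have as: "\<rho> a z < 3 * A\<^sup>2 * rad k"
      using child_dist[OF s pc(1,3)] rho_sym[of z a] zN cp(2) unfolding k_def z_def a_def by auto
    \<comment> \<open>For \<open>u \<ge> \<alpha> * rad k\<close> the whole integral of
      \<open>F\<close> is already small enough. Below that, an ancestor of \<open>p\<close> of some
      generation \<open>i\<close> with \<open>k \<le> i < j\<close> has passed the test on a ball
      comparable to the given one.\<close>
    have avg_le: "(LINT y|M. F y * indicator (B a u) y) \<le> H * V a u" if u: "\<alpha> * rad j \<le> u" for u
    proof -
      have u0: "0 < u" using u alpha_ge(3) rad_pos[of j] by (meson less_le_trans mult_pos_pos)
      show ?thesis
      proof (cases "\<alpha> * rad k \<le> u")
        case True
        have "A * (\<rho> a z + \<alpha> * rad k) \<le> A * (3 * A\<^sup>2 * rad k + \<alpha> * rad k)"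
          using as A_pos by (intro mult_left_mono add_right_mono) auto
        also have "\<dots> \<le> A * (\<alpha> * rad k + \<alpha> * rad k)"
          using alpha_gt A_pos rad_pos[of k] by (intro mult_left_mono add_right_mono mult_right_mono) auto
        also have "\<dots> = 2 * A * (\<alpha> * rad k)" by simp
        also have "\<dots> \<le> 2 * A * u" using True A_pos by (intro mult_left_mono) auto
        finally have "V z (\<alpha> * rad k) \<le> Dil (2 * A) * V a u" using cp(2) zN u0 by (intro V_le) auto
        then have "t * V z (\<alpha> * rad k) \<le> t * (Dil (2 * A) * V a u)" using t by (intro mult_left_mono) auto
        also have "\<dots> \<le> t * (C\<^sub>H * V a u)" unfolding C\<^sub>H_def
          using t lambda2 Dil_pos[of "64 * A ^ 6"] by (intro mult_left_mono mult_right_mono) (auto simp: V_def)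
        finally have "t * V z (\<alpha> * rad k) \<le> H * V a u" unfolding H_def by (simp add: mult_ac)
        then show ?thesis using FB_le[OF B_sets[OF cp(2)], of u] by linarith
      next
        case False
        \<comment> \<open>The first generation whose dilated radius is at most \<open>u\<close>; the
          ancestor used is of the generation just before it.\<close>
        define m where "m = (LEAST n. \<alpha> * rad n \<le> u)"
        have m1: "\<alpha> * rad m \<le> u" unfolding m_def using u by (rule LeastI)
        have m2: "m \<le> j" unfolding m_def using u by (rule Least_le)
        have m3: "k < m"
        proof (rule ccontr)
          assume "\<not> k < m"
          then have "\<alpha> * rad k \<le> \<alpha> * rad m" using rad_antimono[of m k] alpha_ge(3) by simp
          then show False using m1 False by linarith
        qed
        then obtain i where i: "m = Suc i" by (cases m) auto
        have ui: "u \<le> \<alpha> * rad i" using not_less_Least[of i "\<lambda>n. \<alpha> * rad n \<le> u"] i unfolding m_def[symmetric] by auto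
        obtain b where b: "b \<in> Net i" "cube p \<subseteq> Q i b"
          using Q_ancestor[of i j a] m2 i cp(1) unfolding j_def a_def by auto
        have nb: "\<not> Bad2 i b" using notbad[OF p _ _ b] m2 m3 i unfolding j_def by auto
        have bX: "b \<in> space M" using b(1) by (rule Net_space)
        have "a \<in> Q i b" using Net_in_Q[OF cp(1)] b(2) unfolding a_def j_def by auto
        then have ba: "\<rho> b a < 3 * A\<^sup>2 * rad i" using Q_sub_ball[OF b(1)] by (auto simp: mem_B)
        have al: "3 * A\<^sup>2 * rad i \<le> \<alpha> * rad i" using alpha_gt rad_pos[of i] by (intro mult_right_mono) auto
        have sub: "B a u \<subseteq> B b (\<beta> * rad i)"
        proof (rule B_tri[OF bX cp(2)])
          have "A * (\<rho> b a + u) \<le> A * (\<alpha> * rad i + \<alpha> * rad i)" using ba al ui A_pos by (intro mult_left_mono add_mono) auto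
          then show "A * (\<rho> b a + u) \<le> \<beta> * rad i" unfolding \<beta>_def by (simp add: mult_ac)
        qed
        have "\<rho> a b \<le> \<beta> * rad i"
          using ba al rho_sym[OF cp(2) bX] mult_right_mono[OF \<beta>(2) less_imp_le[OF rad_pos[of i]]] by linarith
        then have "A * (\<rho> a b + \<beta> * rad i) \<le> A * (\<beta> * rad i + \<beta> * rad i)"
          using less_imp_le[OF A_pos] by (intro mult_left_mono add_right_mono)
        also have "\<dots> = 4 * A\<^sup>2 * (\<alpha> * rad i)" unfolding \<beta>_def by (simp add: power2_eq_square)
        also have "\<dots> = 64 * A ^ 6 * (\<alpha> * rad m)"
          unfolding i rad_Suc \<delta>_def using A_pos by (simp add: field_simps power_add[symmetric])
        also have "\<dots> \<le> 64 * A ^ 6 * u" using m1 A_pos by (intro mult_left_mono) auto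
        finally have Vb: "V b (\<beta> * rad i) \<le> Dil (64 * A ^ 6) * V a u" using cp(2) bX u0 by (intro V_le) auto
        have "(LINT y|M. F y * indicator (B a u) y) \<le> (LINT y|M. F y * indicator (B b (\<beta> * rad i)) y)"
          using FB[OF B_sets[OF cp(2)]] FB[OF B_sets[OF bX]] sub F0 by (intro integral_mono) (auto simp: indicator_def)
        also have "\<dots> \<le> L\<^sub>2 * t * V b (\<beta> * rad i)" using nb unfolding Bad2_def by simp
        also have "\<dots> \<le> L\<^sub>2 * t * (Dil (64 * A ^ 6) * V a u)" using Vb lambda2 t by (intro mult_left_mono) auto
        also have "\<dots> = (L\<^sub>2 * Dil (64 * A ^ 6)) * (t * V a u)" by (simp add: mult_ac)
        also have "\<dots> \<le> C\<^sub>H * (t * V a u)" unfolding C\<^sub>H_def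
          using t Dil_pos[of "2 * A"] by (intro mult_right_mono) (auto simp: V_def)
        finally show ?thesis unfolding H_def by (simp add: mult_ac)
      qed
    qed
    have avp: "avb f p \<le> H"
    proof -
      have "(LINT y|M. \<bar>f y\<bar> * indicator (bd p) y) = (LINT y|M. F y * indicator (B a (\<alpha> * rad j)) y)"
        unfolding F_def loc_abs using bsub unfolding a_def j_def
        by (intro Bochner_Integration.integral_cong) (auto simp: indicator_def)
      also have "\<dots> \<le> H * V a (\<alpha> * rad j)" by (rule avg_le) simp
      finally show ?thesis unfolding avb_def using cp(8) unfolding a_def j_def by (simp add: pos_divide_le_eq)
    qed
    \<comment> \<open>The far part: \<open>loc f s\<close> splits into \<open>loc f p\<close>, which
      is left to the next step of the iteration, and \<open>fr\<close>, which vanishes on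
      \<open>bd p\<close>.\<close>
    define fr where "fr y = f y * indicator (bd s - bd p) y" for y
    have sq_fr: "sqint M fr" unfolding fr_def[abs_def] using cubeD(6)[OF s] cubeD(6)[OF pc(1)] by (intro sqint_indicator f) auto
    have frm [measurable]: "fr \<in> borel_measurable M" using sq_fr sqintD by auto
    have fr_le: "\<bar>fr y\<bar> \<le> F y" for y unfolding fr_def F_def loc_abs by (auto simp: indicator_def)
    have Tsplit: "AE x in M. T (loc f s) x = T (loc f p) x + T fr x"
    proof -
      have "loc f s y = loc f p y + fr y" for y
      proof (cases "y \<in> bd p")
        case True
        then have "y \<in> bd s" using bsub by (rule subsetD[rotated])
        then show ?thesis using True unfolding loc_def fr_def by simp
      qed (simp add: loc_def fr_def indicator_def)
      then have "loc f s = (\<lambda>y. loc f p y + fr y)" by (rule ext)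
      then show ?thesis using T_add[OF loc_sqint[OF f pc(1)] sq_fr] by simp
    qed
    have "\<exists>N\<in>null_sets M. \<forall>x\<in>B a (3 * A\<^sup>2 * rad j) - N. \<forall>x'\<in>B a (3 * A\<^sup>2 * rad j) - N.
       \<bar>T fr x - T fr x'\<bar> \<le> 2 * (C\<^sub>\<eta> * H)"
    proof (rule T_oscillation_bound[OF sq_fr cp(2) rad_pos])
      fix u assume u: "\<alpha> * rad j \<le> u"
      have "(\<integral>\<^sup>+y\<in>B a u. ennreal \<bar>fr y\<bar> \<partial>M) \<le> (\<integral>\<^sup>+y. ennreal (F y * indicator (B a u) y) \<partial>M)"
        using fr_le by (intro nn_integral_mono) (auto simp: indicator_def intro: ennreal_leI)
      also have "\<dots> = ennreal (LINT y|M. F y * indicator (B a u) y)"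
        using FB[OF B_sets[OF cp(2)]] F0 by (intro nn_integral_eq_integral) auto
      also have "\<dots> \<le> ennreal (H * V a u)" using avg_le[OF u] by (rule ennreal_leI)
      finally show "(\<integral>\<^sup>+y\<in>B a u. ennreal \<bar>fr y\<bar> \<partial>M) \<le> ennreal (H * V a u)" .
    next
      fix y assume "y \<in> B a (\<alpha> * rad j)"
      then show "fr y = 0" unfolding fr_def a_def j_def by simp
    qed (use H0 in simp)
    then obtain N1 where N1': "N1 \<in> null_sets M"
      "\<forall>x\<in>B a (3 * A\<^sup>2 * rad j) - N1. \<forall>x'\<in>B a (3 * A\<^sup>2 * rad j) - N1. \<bar>T fr x - T fr x'\<bar> \<le> 2 * (C\<^sub>\<eta> * H)"
      by (elim bexE) (rule that)
    have N1: "N1 \<in> null_sets M"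
      "\<And>x x'. x \<in> cube p \<Longrightarrow> x \<notin> N1 \<Longrightarrow> x' \<in> cube p \<Longrightarrow> x' \<notin> N1 \<Longrightarrow> \<bar>T fr x - T fr x'\<bar> \<le> 2 * (C\<^sub>\<eta> * H)"
    proof -
      fix x x' assume "x \<in> cube p" "x \<notin> N1" "x' \<in> cube p" "x' \<notin> N1"
      moreover have "cube p \<subseteq> B a (3 * A\<^sup>2 * rad j)" using Q_sub_ball[OF cp(1)] unfolding a_def j_def .
      ultimately have "x \<in> B a (3 * A\<^sup>2 * rad j) - N1" "x' \<in> B a (3 * A\<^sup>2 * rad j) - N1" by auto
      then show "\<bar>T fr x - T fr x'\<bar> \<le> 2 * (C\<^sub>\<eta> * H)" using N1'(2) by simp
    qed (rule N1'(1))
    obtain N2 where N2: "\<And>x. x \<in> space M - N2 \<Longrightarrow> T (loc f s) x = T (loc f p) x + T fr x" "N2 \<in> null_sets M"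
      using AE_E3[OF Tsplit] by blast
    \<comment> \<open>The threshold is in terms of \<open>H\<close>, which is positive, whereas
      \<open>avb f p\<close> may be zero.\<close>
    define Gp where "Gp = {x \<in> space M. L\<^sub>3 * H < \<bar>T (loc f p) x\<bar>}"
    have [measurable]: "T (loc f p) \<in> borel_measurable M" using T_sqint[OF loc_sqint[OF f pc(1)]] sqintD by auto
    have Gm [measurable]: "Gp \<in> sets M" unfolding Gp_def by measurable
    have Gp_le: "measure M (Gp \<inter> cube p) \<le> measure M (cube p) / 4"
    proof -
      have gf: "Gp \<in> fmeasurable M"
      proof (rule fmeasurableI[OF Gm])
        have l0: "0 < L\<^sub>3 * H" using H0 lambda3 by simp
        have "emeasure M Gp \<le> emeasure M {x \<in> space M. L\<^sub>3 * H \<le> \<bar>T (loc f p) x\<bar>}"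
          unfolding Gp_def by (intro emeasure_mono) (auto, measurable)
        also have "\<dots> \<le> ennreal (b\<^sub>T * (LINT x|M. (loc f p x)\<^sup>2) / (L\<^sub>3 * H)\<^sup>2)"
          by (intro T_chebyshev loc_sqint f pc l0)
        finally show "emeasure M Gp < \<infinity>" by (simp add: le_less_trans)
      qed
      have "measure M (Gp \<inter> cube p) \<le> measure M Gp" using gf Gm cubeD(3)[OF pc(1)] by (intro measure_mono_fmeasurable) auto
      also have "\<dots> \<le> C\<^sub>w * \<kappa> / L\<^sub>3 * measure M (cube p)"
        unfolding Gp_def by (intro local_weak_type f pc H0 avp lambda3)
      also have "\<dots> \<le> 1 / 4 * measure M (cube p)" using lambda3(3) by (intro mult_right_mono) auto
      finally show ?thesis by simp
    qed
    have E_le: "measure M (E \<inter> cube p) \<le> measure M (cube p) / 4"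
    proof -
      obtain i where i: "j = Suc i" using pc(2) by (cases j) auto
      have aN: "a \<in> Net (Suc i)" using cp(1) unfolding i .
      define b where "b = par i a"
      have b: "b \<in> Net i" "Q (Suc i) a \<subseteq> Q i b" unfolding b_def using par(1) cp(2) Q_parent by auto
      have "\<not> Bad1 i b" using notbad[OF p _ _ b(1)] b(2) i pc(2) unfolding j_def a_def by auto
      then have "measure M (E \<inter> Q i b) \<le> \<theta> * measure M (Q i b)" unfolding Bad1_def by simp
      also have "\<dots> \<le> \<theta> * (C\<^sub>p * measure M (Q (Suc i) a))" using parent_measure[OF aN b] \<theta>(1) by (intro mult_left_mono) auto
      also have "\<dots> = measure M (cube p) / 4" using \<theta>(3) i unfolding a_def j_def by (simp add: mult.assoc[symmetric])
      finally have "measure M (E \<inter> Q i b) \<le> measure M (cube p) / 4" .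
      moreover have "measure M (E \<inter> cube p) \<le> measure M (E \<inter> Q i b)"
        using b i Efm[OF Q_fmeasurable[OF b(1)]] cubeD(3)[OF pc(1)] Em unfolding a_def j_def
        by (intro measure_mono_fmeasurable) auto
      ultimately show ?thesis by linarith
    qed
    \<comment> \<open>\<open>E\<close> and \<open>Gp\<close> take up at most a quarter of
      \<open>cube p\<close> each, so half of it is left after removing them and the null
      sets.\<close>
    have "\<exists>x'. x' \<in> cube p \<and> x' \<notin> E \<and> x' \<notin> Gp \<and> x' \<notin> N1 \<and> x' \<notin> N2"
    proof (rule ccontr)
      assume "\<not> ?thesis"
      then have sub: "cube p \<subseteq> (E \<inter> cube p) \<union> (Gp \<inter> cube p) \<union> (N1 \<union> N2)" by auto
      have cpf: "cube p \<in> fmeasurable M" using cubeD(4)[OF pc(1)] .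
      have nN: "N1 \<union> N2 \<in> null_sets M" using N1 N2 by auto
      then have nf: "N1 \<union> N2 \<in> fmeasurable M" by (intro fmeasurableI) (auto simp: null_sets_def)
      have ef: "E \<inter> cube p \<in> fmeasurable M" "Gp \<inter> cube p \<in> fmeasurable M"
        using Efm[OF cpf] fmeasurable_Int_sets[OF Gm cpf] by auto
      have "measure M (cube p) \<le> measure M ((E \<inter> cube p) \<union> (Gp \<inter> cube p) \<union> (N1 \<union> N2))"
        by (rule measure_mono_fmeasurable[OF sub cubeD(3)[OF pc(1)] fmeasurable.Un[OF fmeasurable.Un[OF ef] nf]])
      also have "\<dots> \<le> measure M ((E \<inter> cube p) \<union> (Gp \<inter> cube p)) + measure M (N1 \<union> N2)"
        by (rule measure_Un_le[OF sets.Un[OF fmeasurableD[OF ef(1)] fmeasurableD[OF ef(2)]] fmeasurableD[OF nf]])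
      also have "\<dots> \<le> measure M (E \<inter> cube p) + measure M (Gp \<inter> cube p) + measure M (N1 \<union> N2)"
        using ef by (intro add_right_mono measure_Un_le) (auto dest: fmeasurableD)
      also have "measure M (N1 \<union> N2) = 0" using nN by (simp add: measure_eq_0_null_sets)
      finally show False using E_le Gp_le cubeD(5)[OF pc(1)] by linarith
    qed
    then obtain x' where x': "x' \<in> cube p" "x' \<notin> E" "x' \<notin> Gp" "x' \<notin> N1" "x' \<notin> N2" by auto
    have x'X: "x' \<in> space M" using x'(1) Q_space by auto
    have frx': "\<bar>T fr x'\<bar> \<le> L\<^sub>1 * t + L\<^sub>3 * H"
    proof -
      have "\<bar>T (loc f s) x'\<bar> \<le> L\<^sub>1 * t" using x'(2) x'X unfolding E_def by auto
      moreover have "\<bar>T (loc f p) x'\<bar> \<le> L\<^sub>3 * H" using x'(3) x'X unfolding Gp_def by auto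
      moreover have "T (loc f s) x' = T (loc f p) x' + T fr x'" using N2(1) x' x'X by auto
      ultimately show ?thesis by linarith
    qed
    have "AE x in M. x \<notin> N1" "AE x in M. x \<notin> N2" using N1 N2 by (auto intro: AE_not_in)
    then show ?thesis using AE_space
    proof eventually_elim
      case (elim x)
      show ?case
      proof
        assume x: "x \<in> cube p"
        have "\<bar>T fr x - T fr x'\<bar> \<le> 2 * (C\<^sub>\<eta> * H)" by (rule N1(2)[OF x elim(1) x'(1) x'(4)])
        then have "\<bar>T fr x\<bar> \<le> 2 * (C\<^sub>\<eta> * H) + (L\<^sub>1 * t + L\<^sub>3 * H)" using frx' by linarith
        also have "\<dots> = C\<^sub>S * t" unfolding C\<^sub>S_def H_def by (simp add: algebra_simps)
        finally show "\<bar>T (loc f s) x\<bar> \<le> C\<^sub>S * t + \<bar>T (loc f p) x\<bar>" using N2(1)[of x] elim by auto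
      qed
    qed
  qed
  have "L\<^sub>1 * t \<le> C\<^sub>S * t"
    unfolding C\<^sub>S_def using t lambda3(2) CH_pos C_eta_nonneg by (intro mult_right_mono) auto
  with outside have "AE x in M. x \<in> cube s \<and> x \<notin> (\<Union>p\<in>\<P>. cube p) \<longrightarrow> \<bar>T (loc f s) x\<bar> \<le> C\<^sub>S * t"
    by (auto elim!: eventually_mono)
  then show ?thesis using cnt dis small inside P(1-3) unfolding t_def k_def
    by (intro exI[of _ \<P>] conjI ballI allI impI) auto
qed

end

section \<open>Iteration of the sparse step\<close>

lemma sqint_mult_bounded_integrable:
  assumes u: "sqint M u" and E: "E \<in> fmeasurable M" and g: "g \<in> borel_measurable M" "\<And>x. \<bar>g x\<bar> \<le> G"
  shows "integrable M (\<lambda>x. \<bar>u x\<bar> * g x * indicator E x)"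
proof (rule Bochner_Integration.integrable_bound)
  have [measurable]: "u \<in> borel_measurable M" "g \<in> borel_measurable M" "E \<in> sets M" using u g E sqintD by auto
  show "integrable M (\<lambda>x. G * (u x * indicator E x))" using sqint_integrable_on[OF u E] by simp
  show "(\<lambda>x. \<bar>u x\<bar> * g x * indicator E x) \<in> borel_measurable M" by measurable
  have "0 \<le> G" using g(2)[of undefined] by linarith
  then show "AE x in M. norm (\<bar>u x\<bar> * g x * indicator E x) \<le> norm (G * (u x * indicator E x))"
    using g(2) by (intro AE_I2) (auto simp: abs_mult indicator_def mult.commute[of "\<bar>u _\<bar>"] intro!: mult_right_mono)
qed

context cz_dyadic
begin

text \<open>A crude start for the iteration. It depends on the bounds for \<open>f\<close> and
  \<open>g\<close>, but it is proportional to the measure of the cube, and the measures decay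
  geometrically.\<close>

lemma local_integral_bound:
  assumes f: "sqint M f" "\<And>x. \<bar>f x\<bar> \<le> F" and s: "is_cube s"
    and g: "g \<in> borel_measurable M" "\<And>x. 0 \<le> g x" "\<And>x. g x \<le> G"
  shows "(LINT x|M. \<bar>T (loc f s) x\<bar> * g x * indicator (cube s) x) \<le> G * (b\<^sub>T * F\<^sup>2 * \<kappa> + 1) * measure M (cube s)"
proof -
  have G0: "0 \<le> G" using g(2,3)[of undefined] by linarith
  note sq = loc_sqint[OF f(1) s] note sqT = T_sqint[OF sq]
  have i1: "integrable M (\<lambda>x. (T (loc f s) x)\<^sup>2 + indicator (cube s) x)"
    using sqintD(2)[OF sqT] cubeD(4)[OF s]
    by (intro Bochner_Integration.integrable_add integrable_real_indicator) (auto dest: fmeasurableD2 simp: less_top)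
  have ab: "\<bar>a\<bar> \<le> a\<^sup>2 + 1" for a :: real using sum_squares_bound[of "\<bar>a\<bar>" 1] by simp
  have "(LINT x|M. \<bar>T (loc f s) x\<bar> * g x * indicator (cube s) x) \<le> (LINT x|M. G * ((T (loc f s) x)\<^sup>2 + indicator (cube s) x))"
  proof (rule integral_mono)
    show "integrable M (\<lambda>x. \<bar>T (loc f s) x\<bar> * g x * indicator (cube s) x)"
      using g by (intro sqint_mult_bounded_integrable[where G = G] sqT cubeD(4) s) auto
    show "integrable M (\<lambda>x. G * ((T (loc f s) x)\<^sup>2 + indicator (cube s) x))" using i1 by simp
    fix x
    have "\<bar>T (loc f s) x\<bar> * g x \<le> ((T (loc f s) x)\<^sup>2 + 1) * G" using ab g by (intro mult_mono) auto
    then show "\<bar>T (loc f s) x\<bar> * g x * indicator (cube s) x \<le> G * ((T (loc f s) x)\<^sup>2 + indicator (cube s) x)"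
      using G0 by (auto simp: indicator_def mult.commute)
  qed
  also have "\<dots> = G * ((LINT x|M. (T (loc f s) x)\<^sup>2) + measure M (cube s))"
    using sqintD(2)[OF sqT] cubeD(3,4)[OF s]
    by (simp add: fmeasurableD2 less_top[symmetric] Bochner_Integration.integral_add integrable_real_indicator)
  also have "\<dots> \<le> G * (b\<^sub>T * (F\<^sup>2 * (\<kappa> * measure M (cube s))) + measure M (cube s))"
  proof (intro mult_left_mono add_right_mono G0)
    have "(LINT x|M. (loc f s x)\<^sup>2) \<le> (LINT x|M. F\<^sup>2 * indicator (bd s) x)"
    proof (rule integral_mono[OF sqintD(2)[OF sq]])
      show "integrable M (\<lambda>x. F\<^sup>2 * indicator (bd s) x)"
        using cubeD(6,7)[OF s] by (intro integrable_mult_right integrable_real_indicator) (auto dest: fmeasurableD2 simp: less_top)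
      have "(f x)\<^sup>2 \<le> F\<^sup>2" for x using f(2)[of x] by (metis abs_ge_zero power2_abs power_mono)
      then show "(loc f s x)\<^sup>2 \<le> F\<^sup>2 * indicator (bd s) x" for x unfolding loc_def by (auto simp: indicator_def)
    qed
    also have "\<dots> = F\<^sup>2 * V (snd s) (\<alpha> * rad (fst s))" using cubeD(6)[OF s] unfolding V_def by simp
    also have "\<dots> \<le> F\<^sup>2 * (\<kappa> * measure M (cube s))" using cubeD(10)[OF s] by (intro mult_left_mono) auto
    finally have "b\<^sub>T * (LINT x|M. (loc f s x)\<^sup>2) \<le> b\<^sub>T * (F\<^sup>2 * (\<kappa> * measure M (cube s)))" using bT_nonneg by (intro mult_left_mono)
    then show "(LINT x|M. (T (loc f s) x)\<^sup>2) \<le> b\<^sub>T * (F\<^sup>2 * (\<kappa> * measure M (cube s)))" using T_bounded[OF sq] by linarith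
  qed
  also have "\<dots> = G * (b\<^sub>T * F\<^sup>2 * \<kappa> + 1) * measure M (cube s)" by (simp add: algebra_simps)
  finally show ?thesis .
qed

text \<open>The generation bound keeps \<open>s\<close> out of the families that belong to cubes of
  strictly later generations.\<close>

definition sparse_family :: "nat \<times> 'a \<Rightarrow> (nat \<times> 'a) set \<Rightarrow> (nat \<times> 'a \<Rightarrow> 'a set) \<Rightarrow> bool" where
  "sparse_family s S E \<longleftrightarrow> finite S \<and> (\<forall>p\<in>S. is_cube p \<and> fst s \<le> fst p \<and> cube p \<subseteq> cube s \<and>
      E p \<in> sets M \<and> E p \<subseteq> cube p \<and> measure M (cube p) \<le> 2 * measure M (E p)) \<and> disjoint_family_on E S"

lemma sparse_familyD:
  assumes "sparse_family s S E"
  shows "finite S" "disjoint_family_on E S"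
    "p \<in> S \<Longrightarrow> is_cube p" "p \<in> S \<Longrightarrow> fst s \<le> fst p" "p \<in> S \<Longrightarrow> cube p \<subseteq> cube s"
    "p \<in> S \<Longrightarrow> E p \<in> sets M" "p \<in> S \<Longrightarrow> E p \<subseteq> cube p" "p \<in> S \<Longrightarrow> measure M (cube p) \<le> 2 * measure M (E p)"
  using assms unfolding sparse_family_def by auto

text \<open>The part of \<open>cube s\<close> outside the chosen subcubes is at least half of it and
  is the set assigned to \<open>s\<close>. All other sets are kept; they remain disjoint because the
  families of different subcubes live in disjoint cubes. The last two conclusions let sums over the
  new family be split.\<close>

lemma sparse_family_insert:
  assumes s: "is_cube s" and F: "finite F"
    "\<And>p. p \<in> F \<Longrightarrow> is_cube p" "\<And>p. p \<in> F \<Longrightarrow> fst s < fst p" "\<And>p. p \<in> F \<Longrightarrow> cube p \<subseteq> cube s"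
    and dF: "disjoint_family_on cube F" and half: "(\<Sum>p\<in>F. measure M (cube p)) \<le> measure M (cube s) / 2"
    and IH: "\<And>p. p \<in> F \<Longrightarrow> sparse_family p (S p) (E p)"
  shows "\<exists>E'. sparse_family s (insert s (\<Union>p\<in>F. S p)) E'" "s \<notin> (\<Union>p\<in>F. S p)" "disjoint_family_on S F"
proof -
  have uniq: "p = p'" if "p \<in> F" "q \<in> S p" "p' \<in> F" "q \<in> S p'" for p p' q
  proof (rule ccontr)
    assume "p \<noteq> p'"
    then have "cube p \<inter> cube p' = {}" using dF that(1,3) unfolding disjoint_family_on_def by simp
    moreover have "cube q \<subseteq> cube p" "cube q \<subseteq> cube p'" using sparse_familyD(5)[OF IH] that by auto
    moreover have "snd q \<in> cube q" using Net_in_Q cubeD(1)[OF sparse_familyD(3)[OF IH[OF that(1)] that(2)]] by auto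
    ultimately show False by auto
  qed
  show "s \<notin> (\<Union>p\<in>F. S p)"
  proof
    assume "s \<in> (\<Union>p\<in>F. S p)"
    then obtain p where p: "p \<in> F" "s \<in> S p" by auto
    then show False using sparse_familyD(4)[OF IH[OF p(1)] p(2)] F(3)[OF p(1)] by simp
  qed
  note sn = this
  show "disjoint_family_on S F" unfolding disjoint_family_on_def
  proof (intro ballI impI)
    fix p q assume "p \<in> F" "q \<in> F" "p \<noteq> q"
    then show "S p \<inter> S q = {}" using uniq by (metis disjoint_iff)
  qed
  define \<Omega> where "\<Omega> = (\<Union>p\<in>F. cube p)"
  \<comment> \<open>A label \<open>q\<close> of the big union belongs to exactly one
    \<open>S p\<close>, so the union over such \<open>p\<close> merely selects
    \<open>E p q\<close>.\<close>
  define E' where "E' q = (if q = s then cube s - \<Omega> else (\<Union>p\<in>{p\<in>F. q \<in> S p}. E p q))" for q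
  have E's: "E' s = cube s - \<Omega>" unfolding E'_def by simp
  have E'q: "E' q = E p q" if "p \<in> F" "q \<in> S p" for p q
  proof -
    have "q \<noteq> s" using sn that by auto
    moreover have "{p\<in>F. q \<in> S p} = {p}"
    proof (intro equalityI subsetI)
      fix p' assume "p' \<in> {p\<in>F. q \<in> S p}"
      then have "p = p'" using uniq[OF that, of p'] by simp
      then show "p' \<in> {p}" by simp
    qed (use that in simp)
    ultimately show ?thesis unfolding E'_def by simp
  qed
  have \<Omega>m: "\<Omega> \<in> sets M" unfolding \<Omega>_def by (intro sets.finite_UN F(1) cubeD(3) F(2))
  have m\<Omega>: "measure M \<Omega> \<le> measure M (cube s) / 2"
  proof -
    have "measure M \<Omega> \<le> (\<Sum>p\<in>F. measure M (cube p))"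
      unfolding \<Omega>_def by (intro measure_UNION_le F(1) cubeD(3) F(2))
    then show ?thesis using half by linarith
  qed
  show "\<exists>E'. sparse_family s (insert s (\<Union>p\<in>F. S p)) E'"
  proof (intro exI[of _ E'], unfold sparse_family_def, intro conjI ballI)
    show "finite (insert s (\<Union>p\<in>F. S p))" using F(1) sparse_familyD(1)[OF IH] by simp
    fix q assume "q \<in> insert s (\<Union>p\<in>F. S p)"
    then consider "q = s" | p where "p \<in> F" "q \<in> S p" by auto
    then have "is_cube q \<and> fst s \<le> fst q \<and> cube q \<subseteq> cube s \<and> E' q \<in> sets M \<and> E' q \<subseteq> cube q \<and> measure M (cube q) \<le> 2 * measure M (E' q)"
    proof cases
      case 1
      have "\<Omega> \<subseteq> cube s" unfolding \<Omega>_def using F(4) by auto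
      then have "measure M (cube s - \<Omega>) = measure M (cube s) - measure M \<Omega>"
        using cubeD(4)[OF s] \<Omega>m by (intro measure_Diff) (auto dest: fmeasurableD2 fmeasurableD)
      then show ?thesis using 1 s m\<Omega> cubeD(3)[OF s] \<Omega>m unfolding 1 E's by auto
    next
      case 2
      note I = sparse_familyD[OF IH[OF 2(1)]]
      have "fst s \<le> fst q" using I(4)[OF 2(2)] F(3)[OF 2(1)] by simp
      moreover have "cube q \<subseteq> cube s" by (rule order_trans[OF I(5)[OF 2(2)] F(4)[OF 2(1)]])
      ultimately show ?thesis unfolding E'q[OF 2] using I(3,6-8)[OF 2(2)] by simp
    qed
    then show "is_cube q" "fst s \<le> fst q" "cube q \<subseteq> cube s" "E' q \<in> sets M" "E' q \<subseteq> cube q" "measure M (cube q) \<le> 2 * measure M (E' q)"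
      by simp_all
  next
    have sub: "E' q \<subseteq> cube p" "E' q \<subseteq> \<Omega>" if "p \<in> F" "q \<in> S p" for p q
    proof -
      show "E' q \<subseteq> cube p" using E'q[OF that] sparse_familyD(5,7)[OF IH[OF that(1)] that(2)] by simp
      then show "E' q \<subseteq> \<Omega>" unfolding \<Omega>_def using that(1) by auto
    qed
    show "disjoint_family_on E' (insert s (\<Union>p\<in>F. S p))" unfolding disjoint_family_on_def
    proof (intro ballI impI)
      fix q q' assume q: "q \<in> insert s (\<Union>p\<in>F. S p)" "q' \<in> insert s (\<Union>p\<in>F. S p)" and ne: "q \<noteq> q'"
      show "E' q \<inter> E' q' = {}"
      proof (cases "q = s \<or> q' = s")
        case True
        then consider p where "q = s" "p \<in> F" "q' \<in> S p" | p where "q' = s" "p \<in> F" "q \<in> S p" using q ne by auto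
        then show ?thesis
        proof cases
          case 1 then show ?thesis using sub(2)[OF 1(2,3)] E's by auto
        next
          case 2 then show ?thesis using sub(2)[OF 2(2,3)] E's by auto
        qed
      next
        case False
        then obtain p p' where p: "p \<in> F" "q \<in> S p" "p' \<in> F" "q' \<in> S p'" using q by auto
        show ?thesis
        proof (cases "p = p'")
          case True
          then have "E p q \<inter> E p q' = {}"
            using sparse_familyD(2)[OF IH[OF p(1)]] p ne unfolding disjoint_family_on_def by simp
          then show ?thesis using E'q[OF p(1,2)] E'q[OF p(3,4)] True by simp
        next
          case False
          then have "cube p \<inter> cube p' = {}" using dF p unfolding disjoint_family_on_def by simp
          then show ?thesis using sub(1)[OF p(1,2)] sub(1)[OF p(3,4)] by auto
        qed
      qed
    qed
  qed
qed

text \<open>The tail of the family of stopping cubes is dropped at each step, which keeps the sparse family finite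
  and is paid for by the factor \<open>3 / 4\<close> in place of \<open>1 / 2\<close>.\<close>

lemma sparse_domination:
  assumes f: "sqint M f" "\<And>x. \<bar>f x\<bar> \<le> F"
    and g: "g \<in> borel_measurable M" "\<And>x. 0 \<le> g x" "\<And>x. g x \<le> G" "0 < G" and s: "is_cube s"
  shows "\<exists>S E. sparse_family s S E \<and>
    (LINT x|M. \<bar>T (loc f s) x\<bar> * g x * indicator (cube s) x)
      \<le> C\<^sub>S * (\<Sum>p\<in>S. avb f p * (LINT x|M. g x * indicator (cube p) x))
        + G * (b\<^sub>T * F\<^sup>2 * \<kappa> + 1) * (3 / 4) ^ n * measure M (cube s)"
  using s
proof (induction n arbitrary: s)
  case 0
  have "sparse_family s {} (\<lambda>_. {})" unfolding sparse_family_def by (simp add: disjoint_family_on_def)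
  then show ?case using local_integral_bound[OF f 0 g(1-3)] by (intro exI[of _ "{}"] exI[of _ "\<lambda>_. {}"]) auto
next
  case (Suc n)
  note s = Suc.prems
  define c where "c = G * (b\<^sub>T * F\<^sup>2 * \<kappa> + 1) * (3 / 4) ^ n"
  have "0 \<le> b\<^sub>T * F\<^sup>2 * \<kappa>" using bT_nonneg kappa_ge_1 by simp
  then have c: "0 < c" unfolding c_def using g(4) by (intro mult_pos_pos) auto
  have gG: "\<bar>g x\<bar> \<le> G" for x using g(2,3) by simp
  define h where "h p x = \<bar>T (loc f p) x\<bar> * g x * indicator (cube p) x" for p x
  have h_int: "integrable M (h p)" if "is_cube p" for p
    unfolding h_def[abs_def] using g gG by (intro sqint_mult_bounded_integrable[where G = G] T_sqint loc_sqint f that cubeD(4))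
  have h0: "0 \<le> h p x" for p x unfolding h_def using g(2) by simp
  from sparse_step[OF f(1) s]
  obtain \<P> where cnt: "countable \<P>" and P0: "\<forall>p\<in>\<P>. is_cube p \<and> fst s < fst p \<and> cube p \<subseteq> cube s"
    and dis: "disjoint_family_on cube \<P>"
    and half: "\<forall>F\<subseteq>\<P>. finite F \<longrightarrow> (\<Sum>p\<in>F. measure M (cube p)) \<le> measure M (cube s) / 2"
    and out: "AE x in M. x \<in> cube s \<and> x \<notin> (\<Union>p\<in>\<P>. cube p) \<longrightarrow> \<bar>T (loc f s) x\<bar> \<le> C\<^sub>S * avb f s"
    and ins: "\<forall>p\<in>\<P>. AE x in M. x \<in> cube p \<longrightarrow> \<bar>T (loc f s) x\<bar> \<le> C\<^sub>S * avb f s + \<bar>T (loc f p) x\<bar>"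
    by (elim exE conjE) (rule that)
  have P: "is_cube p" "fst s < fst p" "cube p \<subseteq> cube s" if "p \<in> \<P>" for p using P0 that by simp_all
  have Pm: "cube p \<in> sets M" if "p \<in> \<P>" for p by (rule cubeD(3)[OF P(1)[OF that]])
  \<comment> \<open>\<open>1 / 4\<close> for the tail and \<open>1 / 2\<close> for the cubes in
    \<open>J\<close> make up the factor \<open>3 / 4\<close>.\<close>
  have e: "0 < c / 4 * measure M (cube s)" using c cubeD(5)[OF s] by simp
  have "\<exists>J\<subseteq>\<P>. finite J \<and> (LINT x|M. h s x * indicator ((\<Union>p\<in>\<P>. cube p) - (\<Union>p\<in>J. cube p)) x) < c / 4 * measure M (cube s)"
    by (intro countable_union_finite_tail cnt Pm h_int s h0 e)
  then obtain J where J: "J \<subseteq> \<P>" "finite J"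
    "(LINT x|M. h s x * indicator ((\<Union>p\<in>\<P>. cube p) - (\<Union>p\<in>J. cube p)) x) < c / 4 * measure M (cube s)"
    by (elim exE conjE) (rule that)
  have JP: "p \<in> \<P>" if "p \<in> J" for p using J(1) that by (rule subsetD)
  have "\<forall>p\<in>J. \<exists>S E. sparse_family p S E \<and>
      (LINT x|M. h p x) \<le> C\<^sub>S * (\<Sum>q\<in>S. avb f q * (LINT x|M. g x * indicator (cube q) x)) + c * measure M (cube p)"
    using Suc.IH[OF P(1)[OF JP]] unfolding h_def c_def by simp
  from bchoice[OF this] obtain S where S: "\<forall>p\<in>J. \<exists>E. sparse_family p (S p) E \<and>
      (LINT x|M. h p x) \<le> C\<^sub>S * (\<Sum>q\<in>S p. avb f q * (LINT x|M. g x * indicator (cube q) x)) + c * measure M (cube p)"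
    by (elim exE) (rule that)
  from bchoice[OF S] obtain E where E: "\<forall>p\<in>J. sparse_family p (S p) (E p) \<and>
      (LINT x|M. h p x) \<le> C\<^sub>S * (\<Sum>q\<in>S p. avb f q * (LINT x|M. g x * indicator (cube q) x)) + c * measure M (cube p)"
    by (elim exE) (rule that)
  have SE: "sparse_family p (S p) (E p)"
      "(LINT x|M. h p x) \<le> C\<^sub>S * (\<Sum>q\<in>S p. avb f q * (LINT x|M. g x * indicator (cube q) x)) + c * measure M (cube p)"
    if "p \<in> J" for p using E that by simp_all
  have dJ: "disjoint_family_on cube J" by (rule disjoint_family_on_mono[OF J(1) dis])
  have hJ: "(\<Sum>p\<in>J. measure M (cube p)) \<le> measure M (cube s) / 2" using half J by simp
  have new: "\<exists>E'. sparse_family s (insert s (\<Union>p\<in>J. S p)) E'" "s \<notin> (\<Union>p\<in>J. S p)" "disjoint_family_on S J"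
    by (rule sparse_family_insert[OF s J(2) P(1)[OF JP] P(2)[OF JP] P(3)[OF JP] dJ hJ SE(1)]; assumption)+
  from new(1) obtain E' where E': "sparse_family s (insert s (\<Union>p\<in>J. S p)) E'" by (elim exE) (rule that)
  define \<Omega> where "\<Omega> = (\<Union>p\<in>\<P>. cube p)"
  define \<Omega>J where "\<Omega>J = (\<Union>p\<in>J. cube p)"
  have "\<Omega> \<in> sets M" unfolding \<Omega>_def by (intro sets.countable_UN'' cnt cubeD(3) P(1))
  moreover have "\<Omega>J \<in> sets M" unfolding \<Omega>J_def by (intro sets.finite_UN J(2) cubeD(3) P(1) JP)
  ultimately have Om: "\<Omega> - \<Omega>J \<in> sets M" by auto
  define t where "t = C\<^sub>S * avb f s"
  have t0: "0 \<le> t" unfolding t_def using CS_nonneg avb_nonneg by simp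
  have gi: "integrable M (\<lambda>x. g x * indicator (cube s) x)"
  proof (rule Bochner_Integration.integrable_bound)
    show "integrable M (\<lambda>x. G * indicator (cube s) x)"
      using cubeD(3,4)[OF s] by (intro integrable_mult_right integrable_real_indicator) (auto dest: fmeasurableD2 simp: less_top)
    show "AE x in M. norm (g x * indicator (cube s) x) \<le> norm (G * indicator (cube s) x)"
      using gG g(4) by (intro AE_I2) (auto simp: indicator_def)
  qed (use g(1) cubeD(3)[OF s] in measurable)
  have h\<Omega>: "integrable M (\<lambda>x. h s x * indicator (\<Omega> - \<Omega>J) x)"
    using h_int[OF s] Om by (intro integrable_real_mult_indicator)
  have hS: "integrable M (\<lambda>x. \<Sum>p\<in>J. h p x)" by (intro Bochner_Integration.integrable_sum h_int P(1) JP)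
  have "AE x in M. \<forall>p\<in>J. x \<in> cube p \<longrightarrow> \<bar>T (loc f s) x\<bar> \<le> t + \<bar>T (loc f p) x\<bar>"
    using ins JP unfolding t_def by (intro AE_finite_allI J(2)) simp
  with out have "AE x in M. h s x \<le> t * (g x * indicator (cube s) x) + (\<Sum>p\<in>J. h p x) + h s x * indicator (\<Omega> - \<Omega>J) x"
  proof eventually_elim
    case (elim x)
    have S0: "0 \<le> (\<Sum>p\<in>J. h p x)" by (intro sum_nonneg h0)
    have T0: "0 \<le> t * (g x * indicator (cube s) x)" using t0 g(2) by simp
    show ?case
    proof (cases "x \<in> cube s")
      case False
      then have "h s x = 0" unfolding h_def by simp
      then show ?thesis using S0 T0 by simp
    next
      case True
      \<comment> \<open>On the dropped tail the left-hand side itself is the last summand, off all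
        stopping cubes the average suffices, and a cube in \<open>J\<close> hands
        \<open>T (loc f p)\<close> on to the induction hypothesis.\<close>
      consider "x \<in> \<Omega> - \<Omega>J" | "x \<notin> \<Omega>" | "x \<in> \<Omega>J" by blast
      then show ?thesis
      proof cases
        case 1
        then show ?thesis using S0 T0 by simp
      next
        case 2
        then have "\<bar>T (loc f s) x\<bar> \<le> t" using elim True unfolding \<Omega>_def t_def by simp
        then have "h s x \<le> t * (g x * indicator (cube s) x)" unfolding h_def using True g(2)[of x] by (simp add: mult_right_mono)
        then show ?thesis using S0 2 by simp
      next
        case 3
        then obtain p where 3: "p \<in> J" "x \<in> cube p" unfolding \<Omega>J_def by (elim UN_E) (rule that)
        then have "\<bar>T (loc f s) x\<bar> * g x \<le> (t + \<bar>T (loc f p) x\<bar>) * g x" using elim g(2)[of x] by (intro mult_right_mono) simp_all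
        then have "h s x \<le> t * (g x * indicator (cube s) x) + h p x" unfolding h_def using True 3 by (simp add: distrib_right mult.assoc)
        moreover have "h p x \<le> (\<Sum>p\<in>J. h p x)" using 3(1) h0 J(2) by (intro member_le_sum)
        moreover have "0 \<le> h s x * indicator (\<Omega> - \<Omega>J) x" using h0 by simp
        ultimately show ?thesis by linarith
      qed
    qed
  qed
  then have "(LINT x|M. h s x) \<le> (LINT x|M. t * (g x * indicator (cube s) x) + (\<Sum>p\<in>J. h p x) + h s x * indicator (\<Omega> - \<Omega>J) x)"
    using h_int[OF s] gi hS h\<Omega> by (intro integral_mono_AE) auto
  also have "\<dots> = t * (LINT x|M. g x * indicator (cube s) x) + (\<Sum>p\<in>J. (LINT x|M. h p x)) + (LINT x|M. h s x * indicator (\<Omega> - \<Omega>J) x)"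
    using gi hS h\<Omega> Bochner_Integration.integral_sum[of J M h] h_int[OF P(1)[OF JP]] by simp
  also have "\<dots> \<le> t * (LINT x|M. g x * indicator (cube s) x)
      + (\<Sum>p\<in>J. C\<^sub>S * (\<Sum>q\<in>S p. avb f q * (LINT x|M. g x * indicator (cube q) x)) + c * measure M (cube p)) + c / 4 * measure M (cube s)"
    unfolding \<Omega>_def \<Omega>J_def by (rule add_mono[OF add_mono[OF order_refl sum_mono[OF SE(2)]] less_imp_le[OF J(3)]])
  also have "(\<Sum>p\<in>J. C\<^sub>S * (\<Sum>q\<in>S p. avb f q * (LINT x|M. g x * indicator (cube q) x)) + c * measure M (cube p))
      = C\<^sub>S * (\<Sum>p\<in>J. \<Sum>q\<in>S p. avb f q * (LINT x|M. g x * indicator (cube q) x)) + c * (\<Sum>p\<in>J. measure M (cube p))"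
    by (simp add: sum.distrib sum_distrib_left)
  also have "(\<Sum>p\<in>J. \<Sum>q\<in>S p. avb f q * (LINT x|M. g x * indicator (cube q) x)) = (\<Sum>q\<in>(\<Union>p\<in>J. S p). avb f q * (LINT x|M. g x * indicator (cube q) x))"
    using J(2) sparse_familyD(1)[OF SE(1)] new(3) by (intro sum.UNION_disjoint_family[symmetric]) auto
  also have "t * (LINT x|M. g x * indicator (cube s) x) + (C\<^sub>S * (\<Sum>q\<in>(\<Union>p\<in>J. S p). avb f q * (LINT x|M. g x * indicator (cube q) x)) + c * (\<Sum>p\<in>J. measure M (cube p))) + c / 4 * measure M (cube s)
      \<le> C\<^sub>S * (\<Sum>q\<in>insert s (\<Union>p\<in>J. S p). avb f q * (LINT x|M. g x * indicator (cube q) x)) + c * (3 / 4) * measure M (cube s)"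
  proof -
    have "finite (\<Union>p\<in>J. S p)" using J(2) sparse_familyD(1)[OF SE(1)] by simp
    then have "(\<Sum>q\<in>insert s (\<Union>p\<in>J. S p). avb f q * (LINT x|M. g x * indicator (cube q) x))
        = avb f s * (LINT x|M. g x * indicator (cube s) x) + (\<Sum>q\<in>(\<Union>p\<in>J. S p). avb f q * (LINT x|M. g x * indicator (cube q) x))"
      using new(2) by (intro sum.insert)
    moreover have "c * (\<Sum>p\<in>J. measure M (cube p)) \<le> c * (measure M (cube s) / 2)" using hJ c by (intro mult_left_mono) auto
    ultimately show ?thesis unfolding t_def by (simp add: distrib_left)
  qed
  finally have "(LINT x|M. h s x) \<le> C\<^sub>S * (\<Sum>q\<in>insert s (\<Union>p\<in>J. S p). avb f q * (LINT x|M. g x * indicator (cube q) x)) + c * (3 / 4) * measure M (cube s)" .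
  then show ?case using E' unfolding h_def c_def
    by (intro exI[of _ "insert s (\<Union>p\<in>J. S p)"] exI[of _ E'] conjI) (simp_all add: mult_ac)
qed

end

context doubling_space
begin

section \<open>The weighted bound\<close>

text \<open>The shape in which a weight is used: with a real reciprocal, cleared of denominators,
  and with \<open>1 / w\<close> locally integrable.\<close>

definition A2_bound :: "('a \<Rightarrow> real) \<Rightarrow> ennreal \<Rightarrow> bool" where
  "A2_bound w a \<longleftrightarrow> w \<in> borel_measurable M \<and> (AE x in M. 0 < w x) \<and>
     (\<forall>x\<in>space M. \<forall>r>0.
        (\<integral>\<^sup>+y\<in>B x r. ennreal (w y) \<partial>M) * (\<integral>\<^sup>+y\<in>B x r. ennreal (1 / w y) \<partial>M) \<le> a * (ennreal (V x r))\<^sup>2 \<and>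
        (\<integral>\<^sup>+y\<in>B x r. ennreal (w y) \<partial>M) < \<infinity> \<and> (\<integral>\<^sup>+y\<in>B x r. ennreal (1 / w y) \<partial>M) < \<infinity>)"

end

context cz_space
begin

text \<open>\<open>C\<^sub>S\<close> times the constant of \<open>sparse_form_bound\<close> for
  \<open>c\<^sub>0 = 2 * \<kappa>\<close>: a dilated ball has at most \<open>\<kappa>\<close> times
  the measure of its cube, and this at most twice the measure of the disjoint part.\<close>

definition C\<^sub>A :: real where
  "C\<^sub>A = C\<^sub>S * ((Dil (2 * A * A * (4 * A\<^sup>2 * \<alpha> + A * (4 * A\<^sup>2 * \<alpha> + 1))) + 1) * ((Dil (2 * A))\<^sup>2 * (2 * \<kappa>) * 4))"

lemma CA_nonneg: "0 \<le> C\<^sub>A"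
  unfolding C\<^sub>A_def using CS_nonneg kappa_ge_1 Dil_pos
  by (intro mult_nonneg_nonneg add_nonneg_nonneg) (auto intro: less_imp_le)

end

context cz_dyadic
begin

text \<open>The sparse family depends on \<open>n\<close>, the bound for its form does not. The
  bounds \<open>F\<close> and \<open>G\<close> occur only next to \<open>(3 / 4) ^ n\<close> and
  drop out as \<open>n\<close> grows.\<close>

lemma weighted_cube_bound:
  assumes f: "sqint M f" "\<And>x. \<bar>f x\<bar> \<le> F"
    and g: "g \<in> borel_measurable M" "\<And>x. 0 \<le> g x" "\<And>x. g x \<le> G" "0 < G" and s: "is_cube s"
    and w: "A2_bound w a"
    and fn: "(\<integral>\<^sup>+x. ennreal ((f x)\<^sup>2 * w x) \<partial>M) \<le> ennreal (\<phi>\<^sup>2)" "0 \<le> \<phi>"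
    and gn: "(\<integral>\<^sup>+x. ennreal ((g x)\<^sup>2 / w x) \<partial>M) \<le> ennreal (\<gamma>\<^sup>2)" "0 \<le> \<gamma>"
  shows "ennreal (LINT x|M. \<bar>T (loc f s) x\<bar> * g x * indicator (cube s) x) \<le> a * ennreal (C\<^sub>A * \<phi> * \<gamma>)"
proof -
  have [measurable]: "f \<in> borel_measurable M" "g \<in> borel_measurable M" "w \<in> borel_measurable M"
    using f g w sqintD unfolding A2_bound_def by auto
  define k where "k = (Dil (2 * A * A * (4 * A\<^sup>2 * \<alpha> + A * (4 * A\<^sup>2 * \<alpha> + 1))) + 1) * ((Dil (2 * A))\<^sup>2 * (2 * \<kappa>) * (4 * \<phi> * \<gamma>))"
  have k: "C\<^sub>S * k = C\<^sub>A * \<phi> * \<gamma>" unfolding k_def C\<^sub>A_def by (simp add: mult_ac)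
  have k0: "0 \<le> k" unfolding k_def using kappa_ge_1 fn(2) gn(2) Dil_pos[of "2 * A * A * (4 * A\<^sup>2 * \<alpha> + A * (4 * A\<^sup>2 * \<alpha> + 1))"]
    by (intro mult_nonneg_nonneg add_nonneg_nonneg) auto
  have gi: "integrable M (\<lambda>x. g x * indicator (cube p) x)" if p: "is_cube p" for p
  proof (rule Bochner_Integration.integrable_bound)
    show "integrable M (\<lambda>x. G * indicator (cube p) x)"
      using cubeD(3,4)[OF p] by (intro integrable_mult_right integrable_real_indicator) (auto dest: fmeasurableD2 simp: less_top)
    show "AE x in M. norm (g x * indicator (cube p) x) \<le> norm (G * indicator (cube p) x)"
      using g by (intro AE_I2) (auto simp: indicator_def)
  qed (use cubeD(3)[OF p] in measurable)
  have form: "ennreal (\<Sum>p\<in>S. avb f p * (LINT x|M. g x * indicator (cube p) x)) \<le> a * ennreal k" if SE: "sparse_family s S E" for S E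
  proof -
    note Sp = sparse_familyD[OF SE]
    have g0: "0 \<le> (LINT x|M. g x * indicator (cube p) x)" for p using g(2) by (intro integral_nonneg_AE AE_I2) auto
    have "ennreal (\<Sum>p\<in>S. avb f p * (LINT x|M. g x * indicator (cube p) x)) = (\<Sum>p\<in>S. ennreal (avb f p) * ennreal (LINT x|M. g x * indicator (cube p) x))"
      using avb_nonneg g0 by (subst sum_ennreal[symmetric]) (auto simp: ennreal_mult)
    also have "\<dots> \<le> (\<Sum>p\<in>S. (\<integral>\<^sup>+y\<in>bd p. ennreal \<bar>f y\<bar> \<partial>M) / ennreal (V (snd p) (\<alpha> * rad (fst p))) * (\<integral>\<^sup>+y\<in>bd p. ennreal (g y) \<partial>M))"
    proof (intro sum_mono mult_mono)
      fix p assume p: "p \<in> S"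
      note pc = Sp(3)[OF p]
      have "ennreal (LINT y|M. \<bar>f y\<bar> * indicator (bd p) y) = (\<integral>\<^sup>+y. ennreal (\<bar>f y\<bar> * indicator (bd p) y) \<partial>M)"
        using loc_integrable[OF f(1) pc] loc_abs[of f p] integrable_abs[OF loc_integrable[OF f(1) pc]]
        by (intro nn_integral_eq_integral[symmetric]) auto
      also have "\<dots> = (\<integral>\<^sup>+y\<in>bd p. ennreal \<bar>f y\<bar> \<partial>M)" by (intro nn_integral_cong) (auto simp: indicator_def)
      finally have "ennreal (LINT y|M. \<bar>f y\<bar> * indicator (bd p) y) = (\<integral>\<^sup>+y\<in>bd p. ennreal \<bar>f y\<bar> \<partial>M)" .
      moreover have "ennreal (avb f p) = ennreal (LINT y|M. \<bar>f y\<bar> * indicator (bd p) y) / ennreal (V (snd p) (\<alpha> * rad (fst p)))"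
        unfolding avb_def using cubeD(8)[OF pc] by (intro divide_ennreal[symmetric] integral_nonneg_AE) auto
      ultimately show "ennreal (avb f p) \<le> (\<integral>\<^sup>+y\<in>bd p. ennreal \<bar>f y\<bar> \<partial>M) / ennreal (V (snd p) (\<alpha> * rad (fst p)))" by simp
      have "ennreal (LINT x|M. g x * indicator (cube p) x) = (\<integral>\<^sup>+x. ennreal (g x * indicator (cube p) x) \<partial>M)"
        using gi[OF pc] g(2) by (intro nn_integral_eq_integral[symmetric]) auto
      also have "\<dots> \<le> (\<integral>\<^sup>+y\<in>bd p. ennreal (g y) \<partial>M)"
        using cubeD(9)[OF pc] by (intro nn_integral_mono) (auto simp: indicator_def)
      finally show "ennreal (LINT x|M. g x * indicator (cube p) x) \<le> (\<integral>\<^sup>+y\<in>bd p. ennreal (g y) \<partial>M)" .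
    qed auto
    also have "\<dots> \<le> a * ennreal k" unfolding k_def
    proof (rule sparse_form_bound[where w = w and E = E])
      show "V (snd p) (\<alpha> * rad (fst p)) \<le> 2 * \<kappa> * measure M (E p)" if p: "p \<in> S" for p
      proof -
        have "\<kappa> * measure M (cube p) \<le> \<kappa> * (2 * measure M (E p))" using Sp(8)[OF p] kappa_ge_1 by (intro mult_left_mono) auto
        then show ?thesis using cubeD(10)[OF Sp(3)[OF p]] by simp
      qed
      show "E p \<subseteq> bd p" if p: "p \<in> S" for p by (rule order_trans[OF Sp(7)[OF p] cubeD(9)[OF Sp(3)[OF p]]])
      show "rad i \<le> \<rho> u v" if "(i, u) \<in> S" "(i, v) \<in> S" "u \<noteq> v" for i u v
        using Net_sep[of u i v] cubeD(1)[OF Sp(3)[OF that(1)]] cubeD(1)[OF Sp(3)[OF that(2)]] that(3) by simp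
      show "(\<integral>\<^sup>+x. (ennreal \<bar>f x\<bar>)\<^sup>2 * ennreal (w x) \<partial>M) \<le> ennreal (\<phi>\<^sup>2)"
      proof -
        have "(\<integral>\<^sup>+x. (ennreal \<bar>f x\<bar>)\<^sup>2 * ennreal (w x) \<partial>M) = (\<integral>\<^sup>+x. ennreal ((f x)\<^sup>2 * w x) \<partial>M)"
          by (intro nn_integral_cong) (simp add: ennreal_power ennreal_mult')
        then show ?thesis using fn(1) by simp
      qed
      show "(\<integral>\<^sup>+x. (ennreal (g x))\<^sup>2 * ennreal (1 / w x) \<partial>M) \<le> ennreal (\<gamma>\<^sup>2)"
      proof -
        have "(ennreal (g x))\<^sup>2 * ennreal (1 / w x) = ennreal ((g x)\<^sup>2 / w x)" for x
          using g(2)[of x] by (simp add: ennreal_power ennreal_mult'[symmetric])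
        then show ?thesis using gn(1) by simp
      qed
    qed (use Sp cubeD(2)[OF Sp(3)] w alpha_ge(3) rad_pos rad_4A2 kappa_ge_1 fn gn in \<open>simp_all add: A2_bound_def\<close>)
    finally show ?thesis .
  qed
  show ?thesis
  proof (rule ennreal_le_epsilon)
    fix e :: real assume e: "0 < e"
    define c where "c = G * (b\<^sub>T * F\<^sup>2 * \<kappa> + 1) * measure M (cube s)"
    have "0 \<le> b\<^sub>T * F\<^sup>2 * \<kappa>" using bT_nonneg kappa_ge_1 by simp
    then have c: "0 < c" unfolding c_def using g(4) cubeD(5)[OF s] by (intro mult_pos_pos) auto
    have "\<exists>n. (3 / 4 :: real) ^ n < e / c" using e c by (intro real_arch_pow_inv) auto
    then obtain n where n: "(3 / 4 :: real) ^ n < e / c" by auto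
    obtain S E where SE: "sparse_family s S E" and le: "(LINT x|M. \<bar>T (loc f s) x\<bar> * g x * indicator (cube s) x)
      \<le> C\<^sub>S * (\<Sum>p\<in>S. avb f p * (LINT x|M. g x * indicator (cube p) x))
        + G * (b\<^sub>T * F\<^sup>2 * \<kappa> + 1) * (3 / 4) ^ n * measure M (cube s)"
      using sparse_domination[OF f g s, of n] by (elim exE conjE) (rule that)
    have "G * (b\<^sub>T * F\<^sup>2 * \<kappa> + 1) * (3 / 4) ^ n * measure M (cube s) = c * (3 / 4) ^ n" unfolding c_def by simp
    also have "\<dots> \<le> e" using n c by (simp add: field_simps)
    finally have "(LINT x|M. \<bar>T (loc f s) x\<bar> * g x * indicator (cube s) x)
      \<le> C\<^sub>S * (\<Sum>p\<in>S. avb f p * (LINT x|M. g x * indicator (cube p) x)) + e" using le by linarith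
    then have "ennreal (LINT x|M. \<bar>T (loc f s) x\<bar> * g x * indicator (cube s) x)
      \<le> ennreal (C\<^sub>S * (\<Sum>p\<in>S. avb f p * (LINT x|M. g x * indicator (cube p) x)) + e)" by (rule ennreal_leI)
    also have "\<dots> = ennreal (C\<^sub>S * (\<Sum>p\<in>S. avb f p * (LINT x|M. g x * indicator (cube p) x))) + ennreal e"
      using e CS_nonneg avb_nonneg g(2)
      by (intro ennreal_plus mult_nonneg_nonneg sum_nonneg integral_nonneg_AE AE_I2) auto
    also have "ennreal (C\<^sub>S * (\<Sum>p\<in>S. avb f p * (LINT x|M. g x * indicator (cube p) x))) = ennreal C\<^sub>S * ennreal (\<Sum>p\<in>S. avb f p * (LINT x|M. g x * indicator (cube p) x))"
      using CS_nonneg by (intro ennreal_mult')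
    also have "\<dots> \<le> ennreal C\<^sub>S * (a * ennreal k)" using form[OF SE] by (intro mult_left_mono) auto
    also have "\<dots> = a * (ennreal C\<^sub>S * ennreal k)" by (simp add: mult_ac)
    also have "ennreal C\<^sub>S * ennreal k = ennreal (C\<^sub>A * \<phi> * \<gamma>)" unfolding k[symmetric] using CS_nonneg k0 by (intro ennreal_mult[symmetric])
    finally show "ennreal (LINT x|M. \<bar>T (loc f s) x\<bar> * g x * indicator (cube s) x) \<le> a * ennreal (C\<^sub>A * \<phi> * \<gamma>) + ennreal e"
      by (simp add: add_right_mono)
  qed
qed

end

context cz_space
begin

text \<open>Only here is the dyadic system fixed: with \<open>R = 4 * A\<^sup>2 * N\<close> the
  inner ball of \<open>Q 0 x\<^sub>0\<close> has radius \<open>N\<close>, so the restrictions to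
  that cube and to its dilate change nothing.\<close>

lemma weighted_ball_bound:
  assumes f: "sqint M f" "\<And>x. \<bar>f x\<bar> \<le> F" "\<And>x. x \<notin> B x\<^sub>0 N \<Longrightarrow> f x = 0"
    and g: "g \<in> borel_measurable M" "\<And>x. 0 \<le> g x" "\<And>x. g x \<le> G" "0 < G" "\<And>x. x \<notin> B x\<^sub>0 N \<Longrightarrow> g x = 0"
    and x0: "x\<^sub>0 \<in> space M" "0 < N"
    and w: "A2_bound w a"
    and fn: "(\<integral>\<^sup>+x. ennreal ((f x)\<^sup>2 * w x) \<partial>M) \<le> ennreal (\<phi>\<^sup>2)" "0 \<le> \<phi>"
    and gn: "(\<integral>\<^sup>+x. ennreal ((g x)\<^sup>2 / w x) \<partial>M) \<le> ennreal (\<gamma>\<^sup>2)" "0 \<le> \<gamma>"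
  shows "ennreal (LINT x|M. \<bar>T f x\<bar> * g x) \<le> a * ennreal (C\<^sub>A * \<phi> * \<gamma>)"
proof -
  interpret cz_dyadic M \<rho> A D T K \<eta> b\<^sub>T "4 * A\<^sup>2 * N" x\<^sub>0
    by unfold_locales (use x0 A_ge_1 in auto)
  have s: "is_cube (0, x\<^sub>0)" unfolding is_cube_def using x0_Net by simp
  have r0: "rad 0 = 4 * A\<^sup>2 * N" unfolding rad_def by simp
  have sub: "B x\<^sub>0 N \<subseteq> cube (0, x\<^sub>0)"
    using ball_sub_Q[OF x0_Net[of 0]] unfolding r0 using A_pos by simp
  then have sub': "B x\<^sub>0 N \<subseteq> bd (0, x\<^sub>0)" using cubeD(9)[OF s] by (rule order_trans)
  have "loc f (0, x\<^sub>0) = f"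
  proof
    fix y show "loc f (0, x\<^sub>0) y = f y" unfolding loc_def using f(3)[of y] subsetD[OF sub', of y] by (cases "y \<in> B x\<^sub>0 N") auto
  qed
  moreover have "(\<lambda>x. \<bar>T f x\<bar> * g x * indicator (cube (0, x\<^sub>0)) x) = (\<lambda>x. \<bar>T f x\<bar> * g x)"
  proof
    fix x show "\<bar>T f x\<bar> * g x * indicator (cube (0, x\<^sub>0)) x = \<bar>T f x\<bar> * g x"
      using g(5)[of x] subsetD[OF sub, of x] by (cases "x \<in> B x\<^sub>0 N") auto
  qed
  ultimately show ?thesis
    using weighted_cube_bound[OF f(1,2) g(1-4) s w fn gn] by (simp only:)
qed

text \<open>Removes the bound and the support condition from \<open>f\<close>. The truncations
  converge to \<open>f\<close> in unweighted \<open>L\<^sup>2\<close>, so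
  \<open>T (f - fk n)\<close> is small there and has a small integral against \<open>g\<close>,
  which is bounded and lives in a ball. Truncation does not increase the weighted norm.\<close>

lemma weighted_form_bound:
  assumes f: "sqint M f"
    and g: "g \<in> borel_measurable M" "\<And>x. 0 \<le> g x" "\<And>x. g x \<le> G" "0 < G" "\<And>x. x \<notin> B x\<^sub>0 N \<Longrightarrow> g x = 0"
    and x0: "x\<^sub>0 \<in> space M" "0 < N"
    and w: "A2_bound w a"
    and fn: "(\<integral>\<^sup>+x. ennreal ((f x)\<^sup>2 * w x) \<partial>M) \<le> ennreal (\<phi>\<^sup>2)" "0 \<le> \<phi>"
    and gn: "(\<integral>\<^sup>+x. ennreal ((g x)\<^sup>2 / w x) \<partial>M) \<le> ennreal (\<gamma>\<^sup>2)" "0 \<le> \<gamma>"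
  shows "ennreal (LINT x|M. \<bar>T f x\<bar> * g x) \<le> a * ennreal (C\<^sub>A * \<phi> * \<gamma>)"
proof (rule ennreal_le_epsilon)
  fix e :: real assume e: "0 < e"
  have [measurable]: "f \<in> borel_measurable M" "g \<in> borel_measurable M" "w \<in> borel_measurable M"
    using f g w sqintD unfolding A2_bound_def by auto
  have B_m [measurable]: "B x\<^sub>0 t \<in> sets M" for t using x0 by auto
  have w0: "AE x in M. 0 < w x" using w unfolding A2_bound_def by auto
  define fk where "fk n x = f x * indicator (B x\<^sub>0 (N + real n) \<inter> {x\<in>space M. \<bar>f x\<bar> \<le> real n}) x" for n x
  have fk_m [measurable]: "fk n \<in> borel_measurable M" for n unfolding fk_def[abs_def] by measurable
  have fk_le: "\<bar>fk n x\<bar> \<le> \<bar>f x\<bar>" for n x unfolding fk_def by (auto simp: indicator_def)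
  have sq: "sqint M (fk n)" for n by (rule sqint_bound[OF f fk_m fk_le])
  have sqd: "sqint M (\<lambda>x. f x - fk n x)" for n
    using sqint_lincomb[OF f sq[of n], of 1 "-1"] by simp
  have "(\<lambda>n. LINT x|M. (f x - fk n x)\<^sup>2) \<longlonglongrightarrow> (LINT x|M. 0)"
  proof (rule integral_dominated_convergence[where w = "\<lambda>x. (f x)\<^sup>2"])
    show "AE x in M. (\<lambda>n. (f x - fk n x)\<^sup>2) \<longlonglongrightarrow> 0"
    proof (rule AE_I2)
      fix x assume x: "x \<in> space M"
      obtain n0 :: nat where n0: "max (\<rho> x\<^sub>0 x) \<bar>f x\<bar> < real n0" using reals_Archimedean2 by blast
      have "fk n x = f x" if "n0 \<le> n" for n
        unfolding fk_def using n0 x x0 that by (auto simp: mem_B indicator_def)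
      then have "eventually (\<lambda>n. (f x - fk n x)\<^sup>2 = 0) sequentially"
        unfolding eventually_sequentially by (intro exI[of _ n0]) simp
      then show "(\<lambda>n. (f x - fk n x)\<^sup>2) \<longlonglongrightarrow> 0" by (rule tendsto_eventually)
    qed
    show "AE x in M. norm ((f x - fk n x)\<^sup>2) \<le> (f x)\<^sup>2" for n
      unfolding fk_def by (intro AE_I2) (auto simp: indicator_def)
    show "integrable M (\<lambda>x. (f x)\<^sup>2)" using sqintD(2)[OF f] .
  qed measurable
  then have lim: "(\<lambda>n. LINT x|M. (f x - fk n x)\<^sup>2) \<longlonglongrightarrow> 0" by simp
  define v where "v = V x\<^sub>0 N"
  have v: "0 < v" unfolding v_def using x0 by (intro V_pos)
  \<comment> \<open>Balances \<open>\<bar>u\<bar> \<le> u\<^sup>2 / e' + e'\<close>, which stands in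
    for Cauchy--Schwarz: each of the two terms contributes \<open>e / 2\<close>.\<close>
  define e' where "e' = e / (2 * G * v)"
  have e': "0 < e'" unfolding e'_def using e v g(4) by simp
  have "eventually (\<lambda>n. (LINT x|M. (f x - fk n x)\<^sup>2) < e * e' / (2 * G * (b\<^sub>T + 1))) sequentially"
    using lim e e' g(4) bT_nonneg by (intro order_tendstoD(2)) auto
  then obtain n where n: "(LINT x|M. (f x - fk n x)\<^sup>2) < e * e' / (2 * G * (b\<^sub>T + 1))"
    by (auto simp: eventually_sequentially)
  define u where "u = T (\<lambda>x. f x - fk n x)"
  have squ: "sqint M u" unfolding u_def by (rule T_sqint[OF sqd])
  have split: "AE x in M. T f x = T (fk n) x + u x"
    using T_add[OF sq[of n] sqd[of n]] unfolding u_def by simp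
  have gG: "\<bar>g x\<bar> \<le> G" for x using g(2,3) by simp
  have int: "integrable M (\<lambda>x. \<bar>h x\<bar> * g x)" if "sqint M h" for h
  proof -
    have "(\<lambda>x. \<bar>h x\<bar> * g x * indicator (B x\<^sub>0 N) x) = (\<lambda>x. \<bar>h x\<bar> * g x)"
      using g(5) by (intro ext) (simp add: indicator_def, blast)
    then show ?thesis
      using sqint_mult_bounded_integrable[OF that B_fmeasurable[OF x0(1)] g(1) gG, of N] by (simp only:)
  qed
  have u_small: "(LINT x|M. \<bar>u x\<bar> * g x) \<le> e"
  proof -
    have iB: "integrable M (indicator (B x\<^sub>0 N) :: 'a \<Rightarrow> real)"
      using B_fmeasurable[OF x0(1), of N] by (intro integrable_real_indicator) (auto dest: fmeasurableD2 simp: less_top)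
    have "(LINT x|M. \<bar>u x\<bar> * g x) \<le> (LINT x|M. G * ((u x)\<^sup>2 / e' + e' * indicator (B x\<^sub>0 N) x))"
    proof (rule integral_mono[OF int[OF squ]])
      show "integrable M (\<lambda>x. G * ((u x)\<^sup>2 / e' + e' * indicator (B x\<^sub>0 N) x))"
        using sqintD(2)[OF squ] iB by auto
      fix x
      have "\<bar>u x\<bar> \<le> (u x)\<^sup>2 / e' + e'"
      proof -
        have "2 * \<bar>u x\<bar> * e' \<le> \<bar>u x\<bar>\<^sup>2 + e'\<^sup>2" by (rule sum_squares_bound)
        moreover have "0 \<le> \<bar>u x\<bar> * e'" using e' by simp
        ultimately have "\<bar>u x\<bar> * e' \<le> (u x)\<^sup>2 + e'\<^sup>2" by (simp add: mult.assoc)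
        then show ?thesis using e' by (simp add: field_simps power2_eq_square)
      qed
      then have "\<bar>u x\<bar> * g x \<le> ((u x)\<^sup>2 / e' + e') * G" using g e' by (intro mult_mono) auto
      then show "\<bar>u x\<bar> * g x \<le> G * ((u x)\<^sup>2 / e' + e' * indicator (B x\<^sub>0 N) x)"
        using g(5)[of x] g(4) e' by (cases "x \<in> B x\<^sub>0 N") (auto simp: mult.commute)
    qed
    also have "\<dots> = G * ((LINT x|M. (u x)\<^sup>2) / e' + e' * v)"
      using sqintD(2)[OF squ] iB unfolding v_def V_def by simp
    also have "\<dots> \<le> G * ((b\<^sub>T + 1) * (e * e' / (2 * G * (b\<^sub>T + 1))) / e' + e' * v)"
    proof (intro mult_left_mono add_right_mono divide_right_mono)
      have "(LINT x|M. (u x)\<^sup>2) \<le> b\<^sub>T * (LINT x|M. (f x - fk n x)\<^sup>2)" unfolding u_def by (rule T_bounded[OF sqd])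
      also have "\<dots> \<le> (b\<^sub>T + 1) * (e * e' / (2 * G * (b\<^sub>T + 1)))" using n bT_nonneg by (intro mult_mono) auto
      finally show "(LINT x|M. (u x)\<^sup>2) \<le> (b\<^sub>T + 1) * (e * e' / (2 * G * (b\<^sub>T + 1)))" .
    qed (use e' g(4) in auto)
    also have "\<dots> = e"
    proof -
      have "(b\<^sub>T + 1) * (e * e' / (2 * G * (b\<^sub>T + 1))) / e' = e / (2 * G)"
      proof -
        have "q * (e * e' / (2 * G * q)) / e' = e / (2 * G)" if "q \<noteq> 0" for q :: real using that e' by simp
        from this[of "b\<^sub>T + 1"] show ?thesis using bT_nonneg by argo
      qed
      moreover have "e' * v = e / (2 * G)" unfolding e'_def using v by simp
      ultimately show ?thesis using g(4) by simp
    qed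
    finally show ?thesis .
  qed
  have "(LINT x|M. \<bar>T f x\<bar> * g x) \<le> (LINT x|M. \<bar>T (fk n) x\<bar> * g x + \<bar>u x\<bar> * g x)"
  proof (rule integral_mono_AE[OF int[OF T_sqint[OF f]] Bochner_Integration.integrable_add[OF int[OF T_sqint[OF sq]] int[OF squ]]])
    show "AE x in M. \<bar>T f x\<bar> * g x \<le> \<bar>T (fk n) x\<bar> * g x + \<bar>u x\<bar> * g x"
      using split
    proof eventually_elim
      case (elim x)
      have "\<bar>T f x\<bar> * g x \<le> (\<bar>T (fk n) x\<bar> + \<bar>u x\<bar>) * g x" unfolding elim using g(2)[of x] by (intro mult_right_mono abs_triangle_ineq)
      then show ?case by (simp add: distrib_right)
    qed
  qed
  also have "\<dots> = (LINT x|M. \<bar>T (fk n) x\<bar> * g x) + (LINT x|M. \<bar>u x\<bar> * g x)"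
    by (rule Bochner_Integration.integral_add[OF int[OF T_sqint[OF sq]] int[OF squ]])
  also have "\<dots> \<le> (LINT x|M. \<bar>T (fk n) x\<bar> * g x) + e" using u_small by simp
  finally have "ennreal (LINT x|M. \<bar>T f x\<bar> * g x) \<le> ennreal ((LINT x|M. \<bar>T (fk n) x\<bar> * g x) + e)" by (rule ennreal_leI)
  also have "\<dots> = ennreal (LINT x|M. \<bar>T (fk n) x\<bar> * g x) + ennreal e"
    using e g(2) by (intro ennreal_plus integral_nonneg_AE AE_I2) auto
  also have "\<dots> \<le> a * ennreal (C\<^sub>A * \<phi> * \<gamma>) + ennreal e"
  proof (intro add_right_mono weighted_ball_bound[OF sq _ _ g(1-4) _ x0(1) _ w _ fn(2) gn])
    show "\<bar>fk n x\<bar> \<le> real n" for x unfolding fk_def by (auto simp: indicator_def)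
    show "fk n x = 0" if "x \<notin> B x\<^sub>0 (N + real n)" for x using that unfolding fk_def by simp
    show "g x = 0" if "x \<notin> B x\<^sub>0 (N + real n)" for x using that g(5)[of x] B_mono[of N "N + real n" x\<^sub>0] by auto
    have "(\<integral>\<^sup>+x. ennreal ((fk n x)\<^sup>2 * w x) \<partial>M) \<le> (\<integral>\<^sup>+x. ennreal ((f x)\<^sup>2 * w x) \<partial>M)"
      using w0 by (intro nn_integral_mono_AE) (auto elim!: eventually_mono intro!: ennreal_leI mult_right_mono simp: abs_le_square_iff[symmetric] fk_le)
    then show "(\<integral>\<^sup>+x. ennreal ((fk n x)\<^sup>2 * w x) \<partial>M) \<le> ennreal (\<phi>\<^sup>2)" using fn(1) by (rule order_trans)
  qed (use x0 in simp)
  finally show "ennreal (LINT x|M. \<bar>T f x\<bar> * g x) \<le> a * ennreal (C\<^sub>A * \<phi> * \<gamma>) + ennreal e" .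
qed

text \<open>For \<open>g = \<bar>T f\<bar> * w\<close> both
  \<open>\<integral> \<bar>T f\<bar> g\<close> and \<open>\<integral> g\<^sup>2 / w\<close> are the
  square of the norm sought. With a cut-off of \<open>g\<close> that square becomes a finite number
  \<open>I\<close> with \<open>I \<le> c * sqrt I\<close>, which can be divided; monotone
  convergence removes the cut-off.\<close>

lemma weighted_L2_bound:
  assumes f: "sqint M f" and w: "A2_bound w (ennreal a)" and a: "0 \<le> a"
    and fn: "(\<integral>\<^sup>+x. ennreal ((f x)\<^sup>2 * w x) \<partial>M) \<le> ennreal (\<phi>\<^sup>2)" "0 \<le> \<phi>"
    and x0: "x\<^sub>0 \<in> space M"
  shows "(\<integral>\<^sup>+x. ennreal ((T f x)\<^sup>2 * w x) \<partial>M) \<le> ennreal ((a * C\<^sub>A * \<phi>)\<^sup>2)"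
proof -
  have [measurable]: "w \<in> borel_measurable M" using w unfolding A2_bound_def by auto
  have Tm [measurable]: "T f \<in> borel_measurable M" using T_sqint[OF f] sqintD by auto
  have B_m [measurable]: "B x\<^sub>0 t \<in> sets M" for t using x0 by auto
  define c where "c = a * C\<^sub>A * \<phi>"
  have c0: "0 \<le> c" unfolding c_def using a CA_nonneg fn(2) by simp
  \<comment> \<open>On \<open>X n\<close> the weight is positive and at most \<open>n\<close>, so
    that \<open>g x\<close> is at most \<open>n * n\<close> and
    \<open>(g x)\<^sup>2 / w x = h n x\<close>.\<close>
  define X where "X n = {x \<in> B x\<^sub>0 (real n). 0 < w x \<and> w x \<le> real n}" for n
  have X_m [measurable]: "X n \<in> sets M" for n
  proof -
    have "X n = B x\<^sub>0 (real n) \<inter> {x\<in>space M. 0 < w x \<and> w x \<le> real n}" unfolding X_def by (auto simp: mem_B)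
    then show ?thesis by simp
  qed
  define m where "m n x = min \<bar>T f x\<bar> (real n)" for n x
  have m_m [measurable]: "m n \<in> borel_measurable M" for n unfolding m_def[abs_def] by measurable
  have m0: "0 \<le> m n x" "m n x \<le> \<bar>T f x\<bar>" "m n x \<le> real n" for n x unfolding m_def by auto
  define h where "h n x = (m n x)\<^sup>2 * w x * indicator (X n) x" for n x
  have h_m [measurable]: "h n \<in> borel_measurable M" for n unfolding h_def[abs_def] by measurable
  have h0: "0 \<le> h n x" for n x unfolding h_def X_def by (auto simp: indicator_def)
  have bound: "(\<integral>\<^sup>+x. ennreal (h n x) \<partial>M) \<le> ennreal (c\<^sup>2)" if n: "0 < n" for n
  proof -
    define g where "g x = m n x * w x * indicator (X n) x" for x
    have g_m [measurable]: "g \<in> borel_measurable M" unfolding g_def[abs_def] by measurable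
    have g_bd: "0 \<le> g x" "g x \<le> real n * real n" for x
    proof -
      show "0 \<le> g x" unfolding g_def X_def using m0[of n x] by (auto simp: indicator_def)
      show "g x \<le> real n * real n" unfolding g_def X_def using m0[of n x] by (auto simp: indicator_def intro!: mult_mono)
    qed
    have g_out: "g x = 0" if "x \<notin> B x\<^sub>0 (real n)" for x using that unfolding g_def X_def by simp
    have hg: "h n x \<le> \<bar>T f x\<bar> * g x" for x
    proof -
      have "m n x * g x \<le> \<bar>T f x\<bar> * g x" using m0 g_bd by (intro mult_right_mono) auto
      then show ?thesis unfolding h_def g_def by (simp add: power2_eq_square mult_ac)
    qed
    have gG: "\<bar>g x\<bar> \<le> real n * real n" for x using g_bd[of x] by simp
    have "(\<lambda>x. \<bar>T f x\<bar> * g x * indicator (B x\<^sub>0 (real n)) x) = (\<lambda>x. \<bar>T f x\<bar> * g x)"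
      using g_out by (intro ext) (simp add: indicator_def, blast)
    then have int: "integrable M (\<lambda>x. \<bar>T f x\<bar> * g x)"
      using sqint_mult_bounded_integrable[OF T_sqint[OF f] B_fmeasurable[OF x0] g_m gG, of "real n"] by (simp only:)
    have hint: "integrable M (h n)"
      using h0 hg g_bd by (intro Bochner_Integration.integrable_bound[OF int h_m] AE_I2) (auto simp: abs_mult)
    define I where "I = (LINT x|M. h n x)"
    have I0: "0 \<le> I" unfolding I_def using h0 by simp
    have In: "(\<integral>\<^sup>+x. ennreal (h n x) \<partial>M) = ennreal I" unfolding I_def using hint h0 by (intro nn_integral_eq_integral) auto
    have "ennreal I \<le> ennreal (LINT x|M. \<bar>T f x\<bar> * g x)" unfolding I_def by (intro ennreal_leI integral_mono[OF hint int] hg)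
    also have "\<dots> \<le> ennreal a * ennreal (C\<^sub>A * \<phi> * sqrt I)"
    proof (rule weighted_form_bound[OF f g_m g_bd(1) g_bd(2) _ g_out x0 _ w fn])
      have "(g x)\<^sup>2 / w x = h n x" for x
        unfolding g_def h_def by (auto simp: X_def indicator_def power2_eq_square)
      then show "(\<integral>\<^sup>+x. ennreal ((g x)\<^sup>2 / w x) \<partial>M) \<le> ennreal ((sqrt I)\<^sup>2)" using In I0 by simp
    qed (use n I0 in auto)
    also have "\<dots> = ennreal (c * sqrt I)" unfolding c_def using a CA_nonneg fn(2) I0 by (simp add: ennreal_mult[symmetric] mult.assoc)
    finally have "I \<le> c * sqrt I" using c0 I0 by simp
    then have "sqrt I * sqrt I \<le> c * sqrt I" using I0 by simp
    then have "sqrt I \<le> c"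
    proof (cases "I = 0")
      case False
      then have "0 < sqrt I" using I0 by simp
      with \<open>sqrt I * sqrt I \<le> c * sqrt I\<close> show ?thesis by (rule mult_right_le_imp_le)
    qed (use c0 in simp)
    then have "I \<le> c\<^sup>2" using I0 power_mono[of "sqrt I" c 2] by simp
    then show ?thesis using In by (simp add: ennreal_leI)
  qed
  \<comment> \<open>Shifted by one, since \<open>bound\<close> needs a positive radius and a
    positive bound for \<open>g\<close>.\<close>
  have "incseq (\<lambda>n x. ennreal (h (Suc n) x))"
  proof (intro incseq_SucI le_funI ennreal_leI)
    fix n x
    show "h (Suc n) x \<le> h (Suc (Suc n)) x"
    proof (cases "x \<in> X (Suc n)")
      case True
      then have "x \<in> X (Suc (Suc n))" unfolding X_def by (auto simp: mem_B)
      moreover have "(m (Suc n) x)\<^sup>2 \<le> (m (Suc (Suc n)) x)\<^sup>2" unfolding m_def by (intro power_mono) auto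
      moreover have "0 < w x" using True unfolding X_def by auto
      ultimately show ?thesis using True unfolding h_def by (simp add: mult_right_mono)
    qed (use h0 in \<open>simp add: h_def[of "Suc n"]\<close>)
  qed
  then have mc: "(\<integral>\<^sup>+x. (SUP n. ennreal (h (Suc n) x)) \<partial>M) = (SUP n. (\<integral>\<^sup>+x. ennreal (h (Suc n) x) \<partial>M))"
    by (intro nn_integral_monotone_convergence_SUP) measurable
  have "AE x in M. 0 < w x" using w unfolding A2_bound_def by auto
  then have "AE x in M. ennreal ((T f x)\<^sup>2 * w x) \<le> (SUP n. ennreal (h (Suc n) x))"
    using AE_space
  proof eventually_elim
    case (elim x)
    obtain n :: nat where n: "max (\<rho> x\<^sub>0 x) (max \<bar>T f x\<bar> (w x)) < real n" using reals_Archimedean2 by blast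
    then have "x \<in> X (Suc n)" unfolding X_def using elim by (auto simp: mem_B)
    moreover have "m (Suc n) x = \<bar>T f x\<bar>" unfolding m_def using n by auto
    ultimately have "h (Suc n) x = (T f x)\<^sup>2 * w x" unfolding h_def by simp
    then show ?case by (metis SUP_upper UNIV_I)
  qed
  then have "(\<integral>\<^sup>+x. ennreal ((T f x)\<^sup>2 * w x) \<partial>M) \<le> (\<integral>\<^sup>+x. (SUP n. ennreal (h (Suc n) x)) \<partial>M)"
    by (rule nn_integral_mono_AE)
  also have "\<dots> \<le> ennreal (c\<^sup>2)" unfolding mc using bound by (intro SUP_least) simp
  finally show ?thesis unfolding c_def .
qed

end

section \<open>From the definitions of the statement to the locales\<close>

lemma L2_norm_le_iff:
  assumes "0 \<le> c"
  shows "L2_norm M w f \<le> ennreal c \<longleftrightarrow> (\<integral>\<^sup>+x. ennreal (\<bar>f x\<bar>\<^sup>2 * w x) \<partial>M) \<le> ennreal (c\<^sup>2)"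
proof (cases "(\<integral>\<^sup>+x. ennreal (\<bar>f x\<bar>\<^sup>2 * w x) \<partial>M)")
  case (real r)
  then have "L2_norm M w f = ennreal (sqrt r)" unfolding L2_norm_def by simp
  then show ?thesis using real assms by (simp add: real_sqrt_le_iff' real_le_lsqrt sqrt_le_D)
next
  case top
  then show ?thesis unfolding L2_norm_def by (simp add: top_unique)
qed

lemma L2_norm_finiteE:
  assumes "L2_norm M w f < \<infinity>"
  obtains c where "0 \<le> c" "L2_norm M w f = ennreal c" "(\<integral>\<^sup>+x. ennreal (\<bar>f x\<bar>\<^sup>2 * w x) \<partial>M) = ennreal (c\<^sup>2)"
proof (cases "(\<integral>\<^sup>+x. ennreal (\<bar>f x\<bar>\<^sup>2 * w x) \<partial>M)")
  case (real r)
  then have "L2_norm M w f = ennreal (sqrt r)" unfolding L2_norm_def by simp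
  then show ?thesis using real by (intro that[of "sqrt r"]) auto
next
  case top
  then show ?thesis using assms unfolding L2_norm_def by simp
qed

lemma L2_space_one_iff: "f \<in> L2_space M one_weight \<longleftrightarrow> sqint M f"
proof -
  have "L2_norm M one_weight f < \<infinity> \<longleftrightarrow> integrable M (\<lambda>x. (f x)\<^sup>2)" if f: "f \<in> borel_measurable M"
  proof -
    have "L2_norm M one_weight f < \<infinity> \<longleftrightarrow> (\<integral>\<^sup>+x. ennreal ((f x)\<^sup>2) \<partial>M) < \<infinity>"
      unfolding L2_norm_def by (auto simp: Let_def less_top)
    also have "\<dots> \<longleftrightarrow> integrable M (\<lambda>x. (f x)\<^sup>2)"
      using f by (subst integrable_iff_bounded) auto
    finally show ?thesis .
  qed
  then show ?thesis unfolding L2_space_def sqint_def by auto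
qed

lemma sqint_L2_norm:
  assumes "sqint M f" shows "L2_norm M one_weight f = ennreal (sqrt (LINT x|M. (f x)\<^sup>2))"
proof -
  have "(\<integral>\<^sup>+x. ennreal (\<bar>f x\<bar>\<^sup>2 * 1) \<partial>M) = ennreal (LINT x|M. (f x)\<^sup>2)"
    using sqintD(2)[OF assms] by (subst nn_integral_eq_integral[symmetric]) auto
  then show ?thesis unfolding L2_norm_def by (simp add: Let_def)
qed

lemma homogeneous_space_doubling:
  assumes "homogeneous_space M \<rho>" shows "\<exists>A D. doubling_space M \<rho> A D"
proof -
  obtain C0 where q: "\<forall>x\<in>space M. \<forall>y\<in>space M. 0 \<le> \<rho> x y \<and> (\<rho> x y = 0 \<longleftrightarrow> x = y) \<and> \<rho> x y = \<rho> y x"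
    and C0: "0 < C0" "\<forall>x\<in>space M. \<forall>y\<in>space M. \<forall>z\<in>space M. \<rho> x z \<le> C0 * (\<rho> x y + \<rho> y z)"
    using assms unfolding homogeneous_space_def quasimetric_on_def by auto
  obtain Cd :: real where Cd: "\<And>x r. x \<in> space M \<Longrightarrow> 0 < r \<Longrightarrow>
        0 < emeasure M (qball M \<rho> x (2 * r)) \<and>
        emeasure M (qball M \<rho> x (2 * r)) \<le> ennreal Cd * emeasure M (qball M \<rho> x r) \<and>
        ennreal Cd * emeasure M (qball M \<rho> x r) < \<infinity>"
  proof -
    obtain Cd :: real where "\<forall>x\<in>space M. \<forall>r>0.
        0 < emeasure M (qball M \<rho> x (2 * r)) \<and>
        emeasure M (qball M \<rho> x (2 * r)) \<le> ennreal Cd * emeasure M (qball M \<rho> x r) \<and>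
        ennreal Cd * emeasure M (qball M \<rho> x r) < \<infinity>"
      using assms unfolding homogeneous_space_def by (elim conjE exE) (rule that)
    then show thesis by (intro that[of Cd]) simp
  qed
  \<comment> \<open>The hypothesis speaks of the ball of radius \<open>2 * r\<close>; the ball of
    radius \<open>r\<close> is reached from \<open>r / 2\<close>.\<close>
  have pos: "0 < emeasure M (qball M \<rho> x r)" if "x \<in> space M" "0 < r" for x r
    using Cd[of x "r / 2"] that by simp
  have fin: "emeasure M (qball M \<rho> x r) < \<infinity>" if "x \<in> space M" "0 < r" for x r
    using Cd[of x "r / 2"] that by (auto intro: le_less_trans)
  have em: "emeasure M (qball M \<rho> x r) = ennreal (measure M (qball M \<rho> x r))" if "x \<in> space M" "0 < r" for x r
    using fin[OF that] by (intro emeasure_eq_ennreal_measure) auto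
  have "doubling_space M \<rho> (max 1 C0) (max 1 Cd)"
  proof
    fix x y z assume X: "x \<in> space M" "y \<in> space M" "z \<in> space M"
    have "\<rho> x z \<le> C0 * (\<rho> x y + \<rho> y z)" using C0 X by blast
    also have "\<dots> \<le> max 1 C0 * (\<rho> x y + \<rho> y z)" using q X by (intro mult_right_mono add_nonneg_nonneg) auto
    finally show "\<rho> x z \<le> max 1 C0 * (\<rho> x y + \<rho> y z)" .
  next
    fix x r assume X: "x \<in> space M" "0 < (r::real)"
    show "0 < measure M (qball M \<rho> x r)" using pos[OF X] em[OF X] by simp
    have "ennreal (measure M (qball M \<rho> x (2 * r))) \<le> ennreal Cd * ennreal (measure M (qball M \<rho> x r))"
      using Cd[OF X] em[OF X] em[of x "2 * r"] X by simp
    also have "\<dots> \<le> ennreal (max 1 Cd) * ennreal (measure M (qball M \<rho> x r))" by (intro mult_right_mono ennreal_leI) auto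
    also have "\<dots> = ennreal (max 1 Cd * measure M (qball M \<rho> x r))" by (intro ennreal_mult[symmetric]) auto
    finally show "measure M (qball M \<rho> x (2 * r)) \<le> max 1 Cd * measure M (qball M \<rho> x r)"
      by (subst (asm) ennreal_le_iff) auto
  qed (use assms q fin in \<open>auto simp: homogeneous_space_def\<close>)
  then show ?thesis by blast
qed

lemma cz_operator_cz_space:
  assumes sp: "doubling_space M \<rho> A D" and T: "cz_operator M \<rho> T"
  shows "\<exists>K \<eta> b. cz_space M \<rho> A D T K \<eta> b"
proof -
  interpret doubling_space M \<rho> A D by fact
  obtain K where K: "cz_kernel M \<rho> K" "associated_kernel M \<rho> T K"
    and lin: "linear_on_L2 M T" and bdd: "bounded_on_L2 M T"
    using T unfolding cz_operator_def by auto
  obtain \<eta> :: real and C :: real where eta: "0 < \<eta>"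
    and k: "\<And>x0 y x. x0 \<in> space M \<Longrightarrow> y \<in> space M \<Longrightarrow> x0 \<noteq> y \<Longrightarrow> x \<in> space M \<Longrightarrow> x \<noteq> y \<Longrightarrow> \<rho> x0 x \<le> \<eta> * \<rho> x0 y \<Longrightarrow>
           \<bar>K x y - K x0 y\<bar>
             \<le> (\<rho> x x0 / \<rho> x0 y) powr \<eta> * (1 / measure M (qball M \<rho> x0 (\<rho> x0 y))) \<and>
           \<bar>K y x - K y x0\<bar>
             \<le> (\<rho> x x0 / \<rho> x0 y) powr \<eta> * (1 / measure M (qball M \<rho> x0 (\<rho> x0 y)))"
    using K(1) unfolding cz_kernel_def by (elim exE conjE) (rule that, auto)
  obtain b :: real where b: "\<And>f. sqint M f \<Longrightarrow> sqint M (T f) \<and> L2_norm M one_weight (T f) \<le> ennreal b * L2_norm M one_weight f"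
  proof -
    obtain b :: real where "\<forall>f\<in>L2_space M one_weight. T f \<in> L2_space M one_weight \<and>
        L2_norm M one_weight (T f) \<le> ennreal b * L2_norm M one_weight f"
      using bdd unfolding bounded_on_L2_def by (elim exE) (rule that)
    then show thesis by (intro that[of b]) (simp add: L2_space_one_iff)
  qed
  \<comment> \<open>\<open>b\<close> may be negative, in which case \<open>ennreal b = 0\<close>;
    the square is taken because the locale compares square integrals.\<close>
  define b' where "b' = max 0 b"
  have "cz_space M \<rho> A D T K \<eta> (b'\<^sup>2)"
  proof
    fix f assume f: "sqint M f"
    show Tf: "sqint M (T f)" using b[OF f] by simp
    have "ennreal (sqrt (LINT x|M. (T f x)\<^sup>2)) \<le> ennreal b * ennreal (sqrt (LINT x|M. (f x)\<^sup>2))"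
      using b[OF f] sqint_L2_norm[OF f] sqint_L2_norm[OF Tf] by simp
    also have "\<dots> \<le> ennreal b' * ennreal (sqrt (LINT x|M. (f x)\<^sup>2))" unfolding b'_def by (intro mult_right_mono ennreal_leI) auto
    also have "\<dots> = ennreal (b' * sqrt (LINT x|M. (f x)\<^sup>2))" unfolding b'_def by (intro ennreal_mult[symmetric]) auto
    finally have "sqrt (LINT x|M. (T f x)\<^sup>2) \<le> b' * sqrt (LINT x|M. (f x)\<^sup>2)"
      unfolding b'_def by (subst (asm) ennreal_le_iff) auto
    then have "(sqrt (LINT x|M. (T f x)\<^sup>2))\<^sup>2 \<le> (b' * sqrt (LINT x|M. (f x)\<^sup>2))\<^sup>2" by (intro power_mono) auto
    then show "(LINT x|M. (T f x)\<^sup>2) \<le> b'\<^sup>2 * (LINT x|M. (f x)\<^sup>2)" by (simp add: power_mult_distrib)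
    show "AE x in M. x \<notin> ess_support M \<rho> f \<longrightarrow> has_bochner_integral M (\<lambda>y. K x y * f y) (T f x)"
      using K(2) f unfolding associated_kernel_def by (simp add: L2_space_one_iff)
  next
    fix f g and a c :: real assume "sqint M f" "sqint M g"
    then show "AE x in M. T (\<lambda>y. a * f y + c * g y) x = a * T f x + c * T g x"
      using lin unfolding linear_on_L2_def by (simp add: L2_space_one_iff)
  next
    fix x\<^sub>0 x y assume X: "x\<^sub>0 \<in> space M" "x \<in> space M" "y \<in> space M" "x\<^sub>0 \<noteq> y" "x \<noteq> y" "\<rho> x\<^sub>0 x \<le> \<eta> * \<rho> x\<^sub>0 y"
    note * = k[OF X(1,3,4,2,5,6)]
    show "\<bar>K x y - K x\<^sub>0 y\<bar> \<le> (\<rho> x\<^sub>0 x / \<rho> x\<^sub>0 y) powr \<eta> / measure M (qball M \<rho> x\<^sub>0 (\<rho> x\<^sub>0 y))"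
      "\<bar>K y x - K y x\<^sub>0\<bar> \<le> (\<rho> x\<^sub>0 x / \<rho> x\<^sub>0 y) powr \<eta> / measure M (qball M \<rho> x\<^sub>0 (\<rho> x\<^sub>0 y))"
      using * rho_sym[OF X(1,2)] by simp_all
  qed (use eta in auto)
  then show ?thesis by blast
qed

context doubling_space
begin

text \<open>As \<open>0 * \<infinity> = 0\<close> in \<open>ennreal\<close>, a weight that vanishes almost everywhere has \<open>A\<^sub>2\<close> constant \<open>0\<close>.\<close>

lemma A2_weight_dichotomy:
  assumes w: "A2_weight M \<rho> w"
  shows "(AE x in M. w x = 0) \<or> A2_bound w (A2_const M \<rho> w)"
proof (cases "AE x in M. w x = 0")
  case False
  define a where "a = A2_const M \<rho> w"
  have wm [measurable]: "w \<in> borel_measurable M" and w0: "\<And>x. x \<in> space M \<Longrightarrow> 0 \<le> w x"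
    and wi: "\<And>x r. x \<in> space M \<Longrightarrow> 0 < r \<Longrightarrow> set_integrable M (B x r) w" and fin: "a < \<infinity>"
    using w unfolding A2_weight_def weight_def a_def by auto
  define I where "I x r = (\<integral>\<^sup>+y\<in>B x r. ennreal (w y) \<partial>M)" for x r
  define J where "J x r = (\<integral>\<^sup>+y\<in>B x r. inverse (ennreal (w y)) \<partial>M)" for x r
  have prod: "I x r * J x r \<le> a * (ennreal (V x r))\<^sup>2" if x: "x \<in> space M" "0 < r" for x r
  proof -
    have v: "ennreal (V x r) \<noteq> 0" "ennreal (V x r) \<noteq> top" using V_pos[OF x] by auto
    have "average M (B x r) (\<lambda>y. ennreal (w y)) * average M (B x r) (\<lambda>y. inverse (ennreal (w y))) \<le> a"
      unfolding a_def A2_const_def using x by (intro SUP_upper2[of "(x, r)"]) auto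
    then have "(I x r / ennreal (V x r)) * (J x r / ennreal (V x r)) \<le> a"
      unfolding average_def I_def J_def emeasure_B[OF x(1)] .
    then have "(I x r / ennreal (V x r)) * (J x r / ennreal (V x r)) * (ennreal (V x r) * ennreal (V x r)) \<le> a * (ennreal (V x r) * ennreal (V x r))"
      by (rule mult_right_mono) simp
    also have "(I x r / ennreal (V x r)) * (J x r / ennreal (V x r)) * (ennreal (V x r) * ennreal (V x r))
        = (I x r / ennreal (V x r) * ennreal (V x r)) * (J x r / ennreal (V x r) * ennreal (V x r))" by (simp add: mult_ac)
    also have "\<dots> = I x r * J x r" using v by (simp add: ennreal_divide_times ennreal_divide_self less_top)
    finally show ?thesis by (simp add: power2_eq_square)
  qed
  have I_fin: "I x r < \<infinity>" if x: "x \<in> space M" "0 < r" for x r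
  proof -
    have "integrable M (\<lambda>y. indicator (B x r) y *\<^sub>R w y)" using wi[OF x] unfolding set_integrable_def .
    then have "(\<integral>\<^sup>+y. ennreal (norm (indicator (B x r) y *\<^sub>R w y)) \<partial>M) < \<infinity>" by (simp add: integrable_iff_bounded)
    moreover have "I x r \<le> (\<integral>\<^sup>+y. ennreal (norm (indicator (B x r) y *\<^sub>R w y)) \<partial>M)"
      unfolding I_def by (intro nn_integral_mono) (auto simp: indicator_def w0)
    ultimately show ?thesis by (rule le_less_trans[rotated])
  qed
  have J_fin: "J x r < \<infinity>" if x: "x \<in> space M" "0 < r" for x r
  proof -
    \<comment> \<open>The product bound makes \<open>J\<close> finite only where \<open>I\<close>
      does not vanish. As \<open>w\<close> is not zero almost everywhere, some larger concentric
      ball has positive \<open>w\<close>-mass, and \<open>J\<close> grows with the ball.\<close>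
    have "\<exists>n::nat. I x (r + real n) \<noteq> 0"
    proof (rule ccontr)
      assume "\<not> ?thesis"
      then have z: "I x (r + real n) = 0" for n :: nat by auto
      have "AE y in M. ennreal (w y) * indicator (B x (r + real n)) y = 0" for n :: nat
        using z[of n] B_sets[OF x(1)] unfolding I_def by (subst (asm) nn_integral_0_iff_AE) auto
      then have "AE y in M. \<forall>n::nat. ennreal (w y) * indicator (B x (r + real n)) y = 0" by (subst AE_all_countable) blast
      then have "AE y in M. w y = 0" using AE_space
      proof eventually_elim
        case (elim y)
        obtain n :: nat where "\<rho> x y < real n" using reals_Archimedean2 by auto
        then have "y \<in> B x (r + real n)" using elim x by (auto simp: mem_B)
        then have "ennreal (w y) = 0" using elim(1) by (auto dest: spec[of _ n])
        then show ?case using w0[OF elim(2)] by simp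
      qed
      then show False using False by simp
    qed
    then obtain n :: nat where n: "I x (r + real n) \<noteq> 0" by auto
    have pos: "0 < r + real n" using x by simp
    have "I x (r + real n) * J x (r + real n) < \<infinity>"
      using fin by (intro le_less_trans[OF prod[OF x(1) pos]]) (simp add: ennreal_mult_less_top power2_eq_square)
    then have "J x (r + real n) < \<infinity>" using n by (auto simp: ennreal_mult_less_top)
    moreover have "J x r \<le> J x (r + real n)" unfolding J_def using B_mono[of r "r + real n" x]
      by (intro nn_integral_mono) (auto simp: indicator_def)
    ultimately show ?thesis by (rule le_less_trans[rotated])
  qed
  have w_pos: "AE x in M. 0 < w x"
  proof (cases "space M = {}")
    case True
    then show ?thesis by (simp add: AE_iff_null null_sets_def)
  next
    case False
    then obtain x where x: "x \<in> space M" by auto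
    \<comment> \<open>Since \<open>inverse 0 = \<infinity>\<close> in \<open>ennreal\<close>,
      finiteness of \<open>J\<close> on balls that exhaust the space leaves \<open>w\<close> only a
      null set of zeros.\<close>
    have "AE y in M. inverse (ennreal (w y)) * indicator (B x (1 + real n)) y \<noteq> \<infinity>" for n :: nat
      using J_fin[OF x, of "1 + real n"] B_sets[OF x] unfolding J_def by (intro nn_integral_noteq_infinite) auto
    then have "AE y in M. \<forall>n::nat. inverse (ennreal (w y)) * indicator (B x (1 + real n)) y \<noteq> \<infinity>" by (subst AE_all_countable) blast
    then show ?thesis using AE_space
    proof eventually_elim
      case (elim y)
      obtain n :: nat where "\<rho> x y < real n" using reals_Archimedean2 by auto
      then have "y \<in> B x (1 + real n)" using elim by (auto simp: mem_B)
      then have "inverse (ennreal (w y)) \<noteq> \<infinity>" using elim(1) by (auto dest: spec[of _ n])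
      then show ?case using w0[OF elim(2)] by (cases "w y = 0") auto
    qed
  qed
  have J_eq: "J x r = (\<integral>\<^sup>+y\<in>B x r. ennreal (1 / w y) \<partial>M)" for x r
    unfolding J_def using w_pos
    by (intro nn_integral_cong_AE) (auto elim!: eventually_mono simp: inverse_ennreal divide_inverse)
  have "A2_bound w a" unfolding A2_bound_def
    using wm w_pos prod I_fin J_fin unfolding J_eq unfolding I_def by auto
  then show ?thesis unfolding a_def by simp
qed simp

end

lemma (in cz_space) weighted_L2_norm_bound:
  assumes w: "A2_weight M \<rho> w" and f: "f \<in> L2_space M one_weight \<inter> L2_space M w"
  shows "L2_norm M w (T f) \<le> ennreal C\<^sub>A * A2_const M \<rho> w * L2_norm M w f"
proof -
  \<comment> \<open>Serves the two degenerate cases, an empty space and a weight that vanishes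
    almost everywhere.\<close>
  have zero: ?thesis if "(\<integral>\<^sup>+x. ennreal (\<bar>T f x\<bar>\<^sup>2 * w x) \<partial>M) = 0"
    using that unfolding L2_norm_def[of M w "T f"] by simp
  have sf: "sqint M f" using f by (simp add: L2_space_one_iff)
  show ?thesis
  proof (cases "space M = {}")
    case True
    then show ?thesis by (intro zero) (simp add: nn_integral_empty)
  next
    case False
    then obtain x0 where x0: "x0 \<in> space M" by auto
    from A2_weight_dichotomy[OF w] show ?thesis
    proof
      assume "AE x in M. w x = 0"
      then have "(\<integral>\<^sup>+x. ennreal (\<bar>T f x\<bar>\<^sup>2 * w x) \<partial>M) = (\<integral>\<^sup>+x. 0 \<partial>M)"
        by (intro nn_integral_cong_AE) (auto elim!: eventually_mono)
      then show ?thesis by (intro zero) simp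
    next
      assume A2: "A2_bound w (A2_const M \<rho> w)"
      have "A2_const M \<rho> w < \<infinity>" using w unfolding A2_weight_def by simp
      then obtain a where a: "0 \<le> a" "A2_const M \<rho> w = ennreal a" by (cases "A2_const M \<rho> w") auto
      have "L2_norm M w f < \<infinity>" using f unfolding L2_space_def by auto
      then obtain c where c: "0 \<le> c" "L2_norm M w f = ennreal c" "(\<integral>\<^sup>+x. ennreal (\<bar>f x\<bar>\<^sup>2 * w x) \<partial>M) = ennreal (c\<^sup>2)"
        by (rule L2_norm_finiteE)
      have "(\<integral>\<^sup>+x. ennreal ((T f x)\<^sup>2 * w x) \<partial>M) \<le> ennreal ((a * C\<^sub>A * c)\<^sup>2)"
        using A2 c by (intro weighted_L2_bound[OF sf _ a(1) _ _ x0]) (auto simp: a)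
      then have "L2_norm M w (T f) \<le> ennreal (a * C\<^sub>A * c)"
        using a(1) c(1) CA_nonneg by (subst L2_norm_le_iff) auto
      also have "\<dots> = ennreal C\<^sub>A * A2_const M \<rho> w * L2_norm M w f"
        using a c CA_nonneg by (simp add: ennreal_mult mult_ac)
      finally show ?thesis .
    qed
  qed
qed

theorem theorem1p1:
  fixes M :: "'a measure" and \<rho> :: "'a \<Rightarrow> 'a \<Rightarrow> real"
    and T :: "('a \<Rightarrow> real) \<Rightarrow> ('a \<Rightarrow> real)"
  assumes "homogeneous_space M \<rho>"
    and "cz_operator M \<rho> T"
  shows "\<exists>C::real. C \<ge> 0 \<and> (\<forall>w. A2_weight M \<rho> w \<longrightarrow>
           op_norm_L2 M w T \<le> ennreal C * A2_const M \<rho> w \<and>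
           (\<forall>f \<in> L2_space M one_weight \<inter> L2_space M w.
              L2_norm M w (T f) \<le> ennreal C * A2_const M \<rho> w * L2_norm M w f))"
proof -
  obtain A D where "doubling_space M \<rho> A D" using homogeneous_space_doubling[OF assms(1)] by auto
  then obtain K \<eta> b where "cz_space M \<rho> A D T K \<eta> b" using cz_operator_cz_space assms(2) by blast
  then interpret cz_space M \<rho> A D T K \<eta> b .
  show ?thesis
  proof (intro exI[of _ "C\<^sub>A"] conjI allI impI ballI CA_nonneg weighted_L2_norm_bound)
    fix w assume w: "A2_weight M \<rho> w"
    show "op_norm_L2 M w T \<le> ennreal C\<^sub>A * A2_const M \<rho> w"
      unfolding op_norm_L2_def
    proof (rule SUP_least)
      fix f assume f: "f \<in> {f \<in> L2_space M one_weight \<inter> L2_space M w. L2_norm M w f \<le> 1}"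
      then have "L2_norm M w (T f) \<le> ennreal C\<^sub>A * A2_const M \<rho> w * L2_norm M w f"
        by (intro weighted_L2_norm_bound w) simp
      also have "\<dots> \<le> ennreal C\<^sub>A * A2_const M \<rho> w * 1" using f by (intro mult_left_mono) auto
      finally show "L2_norm M w (T f) \<le> ennreal C\<^sub>A * A2_const M \<rho> w" by simp
    qed
  qed
qed

end
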